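(* Suppose $d=d_1+\dots+d_k$ with integers $d_j>1$ for all $1\le j\le k$, and write $x\in\mathbb R^d$ as $x=(x^1,\dots,x^k)$ with $x^j\in\mathbb R^{d_j}$. For $E\subset\mathbb R^d$ compact, define $$\Delta^{(k)}(E)=\left\{\left(|x^1-y^1|,\dots,|x^k-y^k|\right):x,y\in E\right\}\subset\mathbb R^k.$$ If $$\dim_{\mathcal H}(E)>d-\tfrac12\min_{1\le j\le k}\{d_j-1\},$$ then $\Delta^{(k)}(E)$ has nonempty interior in $\mathbb R^k$.
   Context: $\dim_{\mathcal H}$ denotes Hausdorff dimension and $|\cdot|$ the Euclidean norm. *)

theory Defs
  imports "HOL-Analysis.Analysis"
begin

text \<open>
  The gauge function |U|^s of Hausdorff measure, with the usual conventions that the empty set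
  contributes 0 and that 0^0 = 1 (note that \<open>0 powr 0 = 0\<close> in the library).
\<close>

definition hausdorff_gauge :: "real \<Rightarrow> 'a::metric_space set \<Rightarrow> ennreal" where
  "hausdorff_gauge s U =
     (if U = {} then 0 else if s = 0 then 1 else ennreal (diameter U powr s))"

text \<open>
  The covering sets are required to be bounded explicitly because \<^const>\<open>diameter\<close> is 0
  on the unbounded sets of a metric space.  Finite covers are included by padding with the empty set.
\<close>

definition hausdorff_content :: "real \<Rightarrow> real \<Rightarrow> 'a::metric_space set \<Rightarrow> ennreal" where
  "hausdorff_content s \<delta> E =
     (INF U \<in> {U :: nat \<Rightarrow> 'a set.
                 E \<subseteq> (\<Union>i. U i) \<and> (\<forall>i. bounded (U i) \<and> diameter (U i) \<le> \<delta>)}.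
        \<Sum>i. hausdorff_gauge s (U i))"

definition hausdorff_measure :: "real \<Rightarrow> 'a::metric_space set \<Rightarrow> ennreal" where
  "hausdorff_measure s E = (SUP \<delta> \<in> {0<..}. hausdorff_content s \<delta> E)"

definition hausdorff_dim :: "'a::metric_space set \<Rightarrow> ereal" where
  "hausdorff_dim E = (INF s \<in> {s :: real. 0 \<le> s \<and> hausdorff_measure s E = 0}. ereal s)"

text \<open>
  A decomposition of the coordinates of \<open>real ^ 'n\<close> into blocks indexed by \<open>'k\<close> is given by a map
  \<open>b\<close> sending a coordinate to its block.  The component \<open>x^j\<close> of \<open>x\<close> consists of the coordinates
  \<open>x $ i\<close> with \<open>b i = j\<close>, so the dimension \<open>d_j\<close> is the size of the fibre of \<open>b\<close> over \<open>j\<close>, and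
  \<open>block_dist b j x y\<close> is the Euclidean norm of \<open>x^j - y^j\<close>.
\<close>

definition block_dist ::
  "('n::finite \<Rightarrow> 'k) \<Rightarrow> 'k \<Rightarrow> real ^ 'n \<Rightarrow> real ^ 'n \<Rightarrow> real" where
  "block_dist b j x y = L2_set (\<lambda>i. x $ i - y $ i) {i. b i = j}"

definition block_distance_set ::
  "('n::finite \<Rightarrow> 'k::finite) \<Rightarrow> (real ^ 'n) set \<Rightarrow> (real ^ 'k) set" where
  "block_distance_set b E = {(\<chi> j. block_dist b j x y) | x y. x \<in> E \<and> y \<in> E}"

end

theory Submission
  imports Defs "HOL-Probability.Probability"
begin

text \<open>
  This is the Mattila--Sjolin argument, with the measure replaced by its discrete approximations.
  Pick \<open>s\<close> with \<open>d - A < s < dim E\<close>, where \<open>A = min (d\<^sub>j - 1) / 2\<close>.  Frostman's lemma at scale \<open>2\<^sup>-\<^sup>n\<close>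
  gives finitely supported probability measures \<open>\<mu>\<^sub>n\<close> on \<open>E\<close> with \<open>\<mu>\<^sub>n(B(x,r)) \<le> C r\<^sup>s\<close> for \<open>r \<ge> 2\<^sup>-\<^sup>n\<close>.
  Smoothing the distribution of the block distances under \<open>\<mu>\<^sub>n \<times> \<mu>\<^sub>n\<close> by a Gaussian of width \<open>2\<^sup>-\<^sup>n\<close>
  produces the density \<open>\<nu>\<^sub>n(t) = \<integral>exp(- |\<xi>|\<^sup>2 / 4\<^sup>n) |\<mu>\<^sub>n^(\<xi>)|\<^sup>2 \<sigma>\<^sub>t^(\<xi>) d\<xi>\<close>, where \<open>\<sigma>\<^sub>t\<close> is the surface measure of
  the product of the spheres of radii \<open>t\<^sub>j\<close>.  Since \<open>|\<sigma>\<^sub>t^(\<xi>)| \<le> C |\<xi>|\<^sup>-\<^sup>A\<close> and \<open>s > d - A\<close>, these densities are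
  equicontinuous uniformly in \<open>n\<close>, and they carry a definite mass on a fixed box.  Hence \<open>\<nu>\<^sub>n\<close> is bounded
  below on a ball of fixed radius, all of whose points are close to \<open>\<Delta>(E)\<close>; as \<open>\<Delta>(E)\<close> is compact, a limit
  of these balls lies in it.
\<close>

section \<open>Frostman's lemma at a finite scale\<close>

text \<open>The exponent A reflects the worst direction: if \<xi> lies in a single block j, the
  spheres in the other blocks give no decay, so only the power (d_j - 1) / 2 is available there, and
  the minimum over j remains. The decay also degenerates as a radius t_j tends to 0. The mass of the
  densities therefore has to be found on a box where all radii are at least some a > 0, which
  requires that pairs of points with one small block distance carry little mass. For this the
  Frostman condition is formulated for slabs as well as balls; it is effective because s > d - A > d
  - d_j. The decay comes from an ordinary differential equation whose only source is the invariance
  of the sphere measure under rotations in coordinate planes. With that measure realized as a radial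
  projection of Lebesgue measure, the invariance is inherited from Lebesgue measure, and the lower
  bound for the mass becomes a polar change of variables. Positivity and localization are read off
  in physical space, regularity on the Fourier side. All constants are independent of n, so in the
  end a limit is taken only of points in the space of radii.\<close>

lemma saturated_weights_exist:
  fixes S :: "'i \<Rightarrow> 'a set" and c :: "'i \<Rightarrow> real"
  assumes "finite P" "finite I" and c: "\<And>i. i \<in> I \<Longrightarrow> 0 \<le> c i"
    and covered: "\<And>x. x \<in> P \<Longrightarrow> \<exists>i\<in>I. x \<in> S i"
  shows "\<exists>w. (\<forall>x. 0 \<le> w x) \<and> (\<forall>i\<in>I. sum w (P \<inter> S i) \<le> c i) \<and>
             (\<forall>x\<in>P. \<exists>i\<in>I. x \<in> S i \<and> sum w (P \<inter> S i) = c i)"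
  using assms(1) covered
proof (induction P rule: finite_induct)
  case empty
  show ?case using c by (intro exI[of _ "\<lambda>_. 0"]) auto
next
  case (insert x P)
  then obtain w where w: "\<And>y. 0 \<le> w y" "\<And>i. i \<in> I \<Longrightarrow> sum w (P \<inter> S i) \<le> c i"
      "\<And>y. y \<in> P \<Longrightarrow> \<exists>i\<in>I. y \<in> S i \<and> sum w (P \<inter> S i) = c i"
    by (metis insertCI)
  define J where "J = {i \<in> I. x \<in> S i}"
  \<comment> \<open>Greedy choice: the new point receives the least slack among the constraints that
    contain it. This makes one of them tight and violates none.\<close>
  define \<delta> where "\<delta> = Min ((\<lambda>i. c i - sum w (P \<inter> S i)) ` J)"
  have J: "finite J" "J \<noteq> {}" using insert.prems assms(2) by (auto simp: J_def)
  have \<delta>_le: "\<delta> \<le> c i - sum w (P \<inter> S i)" if "i \<in> J" for i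
    using J that by (auto simp: \<delta>_def)
  have "\<delta> \<in> (\<lambda>i. c i - sum w (P \<inter> S i)) ` J"
    using J unfolding \<delta>_def by (intro Min_in) auto
  then obtain i0 where i0: "i0 \<in> J" "\<delta> = c i0 - sum w (P \<inter> S i0)" by auto
  have \<delta>0: "0 \<le> \<delta>" using i0 w(2) by (auto simp: J_def)
  define w' where "w' = w(x := \<delta>)"
  have out: "sum w' (insert x P \<inter> S i) = sum w (P \<inter> S i)" if "x \<notin> S i" for i
    using that insert.hyps by (auto simp: w'_def intro!: sum.cong)
  have into: "sum w' (insert x P \<inter> S i) = \<delta> + sum w (P \<inter> S i)" if "x \<in> S i" for i
  proof -
    have "insert x P \<inter> S i = insert x (P \<inter> S i)" using that by auto
    moreover have "sum w' (P \<inter> S i) = sum w (P \<inter> S i)"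
      using insert.hyps by (auto simp: w'_def intro!: sum.cong)
    ultimately show ?thesis using insert.hyps by (simp add: w'_def)
  qed
  have feas: "sum w' (insert x P \<inter> S i) \<le> c i" if "i \<in> I" for i
    using out[of i] into[of i] w(2)[OF that] \<delta>_le[of i] that by (cases "x \<in> S i") (auto simp: J_def)
  show ?case
  proof (intro exI[of _ w'] conjI ballI allI)
    fix y show "0 \<le> w' y" using w(1) \<delta>0 by (simp add: w'_def)
  next
    fix i assume "i \<in> I" then show "sum w' (insert x P \<inter> S i) \<le> c i" by (rule feas)
  next
    fix y assume y: "y \<in> insert x P"
    show "\<exists>i\<in>I. y \<in> S i \<and> sum w' (insert x P \<inter> S i) = c i"
    proof (cases "y = x")
      case True
      then show ?thesis using i0 into[of i0] by (intro bexI[of _ i0]) (auto simp: J_def)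
    next
      case False
      then obtain i where i: "i \<in> I" "y \<in> S i" "sum w (P \<inter> S i) = c i" using w(3) y by blast
      \<comment> \<open>Old weights are kept and the new one is nonnegative, so a constraint that
        was tight still reaches its capacity; feasibility turns this into equality.\<close>
      have "sum w' (insert x P \<inter> S i) \<ge> c i" using i out[of i] into[of i] \<delta>0 by (cases "x \<in> S i") auto
      with feas[OF i(1)] i show ?thesis by (intro bexI[of _ i]) auto
    qed
  qed
qed

section \<open>Half-open dyadic cubes of side 2^-m, as the fibres of their index\<close>

definition cube_index :: "nat \<Rightarrow> real ^ 'n \<Rightarrow> 'n \<Rightarrow> int" where
  "cube_index m x = (\<lambda>i. \<lfloor>2 ^ m * x $ i\<rfloor>)"

text \<open>Dyadic cubes are nested: in each coordinate the coarse index is the integer quotient of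
  the fine one by \<open>2 ^ (m' - m)\<close>.\<close>

lemma cube_index_refine:
  assumes "cube_index m' x = cube_index m' y" "m \<le> m'"
  shows "cube_index m x = cube_index m y"
proof
  fix i
  have *: "\<lfloor>2 ^ m * z\<rfloor> = \<lfloor>2 ^ m' * z\<rfloor> div 2 ^ (m' - m)" for z :: real
  proof -
    have "(2::real) ^ m' = 2 ^ m * 2 ^ (m' - m)"
      using assms(2) by (simp flip: power_add)
    then have "2 ^ m * z = (2 ^ m' * z) / of_int (2 ^ (m' - m))"
      by (simp only: of_int_power of_int_numeral) simp
    then show ?thesis by (simp only: floor_divide_real_eq_div zero_le_power)
  qed
  show "cube_index m x i = cube_index m y i"
    using fun_cong[OF assms(1), of i] unfolding cube_index_def *[of "x $ i"] *[of "y $ i"] by simp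
qed

lemma cube_index_dist:
  fixes x y :: "real ^ 'n"
  assumes "cube_index m x = cube_index m y"
  shows "dist x y \<le> real CARD('n) / 2 ^ m"
proof -
  have "\<bar>(x - y) $ i\<bar> \<le> 1 / 2 ^ m" for i
  proof -
    have "\<lfloor>2 ^ m * x $ i\<rfloor> = \<lfloor>2 ^ m * y $ i\<rfloor>"
      using fun_cong[OF assms, of i] by (simp add: cube_index_def)
    then have "\<bar>2 ^ m * x $ i - 2 ^ m * y $ i\<bar> < 1" by linarith
    then have "2 ^ m * \<bar>x $ i - y $ i\<bar> < 1"
      by (metis abs_mult abs_numeral power_abs right_diff_distrib)
    then show ?thesis by (simp add: field_simps)
  qed
  then have "(\<Sum>i\<in>UNIV. \<bar>(x - y) $ i\<bar>) \<le> (\<Sum>i\<in>(UNIV::'n set). 1 / 2 ^ m)" by (intro sum_mono)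
  then show ?thesis using norm_le_l1_cart[of "x - y"] by (simp add: dist_norm)
qed

lemma finite_cube_index_image:
  fixes E :: "(real ^ 'n) set"
  assumes "bounded E"
  shows "finite (cube_index m ` E)"
proof -
  obtain L where L: "\<And>x. x \<in> E \<Longrightarrow> norm x \<le> L" using assms by (auto simp: bounded_iff)
  have "cube_index m ` E \<subseteq> PiE UNIV (\<lambda>i. {\<lfloor>- (2 ^ m * L)\<rfloor>..\<lfloor>2 ^ m * L\<rfloor>})"
  proof (clarsimp simp: PiE_iff)
    fix x i assume "x \<in> E"
    then have "\<bar>x $ i\<bar> \<le> L" using L component_le_norm_cart[of x i] by fastforce
    then have "2 ^ m * x $ i \<le> 2 ^ m * L" "2 ^ m * (- L) \<le> 2 ^ m * x $ i"
      by (intro mult_left_mono; simp)+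
    then show "\<lfloor>- (2 ^ m * L)\<rfloor> \<le> cube_index m x i \<and> cube_index m x i \<le> \<lfloor>2 ^ m * L\<rfloor>"
      unfolding cube_index_def by (auto intro!: floor_mono)
  qed
  then show ?thesis by (rule finite_subset) (intro finite_PiE; simp)
qed

text \<open>Enumerating the cover and continuing with empty sets, whose gauge is 0, gives an
  admissible sequence. Upper bounds \<open>r Q\<close> for the diameters suffice, since the power is
  monotone for 0 < s.\<close>

lemma hausdorff_content_le_finite_cover:
  assumes fin: "finite M" and cov: "E \<subseteq> (\<Union>Q\<in>M. V Q)"
    and V: "\<And>Q. Q \<in> M \<Longrightarrow> bounded (V Q) \<and> diameter (V Q) \<le> r Q \<and> r Q \<le> \<delta>"
    and "0 \<le> \<delta>" "0 < s"
  shows "hausdorff_content s \<delta> E \<le> ennreal (\<Sum>Q\<in>M. r Q powr s)"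
proof -
  obtain e where e: "bij_betw e {..<card M} M" using ex_bij_betw_nat_finite[OF fin] by (auto simp: atLeast0LessThan)
  define U where "U = (\<lambda>i. if i < card M then V (e i) else {})"
  have e_in: "e i \<in> M" if "i < card M" for i using e that by (auto simp: bij_betw_def)
  have "E \<subseteq> (\<Union>i. U i)"
  proof
    fix x assume "x \<in> E"
    then obtain Q where "Q \<in> M" "x \<in> V Q" using cov by auto
    moreover from this e obtain i where "i < card M" "e i = Q"
      by (metis bij_betw_imp_surj_on imageE lessThan_iff)
    ultimately show "x \<in> (\<Union>i. U i)" by (auto simp: U_def intro!: exI[of _ i])
  qed
  moreover have "bounded (U i) \<and> diameter (U i) \<le> \<delta>" for i
    using V[OF e_in, of i] assms(4) by (auto simp: U_def)
  ultimately have "hausdorff_content s \<delta> E \<le> (\<Sum>i. hausdorff_gauge s (U i))"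
    unfolding hausdorff_content_def by (intro INF_lower) auto
  also have "\<dots> = (\<Sum>i<card M. hausdorff_gauge s (U i))"
    by (intro suminf_finite) (auto simp: U_def hausdorff_gauge_def)
  also have "\<dots> \<le> (\<Sum>i<card M. ennreal (r (e i) powr s))"
  proof (intro sum_mono)
    fix i assume "i \<in> {..<card M}"
    then have "V (e i) = {} \<or> diameter (U i) powr s \<le> r (e i) powr s"
      using V[OF e_in, of i] diameter_ge_0[of "V (e i)"] assms(5)
      by (auto simp: U_def intro!: powr_mono2)
    then show "hausdorff_gauge s (U i) \<le> ennreal (r (e i) powr s)"
      using \<open>i \<in> _\<close> assms(5) by (auto simp: hausdorff_gauge_def U_def intro!: ennreal_leI)
  qed
  also have "\<dots> = ennreal (\<Sum>i<card M. r (e i) powr s)" by (intro sum_ennreal) auto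
  also have "(\<Sum>i<card M. r (e i) powr s) = (\<Sum>Q\<in>M. r Q powr s)"
    by (rule sum.reindex_bij_betw[OF e])
  finally show ?thesis .
qed

lemma dyadic_powr: "(1 / 2 ^ m) powr s = 2 powr (- (real m * s))"
proof -
  have "(1::real) / 2 ^ m = 2 powr (- real m)" by (simp add: powr_minus powr_realpow divide_inverse)
  then show ?thesis by (simp add: powr_powr)
qed

text \<open>Give each cube of level m between \<open>m0\<close> and n the capacity 2^(-m s) and
  choose weights that saturate a cube around every point. The coarsest saturated cubes are disjoint
  and cover E; up to the factor \<open>d powr s\<close> their weights bound their gauges, so
  together they dominate the Hausdorff content. Hence the total mass is bounded below independently
  of n, and normalizing it to 1 costs only a constant.\<close>

lemma frostman_cubes:
  fixes E :: "(real ^ 'n) set"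
  assumes "bounded E" "0 < s" "hausdorff_measure s E \<noteq> 0"
  shows "\<exists>C>0. \<forall>n. \<exists>P w. finite P \<and> P \<subseteq> E \<and> (\<forall>x. 0 \<le> w x) \<and> sum w P = 1 \<and>
           (\<forall>m\<le>n. \<forall>q. sum w {x\<in>P. cube_index m x = q} \<le> C * 2 powr (- (real m * s)))"
proof -
  define d where "d = real CARD('n)"
  have d0: "d > 0" by (simp add: d_def)
  obtain \<delta> where \<delta>: "\<delta> > 0" "hausdorff_content s \<delta> E \<noteq> 0"
  proof -
    have "\<exists>\<delta>\<in>{0<..}. hausdorff_content s \<delta> E \<noteq> 0"
      using assms(3) unfolding hausdorff_measure_def by (metis SUP_eq_const bot_ennreal SUP_bot_conv(1) image_cong)
    then show ?thesis using that by auto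
  qed
  obtain h where h: "h > 0" "ennreal h \<le> hausdorff_content s \<delta> E"
  proof -
    have "0 < hausdorff_content s \<delta> E" using \<delta>(2) by (simp add: zero_less_iff_neq_zero)
    then obtain y where y: "0 < y" "y < hausdorff_content s \<delta> E" using dense by blast
    then have "y < top" by (metis order.strict_trans2 top_greatest)
    then have "ennreal (enn2real y) = y" by simp
    with y have "enn2real y > 0" "ennreal (enn2real y) \<le> hausdorff_content s \<delta> E"
      by (auto simp: enn2real_positive_iff \<open>y < top\<close>)
    then show ?thesis by (rule that)
  qed
  have "E \<noteq> {}"
  proof
    assume "E = {}"
    then have "hausdorff_content s \<delta> E \<le> ennreal (\<Sum>Q\<in>({}::unit set). (0::real) powr s)"
      using \<delta> assms(2) by (intro hausdorff_content_le_finite_cover[where V="\<lambda>_. {}"]) auto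
    with \<delta>(2) show False by simp
  qed
  then obtain x0 where x0: "x0 \<in> E" by auto
  \<comment> \<open>From level \<open>m0\<close> on the cubes are small enough for the content at
    scale \<delta>.\<close>
  obtain m0 :: nat where m0: "d / 2 ^ m0 \<le> \<delta>"
  proof -
    obtain m0 where "d / \<delta> < 2 ^ m0" using real_arch_pow[of 2 "d / \<delta>"] by auto
    then have "d / 2 ^ m0 \<le> \<delta>" using \<delta>(1) by (simp add: field_simps)
    then show ?thesis by (rule that)
  qed
  \<comment> \<open>The first summand makes the bound at least the total mass 1 on levels coarser
    than \<open>m0\<close>; the second is the price of normalizing.\<close>
  define C where "C = 2 powr (real m0 * s) + d powr s / h"
  have C: "C > 0" "2 powr (real m0 * s) \<le> C" "d powr s / h \<le> C"
    using h d0 by (auto simp: C_def add_pos_pos)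
  have small: "1 \<le> C * 2 powr (- (real m * s))" if "m < m0" for m
  proof -
    have "1 \<le> 2 powr (real m0 * s) * 2 powr (- (real m * s))"
      using that assms(2) by (simp add: powr_add[symmetric] ge_one_powr_ge_zero)
    also have "\<dots> \<le> C * 2 powr (- (real m * s))" using C by (intro mult_right_mono) auto
    finally show ?thesis .
  qed
  show ?thesis
  proof (intro exI[of _ C] conjI allI)
    fix n :: nat
    show "\<exists>P w. finite P \<and> P \<subseteq> E \<and> (\<forall>x. 0 \<le> w x) \<and> sum w P = 1 \<and>
           (\<forall>m\<le>n. \<forall>q. sum w {x\<in>P. cube_index m x = q} \<le> C * 2 powr (- (real m * s)))"
    proof (cases "n < m0")
      \<comment> \<open>Only levels coarser than \<open>m0\<close> are tested, so a unit mass at one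
        point will do.\<close>
      case True
      have "sum (\<lambda>_. 1) {x \<in> {x0}. cube_index m x = q} \<le> C * 2 powr (- (real m * s))" if "m \<le> n" for m q
      proof -
        have "sum (\<lambda>_. 1::real) {x \<in> {x0}. cube_index m x = q} \<le> sum (\<lambda>_. 1) {x0}"
          by (intro sum_mono2) auto
        then show ?thesis using small[of m] that True by auto
      qed
      then show ?thesis using x0 by (intro exI[of _ "{x0}"] exI[of _ "\<lambda>_. 1"]) simp
    next
      case False
      \<comment> \<open>One point of E in each level-n cube that meets E.\<close>
      define P where "P = inv_into E (cube_index n) ` (cube_index n ` E)"
      have P: "finite P" "P \<subseteq> E"
        using finite_cube_index_image[OF assms(1)] by (auto simp: P_def inv_into_into)
      have P_rep: "\<exists>y\<in>P. cube_index n y = cube_index n x" if "x \<in> E" for x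
        using that f_inv_into_f[of "cube_index n x" "cube_index n" E] by (auto simp: P_def)
      define I where "I = Sigma {m0..n} (\<lambda>m. cube_index m ` P)"
      define S :: "nat \<times> ('n \<Rightarrow> int) \<Rightarrow> (real ^ 'n) set" where "S = (\<lambda>(m, q). {x. cube_index m x = q})"
      define c :: "nat \<times> ('n \<Rightarrow> int) \<Rightarrow> real" where "c = (\<lambda>(m, q). 2 powr (- (real m * s)))"
      have "finite I" using P by (auto simp: I_def)
      moreover have "\<exists>i\<in>I. x \<in> S i" if "x \<in> P" for x
        using that False by (intro bexI[of _ "(n, cube_index n x)"]) (auto simp: I_def S_def)
      moreover have "0 \<le> c i" for i by (simp add: c_def split_beta)
      ultimately obtain w where w: "\<And>x. 0 \<le> w x" "\<And>i. i \<in> I \<Longrightarrow> sum w (P \<inter> S i) \<le> c i"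
          "\<And>x. x \<in> P \<Longrightarrow> \<exists>i\<in>I. x \<in> S i \<and> sum w (P \<inter> S i) = c i"
        using saturated_weights_exist[OF P(1), of I c S] by metis
      define sat where "sat = (\<lambda>x m. m0 \<le> m \<and> m \<le> n \<and>
          sum w (P \<inter> S (m, cube_index m x)) = c (m, cube_index m x))"
      \<comment> \<open>The coarsest saturated level at x. This minimality is what makes the
        selected cubes disjoint.\<close>
      define k where "k = (\<lambda>x. LEAST m. sat x m)"
      have sat_k: "sat x (k x)" if x: "x \<in> P" for x
      proof -
        obtain m q where "(m, q) \<in> I" "x \<in> S (m, q)" "sum w (P \<inter> S (m, q)) = c (m, q)" using w(3)[OF x] by auto
        then have "sat x m" by (auto simp: I_def S_def sat_def)
        then show ?thesis unfolding k_def by (rule LeastI)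
      qed
      have k_le: "k x \<le> m" if "sat x m" for x m using that unfolding k_def by (rule Least_le)
      define M where "M = (\<lambda>x. (k x, cube_index (k x) x)) ` P"
      have finM: "finite M" using P by (simp add: M_def)
      \<comment> \<open>If two selected cubes share a point z, the finer one lies in the coarser one
        by nesting. The coarser one is then a saturated cube around y too, and minimality of
        \<open>k y\<close> forces equal levels.\<close>
      have meet: "k x = k y \<and> cube_index (k x) x = cube_index (k y) y"
        if "x \<in> P" "y \<in> P" "cube_index (k x) z = cube_index (k x) x" "cube_index (k y) z = cube_index (k y) y"
          "k x \<le> k y" for x y z
      proof -
        have "cube_index (k x) z = cube_index (k x) y" using cube_index_refine that(4,5) by blast
        then have e: "cube_index (k x) y = cube_index (k x) x" using that(3) by simp
        then have "sat y (k x)" using sat_k[OF that(1)] by (simp add: sat_def)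
        then have "k y \<le> k x" by (rule k_le)
        then show ?thesis using that(5) e by auto
      qed
      have disj: "(P \<inter> S Q) \<inter> (P \<inter> S Q') = {}" if Q: "Q \<in> M" "Q' \<in> M" "Q \<noteq> Q'" for Q Q'
      proof (rule ccontr)
        assume "(P \<inter> S Q) \<inter> (P \<inter> S Q') \<noteq> {}"
        then obtain z where z: "z \<in> S Q" "z \<in> S Q'" by auto
        obtain x y where xy: "x \<in> P" "y \<in> P" "Q = (k x, cube_index (k x) x)" "Q' = (k y, cube_index (k y) y)"
          using Q by (auto simp: M_def)
        then have "cube_index (k x) z = cube_index (k x) x" "cube_index (k y) z = cube_index (k y) y"
          using z by (auto simp: S_def)
        then have "Q = Q'" using meet[of x y z] meet[of y x z] xy by (cases "k x \<le> k y") auto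
        with Q(3) show False by simp
      qed
      \<comment> \<open>All of E is covered, not just P: x shares its level-n cube with a
        representative y, hence also the coarser selected cube of y.\<close>
      have "E \<subseteq> (\<Union>Q\<in>M. S Q)"
      proof
        fix x assume "x \<in> E"
        then obtain y where y: "y \<in> P" "cube_index n y = cube_index n x" using P_rep by blast
        then have "cube_index (k y) y = cube_index (k y) x"
          using cube_index_refine sat_k[OF y(1)] by (metis sat_def)
        then have "x \<in> S (k y, cube_index (k y) y)" by (simp add: S_def)
        moreover have "(k y, cube_index (k y) y) \<in> M" using y(1) by (simp add: M_def)
        ultimately show "x \<in> (\<Union>Q\<in>M. S Q)" by blast
      qed
      then have "hausdorff_content s \<delta> E \<le> ennreal (\<Sum>Q\<in>M. (d / 2 ^ fst Q) powr s)"
      proof (rule hausdorff_content_le_finite_cover[OF finM])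
        fix Q assume "Q \<in> M"
        then obtain m q where Q: "Q = (m, q)" "m0 \<le> m" using sat_k by (force simp: M_def sat_def)
        have dist: "dist x y \<le> d / 2 ^ m" if "x \<in> S Q" "y \<in> S Q" for x y
          using that cube_index_dist[of m x y] by (simp add: S_def Q d_def)
        have "bounded (S Q)" by (auto simp: bounded_two_points intro: dist)
        moreover have "diameter (S Q) \<le> d / 2 ^ m"
          using d0 by (intro diameter_le) (auto intro!: dist simp: dist_norm[symmetric])
        moreover have "d / 2 ^ m \<le> d / 2 ^ m0" using Q d0 by (intro divide_left_mono power_increasing) auto
        ultimately show "bounded (S Q) \<and> diameter (S Q) \<le> d / 2 ^ fst Q \<and> d / 2 ^ fst Q \<le> \<delta>"
          using m0 Q by auto
      qed (use \<delta> assms(2) in auto)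
      \<comment> \<open>Saturation identifies the power of the side length with the weight of the
        cube.\<close>
      also have "(\<Sum>Q\<in>M. (d / 2 ^ fst Q) powr s) = (\<Sum>Q\<in>M. d powr s * sum w (P \<inter> S Q))"
      proof (intro sum.cong refl)
        fix Q assume "Q \<in> M"
        then have "sum w (P \<inter> S Q) = c Q" using sat_k by (auto simp: M_def sat_def)
        also have "c Q = 2 powr (- (real (fst Q) * s))" by (simp add: c_def split_beta)
        also have "\<dots> = (1 / 2 ^ fst Q) powr s"
          by (simp add: dyadic_powr)
        finally show "(d / 2 ^ fst Q) powr s = d powr s * sum w (P \<inter> S Q)"
          using d0 powr_mult[of d "1 / 2 ^ fst Q" s] by simp
      qed
      also have "\<dots> = d powr s * sum w (\<Union>Q\<in>M. P \<inter> S Q)"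
        using finM P disj by (subst sum.UNION_disjoint) (auto simp: sum_distrib_left)
      also have "\<dots> \<le> d powr s * sum w P"
        using P w(1) by (intro mult_left_mono sum_mono2) auto
      finally have "ennreal h \<le> ennreal (d powr s * sum w P)"
        using h(2) by (meson ennreal_leI order.trans)
      moreover have "0 \<le> d powr s * sum w P" using w(1) by (simp add: sum_nonneg)
      ultimately have hW: "h \<le> d powr s * sum w P" by simp
      then have W: "sum w P > 0" using h(1) d0
        by (smt (verit) mult_nonneg_nonpos powr_ge_zero)
      define w' where "w' = (\<lambda>x. w x / sum w P)"
      have tot: "sum w' P = 1" using W by (simp add: w'_def sum_divide_distrib[symmetric])
      have "sum w' {x\<in>P. cube_index m x = q} \<le> C * 2 powr (- (real m * s))" if "m \<le> n" for m q
      proof (cases "m < m0")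
        case True
        have "sum w' {x\<in>P. cube_index m x = q} \<le> sum w' P"
          using P w(1) W by (intro sum_mono2) (auto simp: w'_def)
        then show ?thesis using tot small[OF True] by simp
      next
        case m: False
        show ?thesis
        proof (cases "q \<in> cube_index m ` P")
          case True
          then have "(m, q) \<in> I" using m that by (auto simp: I_def)
          then have "sum w (P \<inter> S (m, q)) \<le> 2 powr (- (real m * s))" using w(2) by (force simp: c_def)
          moreover have "P \<inter> S (m, q) = {x\<in>P. cube_index m x = q}" by (auto simp: S_def)
          ultimately have "sum w' {x\<in>P. cube_index m x = q} \<le> 1 / sum w P * 2 powr (- (real m * s))"
            using W by (simp add: w'_def sum_divide_distrib[symmetric] divide_right_mono)
          also have "1 / sum w P \<le> d powr s / h" using hW W h by (simp add: field_simps)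
          also have "\<dots> \<le> C" by (rule C(3))
          finally show ?thesis by (simp add: mult_right_mono)
        next
          case False
          then have "{x\<in>P. cube_index m x = q} = {}" by auto
          then show ?thesis using C by (simp only: sum.empty) simp
        qed
      qed
      then show ?thesis using P w(1) W tot
        by (intro exI[of _ P] exI[of _ w']) (auto simp: w'_def)
    qed
  qed (use C in auto)
qed

text \<open>A coordinate in J admits three indices, because 2^m r \<le> 1, and any other at most 2 L
  2^m + 2. The factor 6 L absorbs both cases since 1 \<le> L.\<close>

lemma card_slab_cubes:
  fixes x :: "real ^ 'n" and J :: "'n set"
  assumes "1 \<le> L" "0 \<le> r" "2 ^ m * r \<le> 1"
  shows "\<exists>T. finite T \<and> real (card T) \<le> (6 * L) ^ CARD('n) * (2 ^ m) ^ card (- J) \<and>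
     (\<forall>y. (\<forall>i. \<bar>y $ i\<bar> \<le> L) \<longrightarrow> (\<forall>i\<in>J. \<bar>x $ i - y $ i\<bar> \<le> r) \<longrightarrow> cube_index m y \<in> T)"
proof -
  define B where "B = (\<lambda>i. if i \<in> J then {cube_index m x i - 1..cube_index m x i + 1}
     else {\<lfloor>- (2 ^ m * L)\<rfloor>..\<lfloor>2 ^ m * L\<rfloor>})"
  have finB: "finite (B i)" for i by (simp add: B_def)
  have cardB: "real (card (B i)) \<le> 6 * L * (if i \<in> J then 1 else 2 ^ m)" for i
  proof (cases "i \<in> J")
    case True
    then show ?thesis using assms(1) by (simp add: B_def)
  next
    case False
    have "1 \<le> (2::real) ^ m" by simp
    then have "1 * 1 \<le> 2 ^ m * L" using assms(1) by (intro mult_mono) auto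
    moreover have "real (card (B i)) \<le> 2 * (2 ^ m * L) + 2"
    proof -
      have "real (nat (\<lfloor>a\<rfloor> - \<lfloor>- a\<rfloor> + 1)) \<le> 2 * a + 2" if "0 \<le> a" for a :: real
        using that by linarith
      from this[of "2 ^ m * L"] show ?thesis using False assms(1) by (simp add: B_def)
    qed
    ultimately show ?thesis using False by (simp add: algebra_simps)
  qed
  have "real (card (PiE UNIV B)) = (\<Prod>i\<in>UNIV. real (card (B i)))" by (simp add: card_PiE)
  also have "\<dots> \<le> (\<Prod>i\<in>UNIV. 6 * L * (if i \<in> J then 1 else 2 ^ m))"
    using cardB by (intro prod_mono) auto
  also have "\<dots> = (6 * L) ^ CARD('n) * (\<Prod>i\<in>UNIV. if i \<in> J then 1 else 2 ^ m)"
    by (simp add: prod.distrib)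
  also have "(\<Prod>i\<in>UNIV. if i \<in> J then 1 else (2::real) ^ m) = (2 ^ m) ^ card (- J)"
    by (simp add: prod.If_cases)
  finally have card: "real (card (PiE UNIV B)) \<le> (6 * L) ^ CARD('n) * (2 ^ m) ^ card (- J)" .
  have "cube_index m y \<in> PiE UNIV B"
    if y: "\<forall>i. \<bar>y $ i\<bar> \<le> L" "\<forall>i\<in>J. \<bar>x $ i - y $ i\<bar> \<le> r" for y :: "real ^ 'n"
  proof (clarsimp simp: PiE_iff)
    fix i
    show "cube_index m y i \<in> B i"
    proof (cases "i \<in> J")
      case True
      have "2 ^ m * \<bar>x $ i - y $ i\<bar> \<le> 2 ^ m * r" using y(2) True by (intro mult_left_mono) auto
      then have "2 ^ m * \<bar>x $ i - y $ i\<bar> \<le> 1" using assms(3) by linarith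
      then have "\<bar>2 ^ m * x $ i - 2 ^ m * y $ i\<bar> \<le> 1"
        by (metis abs_mult abs_numeral power_abs right_diff_distrib)
      then show ?thesis using True by (simp add: B_def cube_index_def) linarith
    next
      case False
      have "y $ i \<le> L" "- L \<le> y $ i" using y(1) by (auto simp: abs_le_iff dest: spec[of _ i])
      then have "2 ^ m * y $ i \<le> 2 ^ m * L" "2 ^ m * (- L) \<le> 2 ^ m * y $ i"
        by (intro mult_left_mono; simp)+
      then show ?thesis using False unfolding cube_index_def B_def by (auto intro!: floor_mono)
    qed
  qed
  with card finB show ?thesis by (intro exI[of _ "PiE UNIV B"]) (auto intro!: finite_PiE)
qed

text \<open>
  The ball condition \<open>\<mu>(B(x,r)) \<le> C r\<^sup>s\<close> of Frostman's lemma is the case \<open>J = UNIV\<close>; the slabs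
  with smaller \<open>J\<close> control the pairs of points whose distance in one block is small.
\<close>

definition frostman_weights ::
  "real \<Rightarrow> real \<Rightarrow> nat \<Rightarrow> (real ^ 'n) set \<Rightarrow> (real ^ 'n \<Rightarrow> real) \<Rightarrow> bool" where
  "frostman_weights C s n P w \<longleftrightarrow> finite P \<and> (\<forall>x. 0 \<le> w x) \<and> sum w P = 1 \<and>
     (\<forall>J r x. 1 / 2 ^ n \<le> r \<longrightarrow> r \<le> 1 \<longrightarrow>
        sum w {y\<in>P. \<forall>i\<in>J. \<bar>x $ i - y $ i\<bar> \<le> r} \<le> C * r powr (s - real (card (- J))))"

text \<open>Within a bounded region a slab of thickness r meets O(r^(-c)) cubes of side comparable
  to r, where c is the number of free coordinates. Each of them has mass O(r^s), and the product has
  the exponent s - c.\<close>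

theorem discrete_frostman:
  fixes E :: "(real ^ 'n) set"
  assumes "bounded E" "0 < s" "hausdorff_measure s E \<noteq> 0"
  shows "\<exists>C>0. \<forall>n. \<exists>P w. P \<subseteq> E \<and> frostman_weights C s n P w"
proof -
  obtain C where C: "C > 0" "\<And>n. \<exists>P w. finite P \<and> P \<subseteq> E \<and> (\<forall>x. 0 \<le> w x) \<and> sum w P = 1 \<and>
           (\<forall>m\<le>n. \<forall>q. sum w {x\<in>P. cube_index m x = q} \<le> C * 2 powr (- (real m * s)))"
    using frostman_cubes[OF assms] by blast
  obtain L where L: "\<And>x. x \<in> E \<Longrightarrow> norm x \<le> L" using assms(1) by (auto simp: bounded_iff)
  define L' where "L' = max 1 L"
  have L'1: "1 \<le> L'" by (simp add: L'_def)
  have E_L': "\<bar>x $ i\<bar> \<le> L'" if "x \<in> E" for x i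
    using L[OF that] component_le_norm_cart[of x i] by (simp add: L'_def)
  define C' where "C' = (6 * L') ^ CARD('n) * C * 2 powr s"
  show ?thesis
  proof (intro exI[of _ C'] conjI allI)
    show "0 < C'" using C L'1 by (simp add: C'_def)
    fix n
    obtain P w where P: "finite P" "P \<subseteq> E" and w: "\<And>x. 0 \<le> w x" "sum w P = 1"
      and cube: "\<And>m q. m \<le> n \<Longrightarrow> sum w {x\<in>P. cube_index m x = q} \<le> C * 2 powr (- (real m * s))"
      using C(2)[of n] by blast
    have "sum w {y\<in>P. \<forall>i\<in>J. \<bar>x $ i - y $ i\<bar> \<le> r} \<le> C' * r powr (s - real (card (- J)))"
      if r: "1 / 2 ^ n \<le> r" "r \<le> 1" for J r x
    proof -
      have r0: "r > 0" using r(1) by (smt (verit) divide_pos_pos zero_less_power)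
      \<comment> \<open>The finest level whose cubes have side at least r, so that r \<le> 2^-m
        \<le> 2 r. The lower bound on r gives m \<le> n, where the cube estimate is
        available.\<close>
      define m where "m = (GREATEST m. 2 ^ m * r \<le> 1)"
      have bound: "m \<le> n" if "2 ^ m * r \<le> 1" for m
      proof -
        have "2 ^ m * (1 / 2 ^ n) \<le> 2 ^ m * r" using r(1) by (intro mult_left_mono) auto
        also note that
        finally have "(2::real) ^ m \<le> 2 ^ n" by (simp add: divide_le_eq)
        then show ?thesis by simp
      qed
      have m: "2 ^ m * r \<le> 1"
        unfolding m_def by (rule GreatestI_nat[of _ 0 n]) (use r bound in auto)
      have "\<not> 2 ^ Suc m * r \<le> 1"
      proof
        assume "2 ^ Suc m * r \<le> 1"
        then have "Suc m \<le> m"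
          unfolding m_def by (intro Greatest_le_nat[of _ _ n]) (use bound in auto)
        then show False by simp
      qed
      then have m': "1 / 2 ^ m \<le> 2 * r" by (simp add: field_simps)
      obtain T where T: "finite T" "real (card T) \<le> (6 * L') ^ CARD('n) * (2 ^ m) ^ card (- J)"
          "\<And>y. (\<forall>i. \<bar>y $ i\<bar> \<le> L') \<Longrightarrow> (\<forall>i\<in>J. \<bar>x $ i - y $ i\<bar> \<le> r) \<Longrightarrow> cube_index m y \<in> T"
        using card_slab_cubes[OF L'1, of r m J x] r0 m by auto
      have "sum w {y\<in>P. \<forall>i\<in>J. \<bar>x $ i - y $ i\<bar> \<le> r} \<le> sum w (\<Union>q\<in>T. {y\<in>P. cube_index m y = q})"
        using P T E_L' w(1) by (intro sum_mono2) auto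
      also have "\<dots> \<le> (\<Sum>q\<in>T. sum w {y\<in>P. cube_index m y = q})"
        using T(1) P w(1) by (subst sum.UNION_disjoint) auto
      also have "\<dots> \<le> (\<Sum>q\<in>T. C * 2 powr (- (real m * s)))"
        using cube bound[OF m] by (intro sum_mono) auto
      also have "\<dots> = real (card T) * (C * (1 / 2 ^ m) powr s)"
        by (simp add: dyadic_powr)
      also have "\<dots> \<le> ((6 * L') ^ CARD('n) * (1 / r) ^ card (- J)) * (C * (2 * r) powr s)"
      proof (intro mult_mono)
        have "2 ^ m \<le> 1 / r" using m r0 by (simp add: field_simps)
        then show "real (card T) \<le> (6 * L') ^ CARD('n) * (1 / r) ^ card (- J)"
          using L'1 by (intro order.trans[OF T(2)] mult_left_mono power_mono) auto
        show "(1 / 2 ^ m) powr s \<le> (2 * r) powr s" using m' assms(2) by (intro powr_mono2) auto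
      qed (use C L'1 r0 in auto)
      also have "\<dots> = C' * r powr (s - real (card (- J)))"
        using r0 by (simp add: C'_def powr_mult powr_diff powr_realpow field_simps)
      finally show ?thesis .
    qed
    then show "\<exists>P w. P \<subseteq> E \<and> frostman_weights C' s n P w"
      using P w unfolding frostman_weights_def by blast
  qed
qed

section \<open>Gaussian Fourier transforms\<close>

text \<open>This is the characteristic function of the standard normal distribution after rescaling
  the variable by sqrt (2 u).\<close>

lemma gaussian_fourier_real:
  assumes u: "0 < (u::real)"
  shows "integrable lborel (\<lambda>x. cis (x * z) * complex_of_real (exp (- u * x\<^sup>2)))"
    and "(LBINT x. cis (x * z) * complex_of_real (exp (- u * x\<^sup>2))) =
           complex_of_real (sqrt (pi / u) * exp (- z\<^sup>2 / (4 * u)))"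
proof -
  define c where "c = sqrt (2 * u)"
  have c: "c > 0" "c\<^sup>2 = 2 * u" using u by (auto simp: c_def)
  have conv: "std_normal_density (c * x) *\<^sub>R iexp (z / c * (c * x)) =
      complex_of_real (1 / sqrt (2 * pi)) * (cis (x * z) * complex_of_real (exp (- u * x\<^sup>2)))" for x
  proof -
    have "std_normal_density (c * x) = 1 / sqrt (2 * pi) * exp (- u * x\<^sup>2)"
      using c by (simp add: std_normal_density_def power_mult_distrib)
    moreover have "iexp (z / c * (c * x)) = cis (x * z)" using c by (simp add: cis_conv_exp mult_ac)
    ultimately show ?thesis by (simp add: scaleR_conv_of_real mult_ac)
  qed
  interpret prob_space std_normal_distribution by (rule prob_space_normal_density) simp
  have "integrable std_normal_distribution (\<lambda>x. iexp (z / c * x))"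
    by (intro integrable_const_bound[of _ 1]) auto
  then have int: "integrable lborel (\<lambda>x. std_normal_density x *\<^sub>R iexp (z / c * x))"
    by (subst (asm) integrable_density) auto
  have "(LBINT x. std_normal_density x *\<^sub>R iexp (z / c * x)) = char std_normal_distribution (z / c)"
    unfolding char_def by (subst integral_density) auto
  then have "(LBINT x. std_normal_density x *\<^sub>R iexp (z / c * x)) = complex_of_real (exp (- (z / c)\<^sup>2 / 2))"
    by (simp add: char_std_normal_distribution)
  then have eq: "c *\<^sub>R (LBINT x. std_normal_density (c * x) *\<^sub>R iexp (z / c * (c * x))) =
      complex_of_real (exp (- (z / c)\<^sup>2 / 2))"
    using lborel_integral_real_affine[of c "\<lambda>x. std_normal_density x *\<^sub>R iexp (z / c * x)" 0] c by simp
  have "integrable lborel (\<lambda>x. std_normal_density (c * x) *\<^sub>R iexp (z / c * (c * x)))"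
    using lborel_integrable_real_affine[OF int, of c 0] c by simp
  then show "integrable lborel (\<lambda>x. cis (x * z) * complex_of_real (exp (- u * x\<^sup>2)))"
    unfolding conv using integrable_mult_right[of "complex_of_real (sqrt (2 * pi))" lborel] by fastforce
  have "(z / c)\<^sup>2 / 2 = z\<^sup>2 / (4 * u)" using c by (simp add: power_divide)
  then have "c * (1 / sqrt (2 * pi)) *\<^sub>R (LBINT x. cis (x * z) * complex_of_real (exp (- u * x\<^sup>2))) =
      complex_of_real (exp (- z\<^sup>2 / (4 * u)))"
    using eq unfolding conv by (simp add: scaleR_conv_of_real mult_ac)
  moreover have "c * (1 / sqrt (2 * pi)) = 1 / sqrt (pi / u)"
    using u by (simp add: c_def real_sqrt_divide real_sqrt_mult)
  ultimately show "(LBINT x. cis (x * z) * complex_of_real (exp (- u * x\<^sup>2))) =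
           complex_of_real (sqrt (pi / u) * exp (- z\<^sup>2 / (4 * u)))"
    using u c by (simp add: scaleR_conv_of_real field_simps)
qed

text \<open>In complex form the integrand is a product of functions of single coordinates, so the
  integral factors; a cosine of a sum would not.\<close>

lemma gaussian_fourier_complex:
  fixes z :: "'a::euclidean_space"
  assumes u: "0 < u"
  shows "has_bochner_integral lborel (\<lambda>\<xi>. cis (\<xi> \<bullet> z) * complex_of_real (exp (- u * (norm \<xi>)\<^sup>2)))
           (complex_of_real (sqrt (pi / u) ^ DIM('a) * exp (- (norm z)\<^sup>2 / (4 * u))))"
proof -
  interpret product_sigma_finite "\<lambda>_::'a. lborel :: real measure" by standard
  define f where "f = (\<lambda>b x. cis (x * (z \<bullet> b)) * complex_of_real (exp (- u * x\<^sup>2)))"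
  define F where "F = (\<lambda>\<xi>::'a. cis (\<xi> \<bullet> z) * complex_of_real (exp (- u * (norm \<xi>)\<^sup>2)))"
  have norm_sq: "(norm x)\<^sup>2 = (\<Sum>b\<in>Basis. (x \<bullet> b)\<^sup>2)" for x :: 'a
    unfolding power2_norm_eq_inner by (subst euclidean_inner) (simp add: power2_eq_square)
  have F_prod: "F \<xi> = (\<Prod>b\<in>Basis. f b (\<xi> \<bullet> b))" for \<xi>
  proof -
    have "cis (\<xi> \<bullet> z) = (\<Prod>b\<in>Basis. cis ((\<xi> \<bullet> b) * (z \<bullet> b)))"
      by (subst euclidean_inner) (simp add: cis_conv_exp exp_sum sum_distrib_left)
    moreover have "exp (- u * (norm \<xi>)\<^sup>2) = (\<Prod>b\<in>Basis. exp (- u * (\<xi> \<bullet> b)\<^sup>2))"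
      by (simp add: norm_sq exp_sum[symmetric] sum_distrib_left)
    ultimately show ?thesis unfolding F_def f_def by (simp add: prod.distrib)
  qed
  have [measurable]: "F \<in> borel_measurable borel"
    unfolding F_def by (intro borel_measurable_continuous_onI continuous_intros)
  have comp: "(\<Sum>b\<in>Basis. g b *\<^sub>R b) \<bullet> c = g c" if "c \<in> Basis" for g and c :: 'a
    using that by (simp add: inner_sum_left inner_Basis if_distrib sum.If_cases cong: if_cong)
  have F_comp: "F (\<Sum>b\<in>Basis. g b *\<^sub>R b) = (\<Prod>b\<in>Basis. f b (g b))" for g
    unfolding F_prod by (intro prod.cong refl) (simp add: comp)
  have ints: "integrable lborel (f b)" for b unfolding f_def by (rule gaussian_fourier_real[OF u])
  have int: "integrable lborel F"
    by (subst lborel_eq) (simp add: integrable_distr_eq F_comp product_integrable_prod ints)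
  have "(LBINT \<xi>. F \<xi>) = (\<Prod>b\<in>Basis. LBINT x. f b x)"
    by (subst lborel_eq) (simp add: integral_distr F_comp product_integral_prod ints)
  also have "\<dots> = complex_of_real (\<Prod>b\<in>(Basis::'a set). sqrt (pi / u) * exp (- (z \<bullet> b)\<^sup>2 / (4 * u)))"
    unfolding f_def gaussian_fourier_real(2)[OF u] by simp
  also have "(\<Prod>b\<in>(Basis::'a set). sqrt (pi / u) * exp (- (z \<bullet> b)\<^sup>2 / (4 * u))) =
      sqrt (pi / u) ^ DIM('a) * exp (- (norm z)\<^sup>2 / (4 * u))"
    by (simp add: norm_sq prod.distrib exp_sum[symmetric] sum_divide_distrib sum_negf)
  finally show ?thesis using int unfolding F_def[symmetric] has_bochner_integral_iff by simp
qed

lemma gaussian_fourier: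
  fixes z :: "'a::euclidean_space"
  assumes u: "0 < u"
  shows "has_bochner_integral lborel (\<lambda>\<xi>. cos (\<xi> \<bullet> z) * exp (- u * (norm \<xi>)\<^sup>2))
           (sqrt (pi / u) ^ DIM('a) * exp (- (norm z)\<^sup>2 / (4 * u)))"
  using has_bochner_integral_bounded_linear[OF bounded_linear_Re gaussian_fourier_complex[OF u, of z]]
  by simp

lemma integrable_gaussian:
  assumes u: "0 < u"
  shows "integrable lborel (\<lambda>\<xi>::'a::euclidean_space. exp (- u * (norm \<xi>)\<^sup>2))"
  using gaussian_fourier[OF u, of "0::'a"] by (simp add: has_bochner_integral_iff)

section \<open>Linear changes of variables\<close>

text \<open>With the integration along b carried out innermost, the shear is a translation in that
  variable by an amount depending only on the others.\<close>

lemma nn_integral_shear: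
  fixes f :: "'a::euclidean_space \<Rightarrow> ennreal"
  assumes [measurable]: "f \<in> borel_measurable borel" and b: "b \<in> Basis" "b' \<in> Basis" "b \<noteq> b'"
  shows "(\<integral>\<^sup>+x. f (x + (c * (x \<bullet> b')) *\<^sub>R b) \<partial>lborel) = (\<integral>\<^sup>+x. f x \<partial>lborel)"
proof -
  interpret product_sigma_finite "\<lambda>_::'a. lborel :: real measure" by standard
  define I where "I = Basis - {b}"
  have I: "finite I" "b \<notin> I" "Basis = insert b I" "b' \<in> I" using b by (auto simp: I_def)
  have iterated: "(\<integral>\<^sup>+x. g x \<partial>lborel) =
      (\<integral>\<^sup>+x. \<integral>\<^sup>+y. g ((\<Sum>a\<in>I. x a *\<^sub>R a) + y *\<^sub>R b) \<partial>lborel \<partial>Pi\<^sub>M I (\<lambda>_. lborel))"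
    if [measurable]: "g \<in> borel_measurable borel" for g :: "'a \<Rightarrow> ennreal"
  proof -
    have "(\<integral>\<^sup>+x. g x \<partial>lborel) = (\<integral>\<^sup>+h. g (\<Sum>a\<in>Basis. h a *\<^sub>R a) \<partial>Pi\<^sub>M (insert b I) (\<lambda>_. lborel))"
      by (subst lborel_eq) (simp add: nn_integral_distr I(3))
    also have "\<dots> = (\<integral>\<^sup>+x. \<integral>\<^sup>+y. g (\<Sum>a\<in>Basis. (x(b := y)) a *\<^sub>R a) \<partial>lborel \<partial>Pi\<^sub>M I (\<lambda>_. lborel))"
      using I(1,2) by (subst product_nn_integral_insert) (simp_all add: I(3))
    also have "(\<lambda>x y. (\<Sum>a\<in>Basis. (x(b := y)) a *\<^sub>R a)) = (\<lambda>x y. (\<Sum>a\<in>I. x a *\<^sub>R a) + y *\<^sub>R b)"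
    proof (intro ext)
      fix x :: "'a \<Rightarrow> real" and y
      have "(\<Sum>a\<in>I. (x(b := y)) a *\<^sub>R a) = (\<Sum>a\<in>I. x a *\<^sub>R a)" using I by (intro sum.cong) auto
      then show "(\<Sum>a\<in>Basis. (x(b := y)) a *\<^sub>R a) = (\<Sum>a\<in>I. x a *\<^sub>R a) + y *\<^sub>R b"
        unfolding I(3) using I(1,2) by (simp add: add.commute)
    qed
    finally show ?thesis .
  qed
  have comp: "((\<Sum>a\<in>I. x a *\<^sub>R a) + y *\<^sub>R b) \<bullet> b' = x b'" for x y
  proof -
    have "(\<Sum>a\<in>I. x a * (a \<bullet> b')) = (\<Sum>a\<in>I. if a = b' then x b' else 0)"
      using b(2) by (intro sum.cong) (auto simp: I_def inner_Basis)
    then show ?thesis using b I(1,4) by (simp add: inner_add_left inner_sum_left inner_Basis)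
  qed
  have "(\<integral>\<^sup>+x. f (x + (c * (x \<bullet> b')) *\<^sub>R b) \<partial>lborel) =
      (\<integral>\<^sup>+x. \<integral>\<^sup>+y. f ((\<Sum>a\<in>I. x a *\<^sub>R a) + (c * x b' + 1 * y) *\<^sub>R b) \<partial>lborel \<partial>Pi\<^sub>M I (\<lambda>_. lborel))"
    using iterated[of "\<lambda>x. f (x + (c * (x \<bullet> b')) *\<^sub>R b)"]
    by (simp add: comp) (simp add: scaleR_add_left add_ac)
  also have "\<dots> = (\<integral>\<^sup>+x. \<integral>\<^sup>+y. f ((\<Sum>a\<in>I. x a *\<^sub>R a) + y *\<^sub>R b) \<partial>lborel \<partial>Pi\<^sub>M I (\<lambda>_. lborel))"
  proof (rule nn_integral_cong)
    fix x
    show "(\<integral>\<^sup>+y. f ((\<Sum>a\<in>I. x a *\<^sub>R a) + (c * x b' + 1 * y) *\<^sub>R b) \<partial>lborel) =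
        (\<integral>\<^sup>+y. f ((\<Sum>a\<in>I. x a *\<^sub>R a) + y *\<^sub>R b) \<partial>lborel)"
      using nn_integral_real_affine[of "\<lambda>y. f ((\<Sum>a\<in>I. x a *\<^sub>R a) + y *\<^sub>R b)" 1 "c * x b'"] by simp
  qed
  also have "\<dots> = (\<integral>\<^sup>+x. f x \<partial>lborel)" by (rule iterated[symmetric]) simp
  finally show ?thesis .
qed

section \<open>Invariance of Lebesgue measure under rotations in a coordinate plane\<close>

definition plane_rot :: "'n \<Rightarrow> 'n \<Rightarrow> real \<Rightarrow> real ^ 'n \<Rightarrow> real ^ 'n" where
  "plane_rot i k \<alpha> v = (\<chi> l. if l = i then cos \<alpha> * v $ i - sin \<alpha> * v $ k
     else if l = k then sin \<alpha> * v $ i + cos \<alpha> * v $ k else v $ l)"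

lemma borel_measurable_plane_rot [measurable]: "plane_rot i k \<alpha> \<in> borel_measurable borel"
proof (intro borel_measurable_continuous_onI)
  show "continuous_on UNIV (plane_rot i k \<alpha>)"
    unfolding plane_rot_def
  proof (intro continuous_on_vec_lambda)
    fix l
    show "continuous_on UNIV (\<lambda>v. if l = i then cos \<alpha> * v $ i - sin \<alpha> * v $ k
        else if l = k then sin \<alpha> * v $ i + cos \<alpha> * v $ k else v $ l)"
      by (cases "l = i"; cases "l = k") (auto intro!: continuous_intros)
  qed
qed

text \<open>The classical factorization of a plane rotation into three shears, with parameters -tan
  (\<alpha>/2), sin \<alpha>, -tan (\<alpha>/2). It reduces rotation invariance to translation
  invariance.\<close>

lemma plane_rot_shears:
  assumes "i \<noteq> k" "cos (\<alpha> / 2) \<noteq> 0"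
  defines "S \<equiv> \<lambda>i k c v. v + (c * (v \<bullet> axis k 1)) *\<^sub>R axis i (1::real)"
  shows "plane_rot i k \<alpha> v = S i k (- tan (\<alpha> / 2)) (S k i (sin \<alpha>) (S i k (- tan (\<alpha> / 2)) v))"
proof -
  define t where "t = tan (\<alpha> / 2)"
  have s: "sin \<alpha> = 2 * sin (\<alpha> / 2) * cos (\<alpha> / 2)" using sin_double[of "\<alpha> / 2"] by simp
  have c: "cos \<alpha> = 1 - 2 * (sin (\<alpha> / 2))\<^sup>2" "cos \<alpha> = 2 * (cos (\<alpha> / 2))\<^sup>2 - 1"
    using cos_double_sin[of "\<alpha> / 2"] cos_double_cos[of "\<alpha> / 2"] by simp_all
  have ts: "t * sin \<alpha> = 1 - cos \<alpha>"
    using assms(2) by (simp add: t_def tan_def s c(1) power2_eq_square)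
  have t1: "t * (1 + cos \<alpha>) = sin \<alpha>"
    using assms(2) by (simp add: t_def tan_def s c(2) power2_eq_square)
  have S: "S i k a v $ l = v $ l + (if l = i then a * v $ k else 0)" for i k a l and v :: "real ^ 'a"
    by (simp add: S_def inner_axis) (simp add: axis_def)
  have c': "cos \<alpha> = 1 - t * sin \<alpha>" using ts by simp
  show ?thesis
  proof (subst vec_eq_iff, intro allI)
    fix l
    have 1: "sin \<alpha> * v $ i + cos \<alpha> * v $ k = v $ k + sin \<alpha> * (v $ i - t * v $ k)"
      unfolding c' by (simp add: algebra_simps)
    have "cos \<alpha> * v $ i - sin \<alpha> * v $ k = (1 - t * sin \<alpha>) * v $ i - (t * (1 + cos \<alpha>)) * v $ k"
      using ts t1 by simp
    also have "\<dots> = v $ i - t * v $ k - t * (sin \<alpha> * v $ i + cos \<alpha> * v $ k)" by (simp add: algebra_simps)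
    finally have 2: "cos \<alpha> * v $ i - sin \<alpha> * v $ k =
        v $ i - t * v $ k - t * (v $ k + sin \<alpha> * (v $ i - t * v $ k))" unfolding 1 .
    show "plane_rot i k \<alpha> v $ l = S i k (- tan (\<alpha> / 2)) (S k i (sin \<alpha>) (S i k (- tan (\<alpha> / 2)) v)) $ l"
      using assms(1) 1 2 unfolding S t_def[symmetric] plane_rot_def
      by (cases "l = i"; cases "l = k") simp_all
  qed
qed

lemma plane_rot_add: "i \<noteq> k \<Longrightarrow> plane_rot i k \<alpha> (plane_rot i k \<beta> v) = plane_rot i k (\<alpha> + \<beta>) v"
  by (auto simp: plane_rot_def vec_eq_iff sin_add cos_add algebra_simps)

lemma nn_integral_plane_rot:
  fixes f :: "real ^ 'n \<Rightarrow> ennreal"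
  assumes [measurable]: "f \<in> borel_measurable borel" and ik: "i \<noteq> k"
  shows "(\<integral>\<^sup>+v. f (plane_rot i k \<alpha> v) \<partial>lborel) = (\<integral>\<^sup>+v. f v \<partial>lborel)"
proof -
  have small: "(\<integral>\<^sup>+v. g (plane_rot i k \<alpha> v) \<partial>lborel) = (\<integral>\<^sup>+v. g v \<partial>lborel)"
    if c: "cos (\<alpha> / 2) \<noteq> 0" and [measurable]: "g \<in> borel_measurable borel" for \<alpha> and g :: "real ^ 'n \<Rightarrow> ennreal"
  proof -
    define S where "S = (\<lambda>i k c v. v + (c * (v \<bullet> axis k 1)) *\<^sub>R axis i (1::real) :: real ^ 'n)"
    have [measurable]: "S i k c \<in> borel_measurable borel" for i k c unfolding S_def by simp
    have inv: "(\<integral>\<^sup>+v. h (S i k c v) \<partial>lborel) = (\<integral>\<^sup>+v. h v \<partial>lborel)"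
      if [measurable]: "h \<in> borel_measurable borel" and "i \<noteq> k" for i k c h
      unfolding S_def by (rule nn_integral_shear) (use that in \<open>auto simp: axis_eq_axis axis_in_Basis_iff\<close>)
    have "(\<integral>\<^sup>+v. g (plane_rot i k \<alpha> v) \<partial>lborel) =
        (\<integral>\<^sup>+v. g (S i k (- tan (\<alpha> / 2)) (S k i (sin \<alpha>) (S i k (- tan (\<alpha> / 2)) v))) \<partial>lborel)"
      unfolding S_def plane_rot_shears[OF ik c] ..
    also have "\<dots> = (\<integral>\<^sup>+v. g (S i k (- tan (\<alpha> / 2)) (S k i (sin \<alpha>) v)) \<partial>lborel)"
      by (rule inv[where h="\<lambda>v. g (S i k (- tan (\<alpha> / 2)) (S k i (sin \<alpha>) v))"]) (use ik in auto)
    also have "\<dots> = (\<integral>\<^sup>+v. g (S i k (- tan (\<alpha> / 2)) v) \<partial>lborel)"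
      by (rule inv[where h="\<lambda>v. g (S i k (- tan (\<alpha> / 2)) v)"]) (use ik in auto)
    also have "\<dots> = (\<integral>\<^sup>+v. g v \<partial>lborel)" by (rule inv) (use ik in auto)
    finally show ?thesis .
  qed
  show ?thesis
  proof (cases "cos (\<alpha> / 2) = 0")
    case False
    then show ?thesis by (rule small) simp
  next
    case True
    \<comment> \<open>The shear factorization breaks down when cos (\<alpha>/2) = 0. Rotating twice
      by \<alpha>/2 avoids this, for by the double angle formula cos (\<alpha>/4) cannot vanish as
      well.\<close>
    then have "cos (\<alpha> / 2 / 2) \<noteq> 0"
      using cos_double_cos[of "\<alpha> / 2 / 2"] cos_double_sin[of "\<alpha> / 2 / 2"] by (auto simp: algebra_simps)
    then have half: "(\<integral>\<^sup>+v. g (plane_rot i k (\<alpha> / 2) v) \<partial>lborel) = (\<integral>\<^sup>+v. g v \<partial>lborel)"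
      if "g \<in> borel_measurable borel" for g by (rule small) (rule that)
    have "(\<integral>\<^sup>+v. f (plane_rot i k \<alpha> v) \<partial>lborel) =
        (\<integral>\<^sup>+v. f (plane_rot i k (\<alpha> / 2) (plane_rot i k (\<alpha> / 2) v)) \<partial>lborel)"
      using ik by (simp add: plane_rot_add)
    also have "\<dots> = (\<integral>\<^sup>+v. f (plane_rot i k (\<alpha> / 2) v) \<partial>lborel)"
      by (rule half[where g="\<lambda>v. f (plane_rot i k (\<alpha> / 2) v)"]) simp
    also have "\<dots> = (\<integral>\<^sup>+v. f v \<partial>lborel)" by (rule half) simp
    finally show ?thesis .
  qed
qed

lemma distr_plane_rot:
  assumes "i \<noteq> k"
  shows "distr lborel borel (plane_rot i k \<alpha>) = lborel"
proof (rule measure_eqI)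
  fix A assume "A \<in> sets (distr lborel borel (plane_rot i k \<alpha>))"
  then have [measurable]: "A \<in> sets borel" by simp
  have "emeasure (distr lborel borel (plane_rot i k \<alpha>)) A = emeasure lborel (plane_rot i k \<alpha> -` A)"
    by (simp add: emeasure_distr)
  also have "\<dots> = (\<integral>\<^sup>+v. indicator (plane_rot i k \<alpha> -` A) v \<partial>lborel)"
    using measurable_sets[of "plane_rot i k \<alpha>" borel borel A] by (intro nn_integral_indicator[symmetric]) simp
  also have "\<dots> = (\<integral>\<^sup>+v. indicator A (plane_rot i k \<alpha> v) \<partial>lborel)"
    by (simp add: indicator_def)
  finally show "emeasure (distr lborel borel (plane_rot i k \<alpha>)) A = emeasure lborel A"
    using nn_integral_plane_rot[OF _ assms, of "indicator A"] by simp
qed simp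

lemma nn_integral_stretch:
  fixes g :: "real ^ 'n \<Rightarrow> ennreal"
  assumes [measurable]: "g \<in> borel_measurable borel" and c: "\<And>i. 0 < c i"
  shows "(\<integral>\<^sup>+x. g x \<partial>lborel) = ennreal (\<Prod>i\<in>UNIV. c i) * (\<integral>\<^sup>+x. g (\<chi> i. c i * x $ i) \<partial>lborel)"
proof -
  \<comment> \<open>Transfers the scaling factors from coordinate indices to basis vectors, the
    index set of \<open>lborel_affine_euclidean\<close>.\<close>
  define c' where "c' = (\<lambda>b::real ^ 'n. \<Sum>i\<in>UNIV. if b = axis i 1 then c i else 0)"
  have c'[simp]: "c' (axis i 1) = c i" for i by (simp add: c'_def axis_eq_axis)
  have basis: "Basis = range (\<lambda>i. axis i (1::real))" by (auto simp: Basis_vec_def)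
  have inj: "inj (\<lambda>i. axis i (1::real))" by (auto simp: inj_on_def axis_eq_axis)
  have T: "0 + (\<Sum>j\<in>Basis. (c' j * (x \<bullet> j)) *\<^sub>R j) = (\<chi> i. c i * x $ i)" for x :: "real ^ 'n"
    unfolding basis sum.reindex[OF inj] o_def
    by (simp add: inner_axis) (simp add: vec_eq_iff axis_def if_distrib sum.delta cong: if_cong)
  have D: "(\<Prod>j\<in>Basis. \<bar>c' j\<bar>) = (\<Prod>i\<in>UNIV. c i)"
    unfolding basis prod.reindex[OF inj] o_def using c by (simp add: less_imp_le)
  have [measurable]: "(\<lambda>x. \<chi> i. c i * x $ i) \<in> borel_measurable (borel :: (real ^ 'n) measure)"
    by (intro borel_measurable_continuous_onI continuous_intros)
  have "lborel = density (distr lborel borel (\<lambda>x. 0 + (\<Sum>j\<in>Basis. (c' j * (x \<bullet> j)) *\<^sub>R j)))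
      (\<lambda>_. ennreal (\<Prod>j\<in>Basis. \<bar>c' j\<bar>))"
    by (rule lborel_affine_euclidean) (use c in \<open>auto simp: basis less_imp_neq[symmetric]\<close>)
  then have "(\<integral>\<^sup>+x. g x \<partial>lborel) =
      (\<integral>\<^sup>+x. g x \<partial>density (distr lborel borel (\<lambda>x. \<chi> i. c i * x $ i)) (\<lambda>_. ennreal (\<Prod>i\<in>UNIV. c i)))"
    unfolding T D by simp
  then show ?thesis by (simp add: nn_integral_density nn_integral_distr nn_integral_cmult)
qed

section \<open>Decay of rotation-invariant oscillatory integrals\<close>

text \<open>
  The substitution \<open>w = r\<^sup>q F\<close> removes the first-order term of the equation and leaves
  \<open>w'' = (q (q - 1) / r\<^sup>2 - 1) w\<close>; since \<open>1 / r\<^sup>2\<close> is integrable, the energy \<open>w\<^sup>2 + w'\<^sup>2\<close> stays bounded.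
\<close>

lemma radial_wave_decay:
  fixes F F' F'' :: "real \<Rightarrow> real" and q :: real
  assumes q: "0 \<le> q"
    and F: "\<And>r. 1 \<le> r \<Longrightarrow> (F has_real_derivative F' r) (at r)"
    and F': "\<And>r. 1 \<le> r \<Longrightarrow> (F' has_real_derivative F'' r) (at r)"
    and eq: "\<And>r. 1 \<le> r \<Longrightarrow> F'' r + 2 * q / r * F' r + F r = 0"
    and K: "\<bar>F 1\<bar> \<le> K" "\<bar>F' 1\<bar> \<le> K" and r: "1 \<le> r"
  shows "\<bar>F r\<bar> \<le> (q + 2) * exp (q * (q + 1) / 2) * K * r powr (- q)"
proof -
  define w where "w = (\<lambda>r. r powr q * F r)"
  define w' where "w' = (\<lambda>r. q * r powr (q - 1) * F r + r powr q * F' r)"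
  define c where "c = \<bar>q * (q - 1)\<bar>"
  \<comment> \<open>The energy grows at relative rate at most c / r^2. The factor exp (c / r) has
    relative rate -c / r^2, so g is nonincreasing.\<close>
  define g where "g = (\<lambda>r. ((w r)\<^sup>2 + (w' r)\<^sup>2) * exp (c / r))"
  have dw: "(w has_real_derivative w' r) (at r)" if "1 \<le> r" for r
    unfolding w_def w'_def using that by (auto intro!: derivative_eq_intros F)
  have dw': "(w' has_real_derivative (q * (q - 1) / r\<^sup>2 - 1) * w r) (at r)" if r: "1 \<le> r" for r
  proof -
    have "(w' has_real_derivative
        q * ((q - 1) * r powr (q - 1 - 1)) * F r + q * r powr (q - 1) * F' r
        + (q * r powr (q - 1) * F' r + r powr q * F'' r)) (at r)"
      unfolding w'_def using r by (auto intro!: derivative_eq_intros F F')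
    also have "r powr (q - 1 - 1) = r powr q / r\<^sup>2"
      using r by (simp add: powr_diff power2_eq_square)
    also have "r powr (q - 1) = r powr q / r"
      using r by (simp add: powr_diff)
    also have "F'' r = - F r - 2 * q / r * F' r" using eq[OF r] by linarith
    also have "q * ((q - 1) * (r powr q / r\<^sup>2)) * F r + q * (r powr q / r) * F' r
        + (q * (r powr q / r) * F' r + r powr q * (- F r - 2 * q / r * F' r)) =
        (q * (q - 1) / r\<^sup>2 - 1) * w r"
      using r by (simp add: w_def field_simps power2_eq_square)
    finally show ?thesis .
  qed
  have "g r \<le> g 1"
  proof (rule DERIV_nonpos_imp_nonincreasing[OF r])
    fix x assume x: "1 \<le> x" "x \<le> r"
    let ?y = "(2 * w x * w' x + 2 * w' x * ((q * (q - 1) / x\<^sup>2 - 1) * w x)) * exp (c / x)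
        + exp (c / x) * (- c / x\<^sup>2) * ((w x)\<^sup>2 + (w' x)\<^sup>2)"
    have "((\<lambda>r. (w r)\<^sup>2 + (w' r)\<^sup>2) has_real_derivative
        2 * w x * w' x + 2 * w' x * ((q * (q - 1) / x\<^sup>2 - 1) * w x)) (at x)"
      by (rule DERIV_cong[OF DERIV_add[OF DERIV_power[OF dw[OF x(1)], of 2] DERIV_power[OF dw'[OF x(1)], of 2]]])
         simp
    moreover have "((\<lambda>r. exp (c / r)) has_real_derivative exp (c / x) * (- c / x\<^sup>2)) (at x)"
      using x by (auto intro!: derivative_eq_intros simp: power2_eq_square)
    ultimately have "(g has_real_derivative ?y) (at x)"
      unfolding g_def by (rule DERIV_mult)
    moreover have "?y \<le> 0"
    proof -
      have "2 * (w x * w' x) * (q * (q - 1)) \<le> \<bar>2 * (w x * w' x)\<bar> * c"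
        unfolding c_def by (metis abs_ge_self abs_mult)
      also have "\<dots> \<le> ((w x)\<^sup>2 + (w' x)\<^sup>2) * c"
        using sum_squares_bound[of "\<bar>w x\<bar>" "\<bar>w' x\<bar>"]
        by (intro mult_right_mono) (auto simp: abs_mult c_def)
      finally have *: "2 * (w x * w' x) * (q * (q - 1)) - ((w x)\<^sup>2 + (w' x)\<^sup>2) * c \<le> 0" by simp
      have "?y = exp (c / x) / x\<^sup>2 * (2 * (w x * w' x) * (q * (q - 1)) - ((w x)\<^sup>2 + (w' x)\<^sup>2) * c)"
        using x by (simp add: field_simps)
      also have "\<dots> \<le> 0" using * by (intro mult_nonneg_nonpos) auto
      finally show ?thesis .
    qed
    ultimately show "\<exists>y. (g has_real_derivative y) (at x) \<and> y \<le> 0" by blast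
  qed
  moreover have "(w r)\<^sup>2 \<le> g r"
  proof -
    have "(w r)\<^sup>2 * 1 \<le> ((w r)\<^sup>2 + (w' r)\<^sup>2) * exp (c / r)"
      using r by (intro mult_mono) (auto simp: c_def)
    then show ?thesis by (simp add: g_def)
  qed
  \<comment> \<open>The initial energy in terms of K: |w 1| \<le> K, |w' 1| \<le> (q + 1) K and c
    \<le> q (q + 1). This is the origin of the constant in the statement.\<close>
  moreover have "g 1 \<le> ((q + 2) * exp (q * (q + 1) / 2) * K)\<^sup>2"
  proof -
    have K0: "0 \<le> K" using K by linarith
    have "\<bar>w 1\<bar> \<le> K" "\<bar>w' 1\<bar> \<le> (q + 1) * K"
    proof -
      have "\<bar>q * F 1\<bar> \<le> q * K" using q K by (simp add: abs_mult mult_left_mono)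
      then show "\<bar>w' 1\<bar> \<le> (q + 1) * K" using K by (simp add: w'_def algebra_simps)
    qed (use K in \<open>simp add: w_def\<close>)
    then have "(w 1)\<^sup>2 \<le> K\<^sup>2" "(w' 1)\<^sup>2 \<le> ((q + 1) * K)\<^sup>2" by (auto simp: abs_le_square_iff[symmetric])
    moreover have "(1 + (q + 1)\<^sup>2) * K\<^sup>2 = K\<^sup>2 + ((q + 1) * K)\<^sup>2"
      by (simp add: power2_eq_square algebra_simps)
    ultimately have "(w 1)\<^sup>2 + (w' 1)\<^sup>2 \<le> (1 + (q + 1)\<^sup>2) * K\<^sup>2" by linarith
    also have "\<dots> \<le> (q + 2)\<^sup>2 * K\<^sup>2"
      using q by (intro mult_right_mono) (auto simp: power2_eq_square algebra_simps)
    also have "\<dots> = ((q + 2) * K)\<^sup>2" by (simp add: power_mult_distrib)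
    finally have "(w 1)\<^sup>2 + (w' 1)\<^sup>2 \<le> ((q + 2) * K)\<^sup>2" .
    moreover have "exp (c / 1) \<le> (exp (q * (q + 1) / 2))\<^sup>2"
    proof -
      have "c \<le> q * (q + 1)" using q by (auto simp: c_def abs_mult intro!: mult_left_mono)
      then show ?thesis by (simp add: power2_eq_square exp_add[symmetric])
    qed
    ultimately have "g 1 \<le> ((q + 2) * K)\<^sup>2 * (exp (q * (q + 1) / 2))\<^sup>2"
      unfolding g_def by (intro mult_mono) auto
    then show ?thesis by (simp add: power_mult_distrib mult_ac)
  qed
  ultimately have "(w r)\<^sup>2 \<le> ((q + 2) * exp (q * (q + 1) / 2) * K)\<^sup>2" by linarith
  then have "\<bar>w r\<bar> \<le> (q + 2) * exp (q * (q + 1) / 2) * K"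
    using q K by (subst (asm) abs_le_square_iff[symmetric]) (simp add: abs_mult)
  then show ?thesis using r by (simp add: w_def abs_mult powr_minus field_simps)
qed

text \<open>Dominated convergence for the difference quotients: by the mean value inequality they
  are bounded by the constant K, which is integrable as N is finite.\<close>

lemma has_derivative_integral_bounded:
  fixes f f' :: "real \<Rightarrow> 'v \<Rightarrow> real"
  assumes "finite_measure N"
    and [measurable]: "\<And>a. f a \<in> borel_measurable N" "\<And>a. f' a \<in> borel_measurable N"
    and int: "integrable N (f x)"
    and deriv: "\<And>a v. v \<in> space N \<Longrightarrow> ((\<lambda>a. f a v) has_real_derivative f' a v) (at a)"
    and bound: "\<And>a v. v \<in> space N \<Longrightarrow> \<bar>f' a v\<bar> \<le> K"
  shows "((\<lambda>a. \<integral>v. f a v \<partial>N) has_real_derivative (\<integral>v. f' x v \<partial>N)) (at x)"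
proof -
  interpret finite_measure N by fact
  have lip: "\<bar>f a v - f b v\<bar> \<le> K * \<bar>a - b\<bar>" if "v \<in> space N" for a b v
  proof -
    have "norm (f a v - f b v) \<le> K * norm (a - b)"
      by (rule field_differentiable_bound[of UNIV "\<lambda>a. f a v" "\<lambda>a. f' a v"])
         (use deriv[OF that] bound[OF that] in auto)
    then show ?thesis by simp
  qed
  have int_f: "integrable N (f a)" for a
  proof -
    have "integrable N (\<lambda>v. f a v - f x v)"
      by (intro integrable_const_bound[of _ "K * \<bar>a - x\<bar>"]) (auto intro!: lip)
    from Bochner_Integration.integrable_add[OF this int] show ?thesis by simp
  qed
  have "((\<lambda>h. ((\<integral>v. f (x + h) v \<partial>N) - (\<integral>v. f x v \<partial>N)) / h) \<longlongrightarrow> (\<integral>v. f' x v \<partial>N)) (at 0)"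
  proof (subst tendsto_at_iff_sequentially, intro allI impI, unfold o_def)
    fix h :: "nat \<Rightarrow> real" assume h: "\<forall>i. h i \<in> UNIV - {0}" "h \<longlonglongrightarrow> 0"
    have "(\<lambda>i. \<integral>v. (f (x + h i) v - f x v) / h i \<partial>N) \<longlonglongrightarrow> (\<integral>v. f' x v \<partial>N)"
    proof (rule integral_dominated_convergence[where w="\<lambda>_. K"])
      show "AE v in N. (\<lambda>i. (f (x + h i) v - f x v) / h i) \<longlonglongrightarrow> f' x v"
      proof (rule AE_I2)
        fix v assume "v \<in> space N"
        from deriv[OF this, of x] have "((\<lambda>h. (f (x + h) v - f x v) / h) \<longlongrightarrow> f' x v) (at 0)"
          by (simp add: DERIV_def)
        then show "(\<lambda>i. (f (x + h i) v - f x v) / h i) \<longlonglongrightarrow> f' x v"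
          using h by (subst (asm) tendsto_at_iff_sequentially) (auto simp: o_def)
      qed
      show "AE v in N. norm ((f (x + h i) v - f x v) / h i) \<le> K" for i
        using h lip[of _ "x + h i" x] by (intro AE_I2) (simp add: field_simps)
    qed auto
    then show "(\<lambda>i. ((\<integral>v. f (x + h i) v \<partial>N) - (\<integral>v. f x v \<partial>N)) / h i) \<longlonglongrightarrow> (\<integral>v. f' x v \<partial>N)"
      using int_f by simp
  qed
  then show ?thesis by (simp add: DERIV_def)
qed

lemma abs_mult_le: "\<bar>x\<bar> \<le> a \<Longrightarrow> \<bar>y\<bar> \<le> c \<Longrightarrow> \<bar>x * y\<bar> \<le> a * c" for x y a c :: real
  unfolding abs_mult by (intro mult_mono) auto

text \<open>
  Invariance under the plane rotations makes
  \<open>\<phi>(\<alpha>) = \<integral>cos (r (u \<bullet> R\<^sub>\<alpha> X) + Y) dN\<close> constant; summing \<open>\<phi>''(0) = 0\<close> over all coordinate planes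
  expresses \<open>H'' + H\<close> through \<open>H'\<close>, that is, it yields the radial wave equation.
\<close>

lemma rotation_invariant_decay:
  fixes X :: "'i \<Rightarrow> 'v \<Rightarrow> real" and Y :: "'v \<Rightarrow> real" and u :: "'i \<Rightarrow> real"
  assumes N: "finite_measure N" and I: "finite I" "2 \<le> card I"
    and X[measurable]: "\<And>i. X i \<in> borel_measurable N" and Y[measurable]: "Y \<in> borel_measurable N"
    and X1: "\<And>v. v \<in> space N \<Longrightarrow> (\<Sum>i\<in>I. (X i v)\<^sup>2) = 1" and u1: "(\<Sum>i\<in>I. (u i)\<^sup>2) = 1"
    and inv: "\<And>i k \<alpha> r. i \<in> I \<Longrightarrow> k \<in> I \<Longrightarrow> i \<noteq> k \<Longrightarrow>
      (\<integral>v. cos (r * ((\<Sum>l\<in>I. u l * X l v) + (u i * X i v + u k * X k v) * (cos \<alpha> - 1)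
          + (u k * X i v - u i * X k v) * sin \<alpha>) + Y v) \<partial>N) =
      (\<integral>v. cos (r * (\<Sum>l\<in>I. u l * X l v) + Y v) \<partial>N)"
    and r: "1 \<le> r"
  defines "q \<equiv> (real (card I) - 1) / 2"
  shows "\<bar>\<integral>v. cos (r * (\<Sum>l\<in>I. u l * X l v) + Y v) \<partial>N\<bar>
          \<le> (q + 2) * exp (q * (q + 1) / 2) * measure N (space N) * r powr (- q)"
proof -
  interpret finite_measure N by fact
  define A where "A = (\<lambda>v. \<Sum>l\<in>I. u l * X l v)"
  have [measurable]: "A \<in> borel_measurable N" unfolding A_def by measurable
  have X_le: "\<bar>X i v\<bar> \<le> 1" if "i \<in> I" "v \<in> space N" for i v
  proof -
    have "(X i v)\<^sup>2 \<le> (\<Sum>i\<in>I. (X i v)\<^sup>2)" using that I by (intro member_le_sum) auto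
    then show ?thesis using X1[OF that(2)] by (simp add: abs_square_le_1)
  qed
  have u_le: "\<bar>u i\<bar> \<le> 1" if "i \<in> I" for i
  proof -
    have "(u i)\<^sup>2 \<le> (\<Sum>i\<in>I. (u i)\<^sup>2)" using that I by (intro member_le_sum) auto
    then show ?thesis using u1 by (simp add: abs_square_le_1)
  qed
  have A_le: "\<bar>A v\<bar> \<le> 1" if "v \<in> space N" for v
  proof -
    have "(A v)\<^sup>2 \<le> (\<Sum>i\<in>I. (u i)\<^sup>2) * (\<Sum>i\<in>I. (X i v)\<^sup>2)"
      unfolding A_def by (rule Cauchy_Schwarz_ineq_sum)
    then show ?thesis using u1 X1[OF that] by (simp add: abs_square_le_1)
  qed
  have bnd: "integrable N f" if [measurable]: "f \<in> borel_measurable N"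
    and "\<And>v. v \<in> space N \<Longrightarrow> \<bar>f v\<bar> \<le> B" for f :: "'v \<Rightarrow> real" and B
    by (rule integrable_const_bound[of _ B]) (use that in auto)
  have int_le: "\<bar>\<integral>v. f v \<partial>N\<bar> \<le> measure N (space N)" if [measurable]: "f \<in> borel_measurable N"
    and f: "\<And>v. v \<in> space N \<Longrightarrow> \<bar>f v\<bar> \<le> 1" for f :: "'v \<Rightarrow> real"
  proof -
    have "\<bar>\<integral>v. f v \<partial>N\<bar> \<le> (\<integral>v. \<bar>f v\<bar> \<partial>N)" by (rule integral_abs_bound)
    also have "\<dots> \<le> (\<integral>v. 1 \<partial>N)" by (rule integral_mono) (use f in \<open>auto intro!: bnd[of _ 1]\<close>)
    finally show ?thesis by simp
  qed
  define H where "H = (\<lambda>r. \<integral>v. cos (r * A v + Y v) \<partial>N)"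
  define H' where "H' = (\<lambda>r. \<integral>v. - sin (r * A v + Y v) * A v \<partial>N)"
  define H'' where "H'' = (\<lambda>r. \<integral>v. - cos (r * A v + Y v) * A v * A v \<partial>N)"
  have dH: "(H has_real_derivative H' r) (at r)" for r
    unfolding H_def H'_def
  proof (rule has_derivative_integral_bounded[OF N, where K=1])
    show "\<bar>- sin (a * A v + Y v) * A v\<bar> \<le> 1" if "v \<in> space N" for a v
      using mult_mono[OF abs_sin_le_one A_le[OF that]] by (simp add: abs_mult)
  qed (auto intro!: derivative_eq_intros bnd[of _ 1])
  have dH': "(H' has_real_derivative H'' r) (at r)" for r
    unfolding H'_def H''_def
  proof (rule has_derivative_integral_bounded[OF N, where K=1])
    show "\<bar>- cos (a * A v + Y v) * A v * A v\<bar> \<le> 1" if "v \<in> space N" for a v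
      using mult_mono[OF mult_mono[OF abs_cos_le_one A_le[OF that]] A_le[OF that]] by (simp add: abs_mult)
    show "integrable N (\<lambda>v. - sin (r * A v + Y v) * A v)"
      by (rule bnd[of _ 1]) (use mult_mono[OF abs_sin_le_one A_le] in \<open>auto simp: abs_mult\<close>)
  qed (auto intro!: derivative_eq_intros)
  \<comment> \<open>The coefficients of cos \<alpha> - 1 and sin \<alpha> when X is rotated by
    \<alpha> in the plane of coordinates i and k before being paired with u.\<close>
  define B where "B = (\<lambda>i k v. u i * X i v + u k * X k v)"
  define L where "L = (\<lambda>i k v. u k * X i v - u i * X k v)"
  have [measurable]: "B i k \<in> borel_measurable N" "L i k \<in> borel_measurable N" for i k
    unfolding B_def L_def by measurable
  have prod_le: "\<bar>u i * X j v\<bar> \<le> 1" if "i \<in> I" "j \<in> I" "v \<in> space N" for i j v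
    using mult_mono[OF u_le[OF that(1)] X_le[OF that(2,3)]] by (simp add: abs_mult)
  have BL: "\<bar>B i k v\<bar> \<le> 2" "\<bar>L i k v\<bar> \<le> 2" if "i \<in> I" "k \<in> I" "v \<in> space N" for i k v
    using prod_le[of i i v] prod_le[of k k v] prod_le[of i k v] prod_le[of k i v] that
    unfolding B_def L_def by linarith+
  \<comment> \<open>This is \<phi>''(0) = 0 divided by r: at \<alpha> = 0 the phase has first
    derivative r L and second derivative -r B.\<close>
  have rot: "r * (\<integral>v. cos (r * A v + Y v) * (L i k v)\<^sup>2 \<partial>N) = (\<integral>v. sin (r * A v + Y v) * B i k v \<partial>N)"
    if ik: "i \<in> I" "k \<in> I" "i \<noteq> k" and r: "1 \<le> r" for i k r
  proof -
    define \<theta> where "\<theta> = (\<lambda>\<alpha> v. r * (A v + B i k v * (cos \<alpha> - 1) + L i k v * sin \<alpha>) + Y v)"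
    define \<theta>' where "\<theta>' = (\<lambda>\<alpha> v. r * (L i k v * cos \<alpha> - B i k v * sin \<alpha>))"
    define \<theta>'' where "\<theta>'' = (\<lambda>\<alpha> v. r * (- L i k v * sin \<alpha> - B i k v * cos \<alpha>))"
    have [measurable]: "\<theta> \<alpha> \<in> borel_measurable N" "\<theta>' \<alpha> \<in> borel_measurable N" "\<theta>'' \<alpha> \<in> borel_measurable N" for \<alpha>
      unfolding \<theta>_def \<theta>'_def \<theta>''_def by measurable
    have d\<theta>: "((\<lambda>\<alpha>. \<theta> \<alpha> v) has_real_derivative \<theta>' \<alpha> v) (at \<alpha>)" for \<alpha> v
      unfolding \<theta>_def \<theta>'_def by (auto intro!: derivative_eq_intros simp: algebra_simps)
    have d\<theta>': "((\<lambda>\<alpha>. \<theta>' \<alpha> v) has_real_derivative \<theta>'' \<alpha> v) (at \<alpha>)" for \<alpha> v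
      unfolding \<theta>'_def \<theta>''_def by (auto intro!: derivative_eq_intros simp: algebra_simps)
    have trig: "\<bar>x * s\<bar> \<le> 2" if "\<bar>x\<bar> \<le> 2" "\<bar>s\<bar> \<le> 1" for x s :: real
      using mult_mono[OF that] by (simp add: abs_mult)
    have \<theta>'_le: "\<bar>\<theta>' \<alpha> v\<bar> \<le> r * 4" and \<theta>''_le: "\<bar>\<theta>'' \<alpha> v\<bar> \<le> r * 4" if v: "v \<in> space N" for \<alpha> v
    proof -
      have "\<bar>L i k v * cos \<alpha> - B i k v * sin \<alpha>\<bar> \<le> 4" "\<bar>- L i k v * sin \<alpha> - B i k v * cos \<alpha>\<bar> \<le> 4"
        using trig[OF BL(1)[OF ik(1,2) v] abs_sin_le_one] trig[OF BL(1)[OF ik(1,2) v] abs_cos_le_one]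
          trig[OF BL(2)[OF ik(1,2) v] abs_sin_le_one] trig[OF BL(2)[OF ik(1,2) v] abs_cos_le_one]
        by (smt (verit) mult_minus_left)+
      then show "\<bar>\<theta>' \<alpha> v\<bar> \<le> r * 4" "\<bar>\<theta>'' \<alpha> v\<bar> \<le> r * 4"
        unfolding \<theta>'_def \<theta>''_def using r by (simp_all add: abs_mult)
    qed
    define \<phi> where "\<phi> = (\<lambda>\<alpha>. \<integral>v. cos (\<theta> \<alpha> v) \<partial>N)"
    define \<phi>' where "\<phi>' = (\<lambda>\<alpha>. \<integral>v. - sin (\<theta> \<alpha> v) * \<theta>' \<alpha> v \<partial>N)"
    define \<phi>'' where "\<phi>'' = (\<lambda>\<alpha>. \<integral>v. - cos (\<theta> \<alpha> v) * \<theta>' \<alpha> v * \<theta>' \<alpha> v - sin (\<theta> \<alpha> v) * \<theta>'' \<alpha> v \<partial>N)"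
    have "(\<phi> has_real_derivative \<phi>' \<alpha>) (at \<alpha>)" for \<alpha>
      unfolding \<phi>_def \<phi>'_def
    proof (rule has_derivative_integral_bounded[OF N, where K="r * 4"])
      show "\<bar>- sin (\<theta> a v) * \<theta>' a v\<bar> \<le> r * 4" if "v \<in> space N" for a v
        using mult_mono[OF abs_sin_le_one \<theta>'_le[OF that]] by (simp add: abs_mult)
    qed (auto intro!: derivative_eq_intros d\<theta> bnd[of _ 1])
    moreover have "\<phi> = (\<lambda>_. \<phi> 0)"
      using inv[OF ik] by (simp add: \<phi>_def \<theta>_def A_def B_def L_def fun_eq_iff)
    ultimately have "\<phi>' \<alpha> = 0" for \<alpha>
      by (metis DERIV_const DERIV_unique)
    then have "\<phi>' = (\<lambda>_. 0)" by auto
    have "(\<phi>' has_real_derivative \<phi>'' 0) (at 0)"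
      unfolding \<phi>'_def \<phi>''_def
    proof (rule has_derivative_integral_bounded[OF N, where K="r * 4 * (r * 4) + r * 4"])
      show "\<bar>- cos (\<theta> a v) * \<theta>' a v * \<theta>' a v - sin (\<theta> a v) * \<theta>'' a v\<bar> \<le> r * 4 * (r * 4) + r * 4"
        if v: "v \<in> space N" for a v
      proof -
        have "\<bar>cos (\<theta> a v) * \<theta>' a v * \<theta>' a v\<bar> \<le> 1 * (r * 4) * (r * 4)"
          unfolding abs_mult using r \<theta>'_le[OF v] by (intro mult_mono) auto
        moreover have "\<bar>sin (\<theta> a v) * \<theta>'' a v\<bar> \<le> 1 * (r * 4)"
          unfolding abs_mult using r \<theta>''_le[OF v] by (intro mult_mono) auto
        ultimately show ?thesis by (simp only: mult_minus_left)
      qed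
      show "integrable N (\<lambda>v. - sin (\<theta> 0 v) * \<theta>' 0 v)"
        by (rule bnd[of _ "r * 4"]) (use mult_mono[OF abs_sin_le_one \<theta>'_le] in \<open>auto simp: abs_mult\<close>)
    qed (auto intro!: derivative_eq_intros d\<theta> d\<theta>')
    then have "\<phi>'' 0 = 0" unfolding \<open>\<phi>' = (\<lambda>_. 0)\<close> by (metis DERIV_const DERIV_unique)
    moreover have "\<phi>'' 0 = (\<integral>v. r * (sin (r * A v + Y v) * B i k v) - r * r * (cos (r * A v + Y v) * (L i k v)\<^sup>2) \<partial>N)"
      unfolding \<phi>''_def \<theta>_def \<theta>'_def \<theta>''_def by (simp add: power2_eq_square algebra_simps)
    moreover have "\<dots> = r * (\<integral>v. sin (r * A v + Y v) * B i k v \<partial>N)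
        - r * r * (\<integral>v. cos (r * A v + Y v) * (L i k v)\<^sup>2 \<partial>N)"
    proof -
      have "integrable N (\<lambda>v. sin (r * A v + Y v) * B i k v)"
        by (rule bnd[of _ "1 * 2"]) (measurable, intro abs_mult_le BL ik abs_sin_le_one)
      moreover have "integrable N (\<lambda>v. cos (r * A v + Y v) * (L i k v)\<^sup>2)"
        unfolding power2_eq_square
        by (rule bnd[of _ "1 * (2 * 2)"]) (measurable, intro abs_mult_le BL ik abs_cos_le_one)
      ultimately show ?thesis by simp
    qed
    ultimately show ?thesis using r by (simp add: algebra_simps)
  qed
  define D where "D = real (card I)"
  \<comment> \<open>Lagrange's identity for the unit vectors u and X; the factor 2 comes from
    summing over ordered pairs.\<close>
  have sum_L: "(\<Sum>i\<in>I. \<Sum>k\<in>I. if i = k then 0 else (L i k v)\<^sup>2) = 2 * (1 - (A v)\<^sup>2)" if v: "v \<in> space N" for v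
  proof -
    have "(\<Sum>i\<in>I. \<Sum>k\<in>I. if i = k then 0 else (L i k v)\<^sup>2) = (\<Sum>i\<in>I. \<Sum>k\<in>I. (L i k v)\<^sup>2)"
      by (intro sum.cong refl) (auto simp: L_def)
    also have "\<dots> = (\<Sum>i\<in>I. \<Sum>k\<in>I. (u k)\<^sup>2 * (X i v)\<^sup>2 + (u i)\<^sup>2 * (X k v)\<^sup>2 - 2 * ((u i * X i v) * (u k * X k v)))"
      by (intro sum.cong refl) (simp add: L_def power2_eq_square algebra_simps)
    also have "\<dots> = 2 * ((\<Sum>k\<in>I. (u k)\<^sup>2) * (\<Sum>i\<in>I. (X i v)\<^sup>2)) - 2 * (A v * A v)"
    proof -
      have "(\<Sum>i\<in>I. \<Sum>k\<in>I. (u i)\<^sup>2 * (X k v)\<^sup>2) = (\<Sum>i\<in>I. \<Sum>k\<in>I. (u k)\<^sup>2 * (X i v)\<^sup>2)"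
        by (rule sum.swap)
      moreover have "(\<Sum>k\<in>I. (u k)\<^sup>2) * (\<Sum>i\<in>I. (X i v)\<^sup>2) = (\<Sum>i\<in>I. \<Sum>k\<in>I. (u i)\<^sup>2 * (X k v)\<^sup>2)"
        by (rule sum_product)
      moreover have "A v * A v = (\<Sum>i\<in>I. \<Sum>k\<in>I. (u i * X i v) * (u k * X k v))"
        unfolding A_def by (rule sum_product)
      ultimately show ?thesis by (simp add: sum.distrib sum_subtractf sum_distrib_left[symmetric])
    qed
    finally show ?thesis using u1 X1[OF v] by (simp add: power2_eq_square)
  qed
  \<comment> \<open>Each index occurs in 2 (D - 1) ordered pairs of distinct indices.\<close>
  have sum_B: "(\<Sum>i\<in>I. \<Sum>k\<in>I. if i = k then 0 else B i k v) = 2 * (D - 1) * A v" for v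
  proof -
    have "(\<Sum>k\<in>I. if i = k then 0 else B i k v) = (\<Sum>k\<in>I. B i k v) - 2 * (u i * X i v)" if "i \<in> I" for i
    proof -
      have "(\<Sum>k\<in>I. if i = k then 0 else B i k v) = (\<Sum>k\<in>I. B i k v - (if i = k then B i k v else 0))"
        by (intro sum.cong) auto
      then show ?thesis using that I by (simp add: sum_subtractf B_def)
    qed
    then have "(\<Sum>i\<in>I. \<Sum>k\<in>I. if i = k then 0 else B i k v) = (\<Sum>i\<in>I. (\<Sum>k\<in>I. B i k v) - 2 * (u i * X i v))"
      by (intro sum.cong) auto
    also have "\<dots> = 2 * (D - 1) * A v"
      by (simp add: B_def A_def D_def sum.distrib sum_subtractf sum_distrib_left algebra_simps)
    finally show ?thesis .
  qed
  have eq: "H'' r + 2 * q / r * H' r + H r = 0" if r: "1 \<le> r" for r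
  proof -
    define c where "c = (\<lambda>v. cos (r * A v + Y v))"
    define s where "s = (\<lambda>v. sin (r * A v + Y v))"
    have [measurable]: "c \<in> borel_measurable N" "s \<in> borel_measurable N" unfolding c_def s_def by measurable
    have cs: "\<bar>c v\<bar> \<le> 1" "\<bar>s v\<bar> \<le> 1" for v by (simp_all add: c_def s_def)
    have iL: "integrable N (\<lambda>v. if i = k then 0 else c v * (L i k v)\<^sup>2)" if "i \<in> I" "k \<in> I" for i k
    proof (cases "i = k")
      case False
      have "integrable N (\<lambda>v. c v * (L i k v * L i k v))"
        by (rule bnd[of _ "1 * (2 * 2)"]) (measurable, intro abs_mult_le BL that cs)
      then show ?thesis using False by (simp add: power2_eq_square)
    qed simp
    have iB: "integrable N (\<lambda>v. if i = k then 0 else s v * B i k v)" if "i \<in> I" "k \<in> I" for i k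
    proof (cases "i = k")
      case False
      have "integrable N (\<lambda>v. s v * B i k v)"
        by (rule bnd[of _ "1 * 2"]) (measurable, intro abs_mult_le BL that cs)
      then show ?thesis using False by simp
    qed simp
    \<comment> \<open>Sum of \<open>rot\<close> over ordered pairs. The left side equals 2 r (H +
      H''), because c A^2 integrates to -H''; the right side equals -2 (D - 1) H', because s A
      integrates to -H'.\<close>
    have "r * (\<integral>v. c v * (2 * (1 - (A v)\<^sup>2)) \<partial>N) =
        r * (\<integral>v. (\<Sum>i\<in>I. \<Sum>k\<in>I. if i = k then 0 else c v * (L i k v)\<^sup>2) \<partial>N)"
    proof -
      have "c v * (2 * (1 - (A v)\<^sup>2)) = (\<Sum>i\<in>I. \<Sum>k\<in>I. if i = k then 0 else c v * (L i k v)\<^sup>2)"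
        if "v \<in> space N" for v
        unfolding sum_L[OF that, symmetric] by (simp add: sum_distrib_left if_distrib cong: if_cong)
      then show ?thesis by (metis (no_types, lifting) Bochner_Integration.integral_cong)
    qed
    also have "\<dots> = (\<Sum>i\<in>I. \<Sum>k\<in>I. r * (\<integral>v. (if i = k then 0 else c v * (L i k v)\<^sup>2) \<partial>N))"
      using iL by (simp add: sum_distrib_left Bochner_Integration.integral_sum)
    also have "\<dots> = (\<Sum>i\<in>I. \<Sum>k\<in>I. (\<integral>v. (if i = k then 0 else s v * B i k v) \<partial>N))"
    proof (intro sum.cong refl)
      fix i k assume "i \<in> I" "k \<in> I"
      then show "r * (\<integral>v. (if i = k then 0 else c v * (L i k v)\<^sup>2) \<partial>N) = (\<integral>v. (if i = k then 0 else s v * B i k v) \<partial>N)"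
        using rot[OF _ _ _ r, of i k] by (cases "i = k") (simp_all add: c_def s_def)
    qed
    also have "\<dots> = (\<integral>v. (\<Sum>i\<in>I. \<Sum>k\<in>I. if i = k then 0 else s v * B i k v) \<partial>N)"
      using iB by (simp add: Bochner_Integration.integral_sum)
    also have "\<dots> = (\<integral>v. s v * (2 * (D - 1) * A v) \<partial>N)"
      unfolding sum_B[symmetric] by (simp add: sum_distrib_left if_distrib cong: if_cong)
    finally have main: "r * (\<integral>v. c v * (2 * (1 - (A v)\<^sup>2)) \<partial>N) = (\<integral>v. s v * (2 * (D - 1) * A v) \<partial>N)" .
    have "(\<integral>v. c v * (2 * (1 - (A v)\<^sup>2)) \<partial>N) = (\<integral>v. 2 * (c v - c v * A v * A v) \<partial>N)"
      by (intro Bochner_Integration.integral_cong) (auto simp: power2_eq_square algebra_simps)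
    also have "\<dots> = 2 * (H r + H'' r)"
    proof -
      have "integrable N c" by (rule bnd[of _ 1]) (use cs in auto)
      moreover have "integrable N (\<lambda>v. c v * A v * A v)"
        by (rule bnd[of _ "1 * 1 * 1"]) (measurable, intro abs_mult_le A_le cs)
      ultimately show ?thesis unfolding H_def H''_def c_def by simp
    qed
    finally have 1: "(\<integral>v. c v * (2 * (1 - (A v)\<^sup>2)) \<partial>N) = 2 * (H r + H'' r)" .
    have "(\<integral>v. s v * (2 * (D - 1) * A v) \<partial>N) = (\<integral>v. (- 2 * (D - 1)) * (- s v * A v) \<partial>N)"
      by (intro Bochner_Integration.integral_cong) (auto simp: algebra_simps)
    also have "\<dots> = - 2 * (D - 1) * H' r" unfolding H'_def s_def by (rule integral_mult_right_zero)
    finally have "r * (2 * (H r + H'' r)) = - 2 * (D - 1) * H' r" using main 1 by simp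
    then have "r * (H r + H'' r) + (D - 1) * H' r = 0" by algebra
    moreover have "D - 1 = 2 * q" by (simp add: q_def D_def)
    ultimately have "r * (H r + H'' r) + 2 * q * H' r = 0" by metis
    then show ?thesis using r by (simp add: field_simps)
  qed
  have "0 \<le> q" using I by (simp add: q_def)
  then have "\<bar>H r\<bar> \<le> (q + 2) * exp (q * (q + 1) / 2) * measure N (space N) * r powr (- q)"
  proof (rule radial_wave_decay[OF _ dH dH' eq _ _ r])
    show "\<bar>H 1\<bar> \<le> measure N (space N)" unfolding H_def by (rule int_le) auto
    show "\<bar>H' 1\<bar> \<le> measure N (space N)" unfolding H'_def
      by (rule int_le) (use mult_mono[OF abs_sin_le_one A_le] in \<open>auto simp: abs_mult\<close>)
  qed
  then show ?thesis by (simp add: H_def A_def)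
qed

section \<open>Fourier transforms of products of spheres\<close>

definition block_norm :: "('n::finite \<Rightarrow> 'k) \<Rightarrow> 'k \<Rightarrow> real ^ 'n \<Rightarrow> real" where
  "block_norm b j v = L2_set (\<lambda>i. v $ i) {i. b i = j}"

lemma block_dist_eq: "block_dist b j x y = block_norm b j (x - y)"
  by (simp add: block_dist_def block_norm_def)

lemma block_norm_nonneg [simp]: "0 \<le> block_norm b j v"
  by (simp add: block_norm_def)

lemma block_norm_sq: "(block_norm b j v)\<^sup>2 = (\<Sum>i | b i = j. (v $ i)\<^sup>2)"
  by (simp add: block_norm_def L2_set_def sum_nonneg)

lemma norm_sq_eq_sum: "(norm v)\<^sup>2 = (\<Sum>i\<in>UNIV. (v $ i)\<^sup>2)" for v :: "real ^ 'n"
  by (simp add: norm_vec_def L2_set_def sum_nonneg)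

lemma sum_over_blocks: "(\<Sum>j\<in>UNIV. \<Sum>i | b i = j. f i) = (\<Sum>i\<in>UNIV. f i)"
  for b :: "'n::finite \<Rightarrow> 'k::finite" and f :: "'n \<Rightarrow> real"
  using sum.group[of UNIV UNIV b f] by simp

lemma sum_block_norm_sq: "(\<Sum>j\<in>UNIV. (block_norm b j v)\<^sup>2) = (norm v)\<^sup>2"
  for b :: "'n::finite \<Rightarrow> 'k::finite"
  by (simp add: block_norm_sq norm_sq_eq_sum sum_over_blocks)

lemma block_norm_le_norm: "block_norm b j v \<le> norm v"
proof -
  have "(block_norm b j v)\<^sup>2 \<le> (norm v)\<^sup>2"
    unfolding block_norm_sq norm_sq_eq_sum by (intro sum_mono2) auto
  then show ?thesis by (rule power2_le_imp_le) simp
qed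

lemma block_norm_diff: "\<bar>block_norm b j v - block_norm b j w\<bar> \<le> norm (v - w)"
proof -
  have "block_norm b j (x + y) \<le> block_norm b j x + block_norm b j y" for x y
    unfolding block_norm_def vector_add_component by (rule L2_set_triangle_ineq)
  from this[of "v - w" w] this[of "w - v" v] have
    "block_norm b j v \<le> block_norm b j (v - w) + block_norm b j w"
    "block_norm b j w \<le> block_norm b j (w - v) + block_norm b j v" by simp_all
  then show ?thesis
    using block_norm_le_norm[of b j "v - w"] block_norm_le_norm[of b j "w - v"] by (simp add: norm_minus_commute)
qed

lemma continuous_on_block_norm: "continuous_on A (block_norm b j)"
  unfolding block_norm_def L2_set_def by (intro continuous_intros)

lemma borel_measurable_block_norm [measurable]: "block_norm b j \<in> borel_measurable borel"
  by (intro borel_measurable_continuous_onI continuous_on_block_norm)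

lemma borel_measurable_vec_nth [measurable]: "(\<lambda>v::real ^ 'n. v $ i) \<in> borel_measurable borel"
  by (intro borel_measurable_continuous_onI continuous_intros)

section \<open>Radial projection, the measure on the annuli and its rotation invariance\<close>

definition sphere_point :: "('n::finite \<Rightarrow> 'k) \<Rightarrow> real ^ 'k \<Rightarrow> real ^ 'n \<Rightarrow> real ^ 'n" where
  "sphere_point b t v = (\<chi> i. t $ b i * v $ i / block_norm b (b i) v)"

text \<open>The inner radius keeps the radial projection well defined, the outer one keeps the
  measure finite. The thickness provides the room used in
  \<open>stretched_point_in_annuli\<close>.\<close>

definition annuli :: "('n::finite \<Rightarrow> 'k::finite) \<Rightarrow> (real ^ 'n) set" where
  "annuli b = {v. \<forall>j. 1 \<le> block_norm b j v \<and> block_norm b j v \<le> 2}"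

definition sphere_measure :: "('n::finite \<Rightarrow> 'k::finite) \<Rightarrow> (real ^ 'n) measure" where
  "sphere_measure b = restrict_space lborel (annuli b)"

text \<open>
  Up to normalization, the Fourier transform of the surface measure of the product of the spheres of
  radii \<open>t $ j\<close>, realized as the image of Lebesgue measure on a product of annuli under radial
  projection.
\<close>

definition sphere_fourier :: "('n::finite \<Rightarrow> 'k::finite) \<Rightarrow> real ^ 'k \<Rightarrow> real ^ 'n \<Rightarrow> real" where
  "sphere_fourier b t \<xi> = (\<integral>v. cos (\<xi> \<bullet> sphere_point b t v) \<partial>sphere_measure b)"

lemma borel_measurable_vec_lambda:
  fixes f :: "'n::finite \<Rightarrow> 'a \<Rightarrow> real"
  assumes "\<And>i. f i \<in> borel_measurable M"
  shows "(\<lambda>x. \<chi> i. f i x) \<in> borel_measurable M"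
proof (rule borel_measurable_euclidean_space[THEN iffD2], intro ballI)
  fix e :: "real ^ 'n" assume "e \<in> Basis"
  then obtain i where "e = axis i 1" by (auto simp: Basis_vec_def)
  then show "(\<lambda>x. (\<chi> i. f i x) \<bullet> e) \<in> borel_measurable M" using assms by (simp add: inner_axis)
qed

lemma borel_measurable_sphere_point [measurable]: "sphere_point b t \<in> borel_measurable borel"
  unfolding sphere_point_def by (intro borel_measurable_vec_lambda) measurable

lemma annuli_borel [measurable]: "annuli b \<in> sets borel"
  unfolding annuli_def by measurable

lemma sets_sphere_measure [measurable_cong]:
  "sets (sphere_measure b) = sets (restrict_space borel (annuli b))"
  unfolding sphere_measure_def by (simp add: sets_restrict_space)

lemma space_sphere_measure [simp]: "space (sphere_measure b) = annuli b"
  by (simp add: sphere_measure_def space_restrict_space)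

lemma measurable_sphere_measure: "f \<in> borel_measurable borel \<Longrightarrow> f \<in> borel_measurable (sphere_measure b)"
  unfolding sphere_measure_def by (intro measurable_restrict_space1) simp

lemma bounded_annuli: "bounded (annuli b)"
proof -
  have "norm v \<le> 2 * real CARD('b)" if "v \<in> annuli b" for v :: "real ^ 'a"
  proof -
    have "(norm v)\<^sup>2 \<le> (\<Sum>j\<in>(UNIV::'b set). 2\<^sup>2)"
      unfolding sum_block_norm_sq[of b v, symmetric] using that
      by (intro sum_mono power_mono) (auto simp: annuli_def)
    also have "\<dots> \<le> (2 * real CARD('b))\<^sup>2"
      by (simp add: power2_eq_square)
    finally show ?thesis by (rule power2_le_imp_le) simp
  qed
  then show ?thesis by (auto simp: bounded_iff)
qed

lemma finite_sphere_measure: "finite_measure (sphere_measure b)"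
proof
  have "emeasure lborel (annuli b) < \<infinity>" by (rule emeasure_bounded_finite[OF bounded_annuli])
  then show "emeasure (sphere_measure b) (space (sphere_measure b)) \<noteq> \<infinity>"
    by (simp add: sphere_measure_def emeasure_restrict_space)
qed

lemma block_norm_plane_rot:
  assumes "i \<noteq> k" "b i = b k"
  shows "block_norm b j (plane_rot i k \<alpha> v) = block_norm b j v"
proof -
  have "(block_norm b j (plane_rot i k \<alpha> v))\<^sup>2 = (block_norm b j v)\<^sup>2"
  proof (cases "b i = j")
    case False
    then show ?thesis unfolding block_norm_sq using assms
      by (intro sum.cong) (auto simp: plane_rot_def)
  next
    case True
    define J where "J = {l. b l = j} - {i, k}"
    have J: "{l. b l = j} = insert i (insert k J)" "finite J" "i \<notin> insert k J" "k \<notin> J"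
      using True assms by (auto simp: J_def)
    have "(\<Sum>l\<in>J. (plane_rot i k \<alpha> v $ l)\<^sup>2) = (\<Sum>l\<in>J. (v $ l)\<^sup>2)"
      by (intro sum.cong) (auto simp: J_def plane_rot_def)
    moreover have "(plane_rot i k \<alpha> v $ i)\<^sup>2 + (plane_rot i k \<alpha> v $ k)\<^sup>2 =
        ((sin \<alpha>)\<^sup>2 + (cos \<alpha>)\<^sup>2) * ((v $ i)\<^sup>2 + (v $ k)\<^sup>2)"
    proof -
      have "(c * x - s * y)\<^sup>2 + (s * x + c * y)\<^sup>2 = (s\<^sup>2 + c\<^sup>2) * (x\<^sup>2 + y\<^sup>2)" for c s x y :: real
        by (simp add: power2_eq_square algebra_simps)
      then show ?thesis using assms(1) by (simp add: plane_rot_def)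
    qed
    ultimately show ?thesis unfolding block_norm_sq J(1) using J(2-4) by simp
  qed
  then show ?thesis by simp
qed

text \<open>A rotation in two coordinates of one block preserves all block norms, hence the annuli,
  and it preserves Lebesgue measure.\<close>

lemma integral_sphere_measure_plane_rot:
  fixes f :: "real ^ 'n \<Rightarrow> real"
  assumes ik: "i \<noteq> k" "b i = b k" and [measurable]: "f \<in> borel_measurable borel"
  shows "(\<integral>v. f (plane_rot i k \<alpha> v) \<partial>sphere_measure b) = (\<integral>v. f v \<partial>sphere_measure b)"
proof -
  have ann: "indicator (annuli b) (plane_rot i k \<alpha> v) = (indicator (annuli b) v :: real)" for v
    by (simp add: indicator_def annuli_def block_norm_plane_rot[OF ik])
  have conv: "(\<integral>v. g v \<partial>sphere_measure b) = (\<integral>v. indicator (annuli b) v * g v \<partial>lborel)" for g :: "real ^ 'n \<Rightarrow> real"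
    unfolding sphere_measure_def by (subst integral_restrict_space) auto
  have "(\<integral>v. f v \<partial>sphere_measure b) = (\<integral>v. indicator (annuli b) v * f v \<partial>distr lborel borel (plane_rot i k \<alpha>))"
    unfolding conv distr_plane_rot[OF ik(1)] ..
  also have "\<dots> = (\<integral>v. indicator (annuli b) v * f (plane_rot i k \<alpha> v) \<partial>lborel)"
    by (subst integral_distr) (simp_all add: ann)
  finally show ?thesis unfolding conv ..
qed

text \<open>An instance of \<open>rotation_invariant_decay\<close>: X is the direction of v in block
  j, u the direction of \<xi> in that block, and r is t_j times the norm of \<xi> there. The other
  blocks form the additional phase Y, which rotations within block j leave unchanged.\<close>

lemma sphere_fourier_decay_block:
  fixes b :: "'n::finite \<Rightarrow> 'k::finite" and j :: 'k
  assumes "2 \<le> card {i. b i = j}" and r: "1 \<le> t $ j * block_norm b j \<xi>"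
  defines "q \<equiv> (real (card {i. b i = j}) - 1) / 2"
  shows "\<bar>sphere_fourier b t \<xi>\<bar> \<le> (q + 2) * exp (q * (q + 1) / 2) * measure (sphere_measure b) (annuli b) *
           (t $ j * block_norm b j \<xi>) powr (- q)"
proof -
  define I where "I = {i. b i = j}"
  define \<rho> where "\<rho> = block_norm b j \<xi>"
  have \<rho>: "\<rho> \<noteq> 0" using r by (auto simp: \<rho>_def)
  define r where "r = t $ j * \<rho>"
  define X where "X = (\<lambda>i v. v $ i / block_norm b j v)"
  define u where "u = (\<lambda>i. \<xi> $ i / \<rho>)"
  define Y where "Y = (\<lambda>v. \<Sum>i\<in>-I. \<xi> $ i * sphere_point b t v $ i)"
  have [measurable]: "X i \<in> borel_measurable borel" "Y \<in> borel_measurable borel" for i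
    unfolding X_def Y_def sphere_point_def vec_lambda_beta by measurable
  have split: "\<xi> \<bullet> sphere_point b t v = r * (\<Sum>l\<in>I. u l * X l v) + Y v" for v
  proof -
    have "\<xi> \<bullet> sphere_point b t v = (\<Sum>i\<in>I. \<xi> $ i * sphere_point b t v $ i) + Y v"
      unfolding Y_def inner_vec_def using sum.union_disjoint[of I "-I"] by (simp add: Compl_partition)
    also have "(\<Sum>i\<in>I. \<xi> $ i * sphere_point b t v $ i) = (\<Sum>i\<in>I. r * (u i * X i v))"
      using \<rho> by (intro sum.cong) (auto simp: sphere_point_def r_def u_def X_def I_def)
    finally show ?thesis by (simp add: sum_distrib_left)
  qed
  have "\<bar>\<integral>v. cos (r * (\<Sum>l\<in>I. u l * X l v) + Y v) \<partial>sphere_measure b\<bar> \<le>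
      (q + 2) * exp (q * (q + 1) / 2) * measure (sphere_measure b) (space (sphere_measure b)) * r powr (- q)"
    unfolding q_def I_def[symmetric]
  proof (rule rotation_invariant_decay[OF finite_sphere_measure])
    show "finite I" "2 \<le> card I" using assms(1) by (auto simp: I_def)
    show "X i \<in> borel_measurable (sphere_measure b)" "Y \<in> borel_measurable (sphere_measure b)" for i
      by (intro measurable_sphere_measure; measurable)+
    show "(\<Sum>i\<in>I. (X i v)\<^sup>2) = 1" if "v \<in> space (sphere_measure b)" for v
    proof -
      have "block_norm b j v \<noteq> 0" using that by (auto simp: annuli_def dest!: spec[of _ j])
      then show ?thesis
        unfolding X_def power_divide sum_divide_distrib[symmetric] I_def block_norm_sq[symmetric] by simp
    qed
    show "(\<Sum>i\<in>I. (u i)\<^sup>2) = 1"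
      using \<rho> unfolding u_def power_divide sum_divide_distrib[symmetric] I_def block_norm_sq[symmetric] \<rho>_def by simp
    show "1 \<le> r" using r by (simp add: r_def \<rho>_def)
    fix i k \<alpha> s assume ik: "i \<in> I" "k \<in> I" "i \<noteq> k"
    then have b: "b i = b k" "b i = j" "b k = j" by (auto simp: I_def)
    let ?F = "\<lambda>v. cos (s * (\<Sum>l\<in>I. u l * X l v) + Y v)"
    have "plane_rot i k \<alpha> v $ l = v $ l" if "l \<notin> I" for l v
      using that ik by (auto simp: plane_rot_def)
    then have "Y (plane_rot i k \<alpha> v) = Y v" for v
      unfolding Y_def sphere_point_def
      by (intro sum.cong) (auto simp: block_norm_plane_rot[OF ik(3) b(1)])
    moreover have "(\<Sum>l\<in>I. u l * X l (plane_rot i k \<alpha> v)) = (\<Sum>l\<in>I. u l * X l v)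
        + (u i * X i v + u k * X k v) * (cos \<alpha> - 1) + (u k * X i v - u i * X k v) * sin \<alpha>" for v
    proof -
      define J where "J = I - {i, k}"
      have J: "I = insert i (insert k J)" "finite J" "i \<notin> insert k J" "k \<notin> J"
        using ik by (auto simp: J_def I_def)
      have sum_J: "(\<Sum>l\<in>J. u l * X l (plane_rot i k \<alpha> v)) = (\<Sum>l\<in>J. u l * X l v)"
        unfolding X_def block_norm_plane_rot[OF ik(3) b(1)]
        by (intro sum.cong) (auto simp: J_def plane_rot_def)
      have X_rot: "X i (plane_rot i k \<alpha> v) = cos \<alpha> * X i v - sin \<alpha> * X k v"
        "X k (plane_rot i k \<alpha> v) = sin \<alpha> * X i v + cos \<alpha> * X k v"
        unfolding X_def block_norm_plane_rot[OF ik(3) b(1)] using ik(3)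
        by (auto simp: plane_rot_def diff_divide_distrib add_divide_distrib)
      show ?thesis
        unfolding J(1) using J(2-4) by (simp add: sum_J X_rot algebra_simps)
    qed
    ultimately show "(\<integral>v. cos (s * ((\<Sum>l\<in>I. u l * X l v) + (u i * X i v + u k * X k v) * (cos \<alpha> - 1)
          + (u k * X i v - u i * X k v) * sin \<alpha>) + Y v) \<partial>sphere_measure b) = (\<integral>v. ?F v \<partial>sphere_measure b)"
      using integral_sphere_measure_plane_rot[OF ik(3) b(1), of ?F \<alpha>] by simp
  qed
  then show ?thesis unfolding sphere_fourier_def split by (simp add: r_def \<rho>_def)
qed

lemma sphere_fourier_bound: "\<bar>sphere_fourier b t \<xi>\<bar> \<le> measure (sphere_measure b) (annuli b)"
proof -
  interpret finite_measure "sphere_measure b" by (rule finite_sphere_measure)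
  have m: "(\<lambda>v. cos (\<xi> \<bullet> sphere_point b t v)) \<in> borel_measurable (sphere_measure b)"
    by (intro measurable_sphere_measure) measurable
  have "\<bar>sphere_fourier b t \<xi>\<bar> \<le> (\<integral>v. \<bar>cos (\<xi> \<bullet> sphere_point b t v)\<bar> \<partial>sphere_measure b)"
    unfolding sphere_fourier_def by (rule integral_abs_bound)
  also have "\<dots> \<le> (\<integral>v. 1 \<partial>sphere_measure b)"
    by (intro integral_mono integrable_abs integrable_const_bound[of _ 1] m) auto
  finally show ?thesis by simp
qed

text \<open>Only one block is exploited, one in which \<xi> has norm at least |\<xi>| / K; its decay
  exponent is at least A. The lower bound a on the radii makes the constant uniform in t.\<close>

lemma sphere_fourier_decay:
  fixes b :: "'n::finite \<Rightarrow> 'k::finite"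
  assumes card: "\<And>j. 2 \<le> card {i. b i = j}" and A: "0 \<le> A" "\<And>j. A \<le> (real (card {i. b i = j}) - 1) / 2"
    and a: "0 < a"
  shows "\<exists>C>0. \<forall>t \<xi>. (\<forall>j. a \<le> t $ j) \<longrightarrow> 1 \<le> norm \<xi> \<longrightarrow> \<bar>sphere_fourier b t \<xi>\<bar> \<le> C * norm \<xi> powr (- A)"
proof -
  define q where "q = (\<lambda>j. (real (card {i. b i = j}) - 1) / 2)"
  define m where "m = measure (sphere_measure b) (annuli b)"
  define K where "K = real CARD('k)"
  have K: "K \<ge> 1" by (simp add: K_def Suc_leI)
  define C0 where "C0 = 1 + (\<Sum>j\<in>UNIV. (q j + 2) * exp (q j * (q j + 1) / 2))"
  have q0: "0 \<le> q j" for j using card[of j] by (simp add: q_def)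
  have C0: "(q j + 2) * exp (q j * (q j + 1) / 2) \<le> C0" "1 \<le> C0" for j
  proof -
    have "(q j + 2) * exp (q j * (q j + 1) / 2) \<le> (\<Sum>j\<in>UNIV. (q j + 2) * exp (q j * (q j + 1) / 2))"
      using q0 by (intro member_le_sum) auto
    then show "(q j + 2) * exp (q j * (q j + 1) / 2) \<le> C0" by (simp add: C0_def)
    show "1 \<le> C0" using q0 by (auto simp: C0_def intro!: sum_nonneg)
  qed
  \<comment> \<open>The summand 1 makes C positive whatever the value of m.\<close>
  define C where "C = C0 * m * (a / K) powr (- A) + 1"
  have m0: "0 \<le> m" by (simp add: m_def)
  show ?thesis
  proof (intro exI[of _ C] conjI allI impI)
    show "0 < C" using C0(2) m0 by (simp add: C_def add_nonneg_pos)
    fix t :: "real ^ 'k" and \<xi> :: "real ^ 'n"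
    assume t: "\<forall>j. a \<le> t $ j" and \<xi>: "1 \<le> norm \<xi>"
    obtain j where j: "norm \<xi> / K \<le> block_norm b j \<xi>"
    proof (rule ccontr)
      assume "\<not> thesis"
      then have "block_norm b j \<xi> < norm \<xi> / K" for j using that by (meson not_le)
      then have "(block_norm b j \<xi>)\<^sup>2 < (norm \<xi> / K)\<^sup>2" for j by (intro power_strict_mono) auto
      then have "(\<Sum>j\<in>UNIV. (block_norm b j \<xi>)\<^sup>2) < (\<Sum>j\<in>(UNIV::'k set). (norm \<xi> / K)\<^sup>2)"
        by (intro sum_strict_mono) auto
      also have "\<dots> = (norm \<xi>)\<^sup>2 / K" using K by (simp add: K_def power2_eq_square)
      also have "\<dots> \<le> (norm \<xi>)\<^sup>2" using K mult_left_mono[of 1 K "(norm \<xi>)\<^sup>2"] by (simp add: divide_le_eq)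
      finally show False by (simp add: sum_block_norm_sq)
    qed
    define z where "z = a / K * norm \<xi>"
    have z0: "0 < z" unfolding z_def using a K \<xi> by (intro mult_pos_pos divide_pos_pos) auto
    have z: "z \<le> t $ j * block_norm b j \<xi>"
    proof -
      have "a * (norm \<xi> / K) \<le> t $ j * block_norm b j \<xi>" using a t j K by (intro mult_mono) (auto intro: order.trans less_imp_le)
      then show ?thesis by (simp add: z_def)
    qed
    have "\<bar>sphere_fourier b t \<xi>\<bar> \<le> C0 * m * z powr (- A)"
    proof (cases "1 \<le> z")
      case True
      then have "\<bar>sphere_fourier b t \<xi>\<bar> \<le> (q j + 2) * exp (q j * (q j + 1) / 2) * m * (t $ j * block_norm b j \<xi>) powr (- q j)"
        unfolding q_def m_def using z by (intro sphere_fourier_decay_block card) auto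
      also have "\<dots> \<le> C0 * m * z powr (- A)"
      proof (intro mult_mono C0)
        have "(t $ j * block_norm b j \<xi>) powr (- q j) \<le> z powr (- q j)"
          using z z0 q0 by (intro powr_mono2') auto
        also have "\<dots> \<le> z powr (- A)" using True A(2)[of j] by (intro powr_mono) (auto simp: q_def)
        finally show "(t $ j * block_norm b j \<xi>) powr (- q j) \<le> z powr (- A)" .
      qed (use m0 C0 in auto)
      finally show ?thesis .
    next
      \<comment> \<open>Here z^(-A) is at least 1, so the bound by the total mass suffices.\<close>
      case False
      have "\<bar>sphere_fourier b t \<xi>\<bar> \<le> m" unfolding m_def by (rule sphere_fourier_bound)
      also have "m \<le> C0 * m * z powr (- A)"
      proof -
        have "1 \<le> z powr (- A)" using False z0 A(1) powr_mono2'[of "- A" z 1] by simp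
        then have "1 * m * 1 \<le> C0 * m * z powr (- A)" using C0(2) m0 by (intro mult_mono) auto
        then show ?thesis by simp
      qed
      finally show ?thesis .
    qed
    also have "\<dots> = C0 * m * (a / K) powr (- A) * norm \<xi> powr (- A)"
      unfolding z_def powr_mult by simp
    also have "\<dots> \<le> C * norm \<xi> powr (- A)" by (intro mult_right_mono) (auto simp: C_def)
    finally show "\<bar>sphere_fourier b t \<xi>\<bar> \<le> C * norm \<xi> powr (- A)" .
  qed
qed

lemma block_norm_sphere_point:
  assumes "v \<in> annuli b"
  shows "block_norm b j (sphere_point b t v) = \<bar>t $ j\<bar>"
proof -
  have "block_norm b j v \<noteq> 0" using assms by (auto simp: annuli_def dest!: spec[of _ j])
  moreover have "(block_norm b j (sphere_point b t v))\<^sup>2 = (\<Sum>i | b i = j. (t $ j)\<^sup>2 / (block_norm b j v)\<^sup>2 * (v $ i)\<^sup>2)"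
    unfolding block_norm_sq[of b j "sphere_point b t v"]
    by (intro sum.cong) (auto simp: sphere_point_def power_divide power_mult_distrib)
  ultimately have "(block_norm b j (sphere_point b t v))\<^sup>2 = (t $ j)\<^sup>2"
    unfolding sum_distrib_left[symmetric] block_norm_sq[symmetric] by simp
  then show ?thesis by (metis abs_of_nonneg block_norm_nonneg real_sqrt_abs)
qed

text \<open>For v in the annuli, \<open>sphere_point\<close> is linear and isometric in t, and the
  cosine is 1-Lipschitz.\<close>

lemma sphere_fourier_lipschitz:
  "\<bar>sphere_fourier b t \<xi> - sphere_fourier b t' \<xi>\<bar> \<le> measure (sphere_measure b) (annuli b) * (norm \<xi> * norm (t - t'))"
proof -
  interpret finite_measure "sphere_measure b" by (rule finite_sphere_measure)
  have m: "(\<lambda>v. cos (\<xi> \<bullet> sphere_point b t v)) \<in> borel_measurable (sphere_measure b)" for t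
    by (intro measurable_sphere_measure) measurable
  have int: "integrable (sphere_measure b) (\<lambda>v. cos (\<xi> \<bullet> sphere_point b t v))" for t
    by (intro integrable_const_bound[of _ 1] m) auto
  have le: "\<bar>cos (\<xi> \<bullet> sphere_point b t v) - cos (\<xi> \<bullet> sphere_point b t' v)\<bar> \<le> norm \<xi> * norm (t - t')"
    if "v \<in> annuli b" for v
  proof -
    have "\<bar>cos x - cos y\<bar> \<le> \<bar>x - y\<bar>" for x y :: real
    proof -
      have "norm (cos x - cos y) \<le> 1 * norm (x - y)"
        by (rule field_differentiable_bound[of UNIV cos "\<lambda>x. - sin x"])
          (auto intro: derivative_eq_intros)
      then show ?thesis by simp
    qed
    then have "\<bar>cos (\<xi> \<bullet> sphere_point b t v) - cos (\<xi> \<bullet> sphere_point b t' v)\<bar> \<le>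
        \<bar>\<xi> \<bullet> sphere_point b t v - \<xi> \<bullet> sphere_point b t' v\<bar>" .
    also have "\<xi> \<bullet> sphere_point b t v - \<xi> \<bullet> sphere_point b t' v = \<xi> \<bullet> sphere_point b (t - t') v"
      by (simp add: inner_diff_right[symmetric])
        (simp add: sphere_point_def vec_eq_iff diff_divide_distrib left_diff_distrib inner_vec_def)
    also have "\<bar>\<xi> \<bullet> sphere_point b (t - t') v\<bar> \<le> norm \<xi> * norm (sphere_point b (t - t') v)"
      by (rule Cauchy_Schwarz_ineq2)
    also have "norm (sphere_point b (t - t') v) = norm (t - t')"
    proof -
      have "(norm (sphere_point b (t - t') v))\<^sup>2 = (norm (t - t'))\<^sup>2"
        unfolding sum_block_norm_sq[of b, symmetric] block_norm_sphere_point[OF that] norm_sq_eq_sum by simp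
      then show ?thesis by simp
    qed
    finally show ?thesis .
  qed
  have "\<bar>sphere_fourier b t \<xi> - sphere_fourier b t' \<xi>\<bar> =
      \<bar>\<integral>v. cos (\<xi> \<bullet> sphere_point b t v) - cos (\<xi> \<bullet> sphere_point b t' v) \<partial>sphere_measure b\<bar>"
    unfolding sphere_fourier_def using int by simp
  also have "\<dots> \<le> (\<integral>v. \<bar>cos (\<xi> \<bullet> sphere_point b t v) - cos (\<xi> \<bullet> sphere_point b t' v)\<bar> \<partial>sphere_measure b)"
    by (rule integral_abs_bound)
  also have "\<dots> \<le> (\<integral>v. norm \<xi> * norm (t - t') \<partial>sphere_measure b)"
    using int by (intro integral_mono integrable_abs Bochner_Integration.integrable_diff) (auto intro: le)
  finally show ?thesis by simp
qed

section \<open>Spectral estimates for the smoothed distance density\<close>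

text \<open>The squared modulus of the Fourier transform of the measure with mass \<open>w x\<close>
  at each point x of P, in real form.\<close>

definition power_spectrum :: "'a::real_inner set \<Rightarrow> ('a \<Rightarrow> real) \<Rightarrow> 'a \<Rightarrow> real" where
  "power_spectrum P w \<xi> = (\<Sum>x\<in>P. w x * cos (\<xi> \<bullet> x))\<^sup>2 + (\<Sum>x\<in>P. w x * sin (\<xi> \<bullet> x))\<^sup>2"

lemma power_spectrum_nonneg: "0 \<le> power_spectrum P w \<xi>"
  by (simp add: power_spectrum_def)

lemma power_spectrum_eq: "power_spectrum P w \<xi> = (\<Sum>x\<in>P. \<Sum>y\<in>P. w x * w y * cos (\<xi> \<bullet> (x - y)))"
  unfolding power_spectrum_def power2_eq_square sum_product sum.distrib[symmetric]
  by (intro sum.cong refl) (simp add: inner_diff_right cos_diff algebra_simps)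

text \<open>The sine terms are antisymmetric under exchanging x and y and cancel, so the phase
  \<beta> comes out as the factor cos \<beta>.\<close>

lemma sum_phase_shifted_cos:
  "(\<Sum>x\<in>P. \<Sum>y\<in>P. w x * w y * cos (\<xi> \<bullet> (x - y) - \<beta>)) = cos \<beta> * power_spectrum P w \<xi>"
proof -
  have "(\<Sum>x\<in>P. \<Sum>y\<in>P. w x * w y * sin (\<xi> \<bullet> (x - y))) = (\<Sum>y\<in>P. \<Sum>x\<in>P. w x * w y * sin (\<xi> \<bullet> (x - y)))"
    by (rule sum.swap)
  also have "\<dots> = - (\<Sum>x\<in>P. \<Sum>y\<in>P. w x * w y * sin (\<xi> \<bullet> (x - y)))"
    unfolding sum_negf[symmetric]
    by (intro sum.cong refl) (simp add: inner_diff_right sin_diff algebra_simps)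
  finally have *: "(\<Sum>x\<in>P. \<Sum>y\<in>P. w x * w y * sin (\<xi> \<bullet> (x - y))) = 0" by simp
  have "(\<Sum>x\<in>P. \<Sum>y\<in>P. w x * w y * cos (\<xi> \<bullet> (x - y) - \<beta>)) =
      (\<Sum>x\<in>P. \<Sum>y\<in>P. cos \<beta> * (w x * w y * cos (\<xi> \<bullet> (x - y))) + sin \<beta> * (w x * w y * sin (\<xi> \<bullet> (x - y))))"
    by (intro sum.cong refl) (simp add: cos_diff[of _ \<beta>] distrib_left mult_ac)
  also have "\<dots> = cos \<beta> * power_spectrum P w \<xi> + sin \<beta> * (\<Sum>x\<in>P. \<Sum>y\<in>P. w x * w y * sin (\<xi> \<bullet> (x - y)))"
    unfolding power_spectrum_eq by (simp add: sum.distrib sum_distrib_left)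
  finally show ?thesis using * by simp
qed

lemma power_spectrum_le_1:
  assumes "\<And>x. 0 \<le> w x" "sum w P = 1"
  shows "power_spectrum P w \<xi> \<le> 1"
proof -
  have "power_spectrum P w \<xi> \<le> (\<Sum>x\<in>P. \<Sum>y\<in>P. w x * w y)"
    unfolding power_spectrum_eq using assms(1)
    by (intro sum_mono) (simp add: mult_left_le)
  then show ?thesis using assms(2) by (simp add: sum_product[symmetric])
qed

lemma borel_measurable_power_spectrum [measurable]:
  "power_spectrum P w \<in> borel_measurable (borel :: 'a::euclidean_space measure)"
  unfolding power_spectrum_def by (intro borel_measurable_continuous_onI continuous_intros)

text \<open>The density \<nu> in physical space, used with u = 4^-n: a Gaussian of width about sqrt
  u compares the differences x - y with the points of the spheres of radii t.\<close>

definition distance_density ::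
  "('n::finite \<Rightarrow> 'k::finite) \<Rightarrow> real \<Rightarrow> (real ^ 'n) set \<Rightarrow> (real ^ 'n \<Rightarrow> real) \<Rightarrow> real ^ 'k \<Rightarrow> real" where
  "distance_density b u P w t = sqrt (pi / u) ^ CARD('n) *
     (\<Sum>x\<in>P. \<Sum>y\<in>P. w x * w y *
        (\<integral>v. exp (- (norm (x - y - sphere_point b t v))\<^sup>2 / (4 * u)) \<partial>sphere_measure b))"

lemma measurable_sphere_point_sphere_measure [measurable]:
  "sphere_point b t \<in> borel_measurable (sphere_measure b)"
  unfolding sphere_measure_def by (intro measurable_restrict_space1) simp

lemma integrable_power_spectrum:
  assumes "0 < u"
  shows "integrable lborel (\<lambda>\<xi>::'a::euclidean_space. exp (- u * (norm \<xi>)\<^sup>2) * power_spectrum P w \<xi>)"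
proof -
  have "integrable lborel (\<lambda>\<xi>::'a. \<Sum>x\<in>P. \<Sum>y\<in>P. w x * w y * (cos (\<xi> \<bullet> (x - y)) * exp (- u * (norm \<xi>)\<^sup>2)))"
    using gaussian_fourier[OF assms] by (intro Bochner_Integration.integrable_sum integrable_mult_right)
      (auto simp: has_bochner_integral_iff)
  then show ?thesis by (simp add: power_spectrum_eq sum_distrib_left mult_ac)
qed

text \<open>Each Gaussian is expanded by \<open>gaussian_fourier\<close>. Fubini applies because the
  integrand is dominated by a Gaussian in \<xi> and the sphere measure is finite; summing over
  pairs, \<open>sum_phase_shifted_cos\<close> separates the spectrum of the weights from that of the
  spheres.\<close>

lemma distance_density_fourier:
  fixes b :: "'n::finite \<Rightarrow> 'k::finite"
  assumes u: "0 < u"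
  shows "distance_density b u P w t =
    (\<integral>\<xi>. exp (- u * (norm \<xi>)\<^sup>2) * power_spectrum P w \<xi> * sphere_fourier b t \<xi> \<partial>lborel)"
proof -
  interpret S: finite_measure "sphere_measure b" by (rule finite_sphere_measure)
  interpret SL: pair_sigma_finite "sphere_measure b" "lborel :: (real ^ 'n) measure" by standard
  define g where "g = (\<lambda>\<xi>::real ^ 'n. exp (- u * (norm \<xi>)\<^sup>2))"
  define f where "f = (\<lambda>z v \<xi>. cos (\<xi> \<bullet> (z - sphere_point b t v)) * g \<xi>)"
  have [measurable]: "g \<in> borel_measurable borel" unfolding g_def by measurable
  have g: "integrable lborel g" "\<And>\<xi>. 0 \<le> g \<xi>" unfolding g_def using integrable_gaussian[OF u] by auto
  have f_int: "integrable (sphere_measure b \<Otimes>\<^sub>M lborel) (case_prod (f z))" for z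
  proof (rule SL.Fubini_integrable)
    show [measurable]: "case_prod (f z) \<in> borel_measurable (sphere_measure b \<Otimes>\<^sub>M lborel)"
      unfolding f_def by measurable
    have int_v: "integrable lborel (\<lambda>\<xi>. f z v \<xi>)" for v
      using gaussian_fourier[OF u, of "z - sphere_point b t v"] by (simp add: f_def g_def has_bochner_integral_iff)
    then show "AE v in sphere_measure b. integrable lborel (\<lambda>\<xi>. case_prod (f z) (v, \<xi>))" by simp
    have "norm (\<integral>\<xi>. norm (f z v \<xi>) \<partial>lborel) \<le> (\<integral>\<xi>. g \<xi> \<partial>lborel)" for v
    proof -
      have "(\<integral>\<xi>. norm (f z v \<xi>) \<partial>lborel) \<le> (\<integral>\<xi>. g \<xi> \<partial>lborel)"
        using g by (intro integral_mono integrable_norm int_v) (auto simp: f_def abs_mult mult_left_le_one_le)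
      then show ?thesis by (simp add: integral_nonneg_AE)
    qed
    then show "integrable (sphere_measure b) (\<lambda>v. \<integral>\<xi>. norm (case_prod (f z) (v, \<xi>)) \<partial>lborel)"
      by (intro S.integrable_const_bound[of _ "\<integral>\<xi>. g \<xi> \<partial>lborel"]) (auto intro: AE_I2)
  qed
  have one: "sqrt (pi / u) ^ CARD('n) * (\<integral>v. exp (- (norm (z - sphere_point b t v))\<^sup>2 / (4 * u)) \<partial>sphere_measure b)
      = (\<integral>\<xi>. (\<integral>v. f z v \<xi> \<partial>sphere_measure b) \<partial>lborel)" for z
  proof -
    have "sqrt (pi / u) ^ CARD('n) * exp (- (norm (z - sphere_point b t v))\<^sup>2 / (4 * u)) = (\<integral>\<xi>. f z v \<xi> \<partial>lborel)" for v
      using gaussian_fourier[OF u, of "z - sphere_point b t v"] by (simp add: f_def g_def has_bochner_integral_iff)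
    then have "sqrt (pi / u) ^ CARD('n) * (\<integral>v. exp (- (norm (z - sphere_point b t v))\<^sup>2 / (4 * u)) \<partial>sphere_measure b)
        = (\<integral>v. (\<integral>\<xi>. f z v \<xi> \<partial>lborel) \<partial>sphere_measure b)"
      by (metis (no_types, lifting) Bochner_Integration.integral_cong integral_mult_right_zero)
    also have "\<dots> = (\<integral>\<xi>. (\<integral>v. f z v \<xi> \<partial>sphere_measure b) \<partial>lborel)"
      by (rule SL.Fubini_integral[OF f_int, symmetric])
    finally show ?thesis .
  qed
  have int_xi: "integrable lborel (\<lambda>\<xi>. \<integral>v. f z v \<xi> \<partial>sphere_measure b)" for z
    using SL.integrable_snd[OF f_int] by simp
  have int_v: "integrable (sphere_measure b) (\<lambda>v. f z v \<xi>)" for z \<xi>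
  proof (rule S.integrable_const_bound[of _ "g \<xi>"])
    show "(\<lambda>v. f z v \<xi>) \<in> borel_measurable (sphere_measure b)" unfolding f_def by measurable
  qed (use g in \<open>auto simp: f_def abs_mult mult_left_le_one_le\<close>)
  have "distance_density b u P w t =
      (\<Sum>x\<in>P. \<Sum>y\<in>P. w x * w y * (\<integral>\<xi>. (\<integral>v. f (x - y) v \<xi> \<partial>sphere_measure b) \<partial>lborel))"
    unfolding distance_density_def one[symmetric] by (simp add: sum_distrib_left mult_ac)
  also have "\<dots> = (\<integral>\<xi>. (\<Sum>x\<in>P. \<Sum>y\<in>P. w x * w y * (\<integral>v. f (x - y) v \<xi> \<partial>sphere_measure b)) \<partial>lborel)"
    using int_xi by (simp add: Bochner_Integration.integral_sum)
  also have "\<dots> = (\<integral>\<xi>. g \<xi> * power_spectrum P w \<xi> * sphere_fourier b t \<xi> \<partial>lborel)"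
  proof (rule Bochner_Integration.integral_cong[OF refl])
    fix \<xi> :: "real ^ 'n"
    have "(\<Sum>x\<in>P. \<Sum>y\<in>P. w x * w y * (\<integral>v. f (x - y) v \<xi> \<partial>sphere_measure b)) =
        (\<integral>v. (\<Sum>x\<in>P. \<Sum>y\<in>P. w x * w y * f (x - y) v \<xi>) \<partial>sphere_measure b)"
      using int_v by (simp add: Bochner_Integration.integral_sum)
    also have "(\<lambda>v. \<Sum>x\<in>P. \<Sum>y\<in>P. w x * w y * f (x - y) v \<xi>) =
        (\<lambda>v. g \<xi> * power_spectrum P w \<xi> * cos (\<xi> \<bullet> sphere_point b t v))"
    proof
      fix v
      have "(\<Sum>x\<in>P. \<Sum>y\<in>P. w x * w y * f (x - y) v \<xi>) =
          g \<xi> * (\<Sum>x\<in>P. \<Sum>y\<in>P. w x * w y * cos (\<xi> \<bullet> (x - y) - \<xi> \<bullet> sphere_point b t v))"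
        by (simp add: f_def inner_diff_right sum_distrib_left mult_ac)
      then show "(\<Sum>x\<in>P. \<Sum>y\<in>P. w x * w y * f (x - y) v \<xi>) =
          g \<xi> * power_spectrum P w \<xi> * cos (\<xi> \<bullet> sphere_point b t v)"
        unfolding sum_phase_shifted_cos by simp
    qed
    finally show "(\<Sum>x\<in>P. \<Sum>y\<in>P. w x * w y * (\<integral>v. f (x - y) v \<xi> \<partial>sphere_measure b)) =
        g \<xi> * power_spectrum P w \<xi> * sphere_fourier b t \<xi>"
      by (simp add: sphere_fourier_def)
  qed
  finally show ?thesis by (simp add: g_def)
qed

section \<open>Energy and spectral tail of Frostman weights\<close>

lemma summable_gaussian_moment: "summable (\<lambda>k. exp (- (real k)\<^sup>2 / 4) * (real k + 1) powr s)"
proof (rule summable_comparison_test_bigo)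
  show "summable (\<lambda>k. norm (1 / real k ^ 2))" using inverse_power_summable[of 2] by (simp add: field_simps)
  show "(\<lambda>k. exp (- (real k)\<^sup>2 / 4) * (real k + 1) powr s) \<in> O(\<lambda>k. 1 / real k ^ 2)" by real_asymp
qed

text \<open>For r \<le> 1 no coordinate is left free when J = UNIV; for larger r the total mass 1 is
  a sufficient bound, hence \<open>max C 1\<close>.\<close>

lemma frostman_ball:
  assumes F: "frostman_weights C s n P w" and s: "0 \<le> s" and r: "1 / 2 ^ n \<le> r"
  shows "sum w {y\<in>P. norm (x - y) \<le> r} \<le> max C 1 * r powr s"
proof -
  have P: "finite P" "\<And>x. 0 \<le> w x" "sum w P = 1" using F by (auto simp: frostman_weights_def)
  show ?thesis
  proof (cases "r \<le> 1")
    case True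
    have "sum w {y\<in>P. norm (x - y) \<le> r} \<le> sum w {y\<in>P. \<forall>i\<in>UNIV. \<bar>x $ i - y $ i\<bar> \<le> r}"
      using P component_le_norm_cart[of "x - _"]
      by (intro sum_mono2) (auto intro: order.trans simp flip: vector_minus_component)
    also have "\<dots> \<le> C * r powr (s - real (card (- (UNIV :: 'a set))))"
      using F r True unfolding frostman_weights_def by blast
    also have "\<dots> \<le> max C 1 * r powr s" by (simp add: mult_right_mono)
    finally show ?thesis .
  next
    case False
    have "sum w {y\<in>P. norm (x - y) \<le> r} \<le> sum w P" using P by (intro sum_mono2) auto
    also have "\<dots> = 1 * 1" using P by simp
    also have "\<dots> \<le> max C 1 * r powr s" using False s by (intro mult_mono ge_one_powr_ge_zero) auto
    finally show ?thesis .
  qed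
qed

text \<open>Sort the points by the integer part k of |x - y| / \<tau>. Such a shell lies in a ball
  of radius (k + 1) \<tau>, whose mass is O(((k + 1) \<tau>)^s), while the Gaussian is at most exp
  (-k^2 / 4) on it; the sum over k converges.\<close>

lemma frostman_gaussian_sum:
  assumes F: "frostman_weights C s n P w" and s: "0 \<le> s" and \<tau>: "1 / 2 ^ n \<le> \<tau>"
  shows "(\<Sum>y\<in>P. w y * exp (- (norm (x - y))\<^sup>2 / (4 * \<tau>\<^sup>2))) \<le>
    max C 1 * (\<Sum>k. exp (- (real k)\<^sup>2 / 4) * (real k + 1) powr s) * \<tau> powr s"
proof -
  have P: "finite P" "\<And>x. 0 \<le> w x" "sum w P = 1" using F by (auto simp: frostman_weights_def)
  have \<tau>0: "\<tau> > 0" using \<tau> by (smt (verit) divide_pos_pos zero_less_power)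
  define k where "k = (\<lambda>y. nat \<lfloor>norm (x - y) / \<tau>\<rfloor>)"
  have k: "real (k y) \<le> norm (x - y) / \<tau>" "norm (x - y) \<le> (real (k y) + 1) * \<tau>" for y
  proof -
    have "0 \<le> norm (x - y) / \<tau>" using \<tau>0 by simp
    then show "real (k y) \<le> norm (x - y) / \<tau>" unfolding k_def by linarith
    have "norm (x - y) / \<tau> \<le> real (k y) + 1" unfolding k_def by linarith
    then show "norm (x - y) \<le> (real (k y) + 1) * \<tau>" using \<tau>0 by (simp add: field_simps)
  qed
  define K where "K = Max (insert 0 (k ` P))"
  have kK: "k y \<le> K" if "y \<in> P" for y using that P(1) by (auto simp: K_def)
  define e where "e = (\<lambda>k::nat. exp (- (real k)\<^sup>2 / 4))"
  have "(\<Sum>y\<in>P. w y * exp (- (norm (x - y))\<^sup>2 / (4 * \<tau>\<^sup>2))) \<le>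
      (\<Sum>y\<in>P. w y * (\<Sum>j\<le>K. if norm (x - y) \<le> (real j + 1) * \<tau> then e j else 0))"
  proof (intro sum_mono mult_left_mono P(2))
    fix y assume y: "y \<in> P"
    have "(real (k y))\<^sup>2 \<le> (norm (x - y) / \<tau>)\<^sup>2" using k(1) by (intro power_mono) auto
    then have "exp (- (norm (x - y))\<^sup>2 / (4 * \<tau>\<^sup>2)) \<le> e (k y)"
      by (simp add: e_def power_divide field_simps)
    also have "\<dots> = (if norm (x - y) \<le> (real (k y) + 1) * \<tau> then e (k y) else 0)" using k(2) by simp
    also have "\<dots> \<le> (\<Sum>j\<le>K. if norm (x - y) \<le> (real j + 1) * \<tau> then e j else 0)"
      using kK[OF y] by (intro member_le_sum[of "k y"]) (auto simp: e_def)
    finally show "exp (- (norm (x - y))\<^sup>2 / (4 * \<tau>\<^sup>2)) \<le>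
        (\<Sum>j\<le>K. if norm (x - y) \<le> (real j + 1) * \<tau> then e j else 0)" .
  qed
  also have "\<dots> = (\<Sum>j\<le>K. \<Sum>y\<in>P. if norm (x - y) \<le> (real j + 1) * \<tau> then w y * e j else 0)"
    unfolding sum_distrib_left by (subst sum.swap) (simp add: if_distrib cong: if_cong)
  also have "\<dots> = (\<Sum>j\<le>K. e j * sum w {y\<in>P. norm (x - y) \<le> (real j + 1) * \<tau>})"
    using P(1) by (simp add: sum.inter_filter[symmetric] sum_distrib_left mult.commute)
  also have "\<dots> \<le> (\<Sum>j\<le>K. e j * (max C 1 * ((real j + 1) * \<tau>) powr s))"
  proof (intro sum_mono mult_left_mono frostman_ball[OF F s])
    fix j :: nat
    have "1 * \<tau> \<le> (real j + 1) * \<tau>" using \<tau>0 by (intro mult_right_mono) auto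
    then show "1 / 2 ^ n \<le> (real j + 1) * \<tau>" using \<tau> by linarith
  qed (simp add: e_def)
  also have "\<dots> = max C 1 * \<tau> powr s * (\<Sum>j\<le>K. e j * (real j + 1) powr s)"
    using \<tau>0 by (simp add: powr_mult sum_distrib_left mult_ac)
  also have "\<dots> \<le> max C 1 * \<tau> powr s * (\<Sum>k. e k * (real k + 1) powr s)"
    using summable_gaussian_moment[of s] unfolding e_def by (intro mult_left_mono sum_le_suminf) auto
  finally show ?thesis by (simp add: e_def mult_ac)
qed

lemma quarter_power: "(1 / 4) ^ n = (1 / 2 ^ n :: real)\<^sup>2"
  by (simp add: power_divide power2_eq_square power_mult_distrib[symmetric])

text \<open>By the Gaussian Fourier transform the integral is (\<pi> / u)^(d/2) times a weighted
  double sum of Gaussians of width about sqrt u. The Frostman condition, available because sqrt u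
  \<ge> 2^-n, bounds that sum by O(u^(s/2)).\<close>

lemma frostman_energy:
  assumes s: "0 \<le> s"
  shows "\<exists>K>0. \<forall>n P w u. frostman_weights C s n (P :: (real ^ 'n) set) w \<longrightarrow> 0 < u \<longrightarrow> (1 / 4) ^ n \<le> u \<longrightarrow>
    (\<integral>\<xi>. exp (- u * (norm \<xi>)\<^sup>2) * power_spectrum P w \<xi> \<partial>lborel) \<le> K * u powr (- (real CARD('n) - s) / 2)"
proof -
  define S where "S = (\<Sum>k. exp (- (real k)\<^sup>2 / 4) * (real k + 1) powr s)"
  have "exp (- (real 0)\<^sup>2 / 4) * (real 0 + 1) powr s \<le> S"
    unfolding S_def using sum_le_suminf[OF summable_gaussian_moment[of s], of "{0}"] by simp
  then have S: "S > 0" by simp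
  define K where "K = sqrt pi ^ CARD('n) * (max C 1 * S)"
  have K: "K > 0" using S by (simp add: K_def)
  have "(\<integral>\<xi>. exp (- u * (norm \<xi>)\<^sup>2) * power_spectrum P w \<xi> \<partial>lborel) \<le> K * u powr (- (real CARD('n) - s) / 2)"
    if F: "frostman_weights C s n P w" and u: "0 < u" "(1 / 4) ^ n \<le> u" for n u w and P :: "(real ^ 'n) set"
  proof -
    have P: "finite P" "\<And>x. 0 \<le> w x" "sum w P = 1" using F by (auto simp: frostman_weights_def)
    define \<tau> where "\<tau> = sqrt u"
    have \<tau>: "\<tau>\<^sup>2 = u" "0 < \<tau>" using u by (auto simp: \<tau>_def)
    have "(1 / 2 ^ n)\<^sup>2 \<le> \<tau>\<^sup>2"
      using u(2) unfolding \<tau>(1) quarter_power .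
    then have \<tau>n: "1 / 2 ^ n \<le> \<tau>" by (rule power2_le_imp_le) (use \<tau> in simp)
    have int: "integrable lborel (\<lambda>\<xi>. cos (\<xi> \<bullet> z) * exp (- u * (norm \<xi>)\<^sup>2))"
      and eq: "(\<integral>\<xi>. cos (\<xi> \<bullet> z) * exp (- u * (norm \<xi>)\<^sup>2) \<partial>lborel) =
        sqrt (pi / u) ^ CARD('n) * exp (- (norm z)\<^sup>2 / (4 * u))" for z :: "real ^ 'n"
      using gaussian_fourier[OF u(1), of z] by (auto simp: has_bochner_integral_iff)
    have "(\<integral>\<xi>. exp (- u * (norm \<xi>)\<^sup>2) * power_spectrum P w \<xi> \<partial>lborel) =
        (\<integral>\<xi>. (\<Sum>x\<in>P. \<Sum>y\<in>P. w x * w y * (cos (\<xi> \<bullet> (x - y)) * exp (- u * (norm \<xi>)\<^sup>2))) \<partial>lborel)"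
      by (simp add: power_spectrum_eq sum_distrib_left mult_ac)
    also have "\<dots> = (\<Sum>x\<in>P. \<Sum>y\<in>P. w x * w y * (\<integral>\<xi>. cos (\<xi> \<bullet> (x - y)) * exp (- u * (norm \<xi>)\<^sup>2) \<partial>lborel))"
      using int by (simp add: Bochner_Integration.integral_sum)
    also have "\<dots> = sqrt (pi / u) ^ CARD('n) * (\<Sum>x\<in>P. w x * (\<Sum>y\<in>P. w y * exp (- (norm (x - y))\<^sup>2 / (4 * \<tau>\<^sup>2))))"
      unfolding eq \<tau>(1) by (simp add: sum_distrib_left mult_ac)
    also have "\<dots> \<le> sqrt (pi / u) ^ CARD('n) * (\<Sum>x\<in>P. w x * (max C 1 * S * \<tau> powr s))"
      unfolding S_def using u(1)
      by (intro mult_left_mono sum_mono frostman_gaussian_sum[OF F s \<tau>n] P(2)) auto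
    also have "\<dots> = sqrt (pi / u) ^ CARD('n) * (max C 1 * S * \<tau> powr s)"
      using P(3) by (simp add: sum_distrib_right[symmetric])
    also have "sqrt (pi / u) ^ CARD('n) = sqrt pi ^ CARD('n) * u powr (- real CARD('n) / 2)"
    proof -
      have "sqrt u ^ CARD('n) = u powr (real CARD('n) / 2)"
      proof -
        have "sqrt u ^ CARD('n) = (u powr (1 / 2)) powr real CARD('n)"
          unfolding powr_half_sqrt[OF less_imp_le[OF u(1)]] using u(1) by (simp add: powr_realpow)
        then show ?thesis unfolding powr_powr by simp
      qed
      moreover have "u powr (- real CARD('n) / 2) = inverse (u powr (real CARD('n) / 2))"
        using powr_minus[of u "real CARD('n) / 2"] by (simp only: minus_divide_left)
      moreover have "sqrt (pi / u) ^ CARD('n) = sqrt pi ^ CARD('n) / sqrt u ^ CARD('n)"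
        by (simp only: real_sqrt_divide power_divide)
      ultimately show ?thesis by (simp only: divide_inverse)
    qed
    also have "\<tau> powr s = u powr (s / 2)"
    proof -
      have "\<tau> = u powr (1 / 2)" using u(1) powr_half_sqrt[of u] by (simp add: \<tau>_def)
      then show ?thesis by (simp add: powr_powr)
    qed
    also have "sqrt pi ^ CARD('n) * u powr (- real CARD('n) / 2) * (max C 1 * S * u powr (s / 2)) =
        K * (u powr (- real CARD('n) / 2) * u powr (s / 2))" by (simp only: K_def mult_ac)
    also have "\<dots> = K * u powr (- (real CARD('n) - s) / 2)"
      by (simp add: powr_add[symmetric] diff_divide_distrib)
    finally show ?thesis .
  qed
  then show ?thesis using K by blast
qed

text \<open>
  Uniform integrability at infinity: dyadic annuli \<open>2\<^sup>j \<le> |\<xi>| < 2\<^sup>j\<^sup>+\<^sup>1\<close> contribute at most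
  \<open>2\<^sup>j\<^sup>(\<^sup>d\<^sup>-\<^sup>s\<^sup>-\<^sup>A\<^sup>)\<close>, a convergent geometric series because \<open>s > d - A\<close>.
\<close>

lemma frostman_spectral_tail:
  assumes s: "0 \<le> s" "s \<le> real CARD('n)" and A: "real CARD('n) - s < A"
  shows "\<exists>K>0. \<exists>\<theta>. 0 < \<theta> \<and> \<theta> < 1 \<and> (\<forall>n P w J. frostman_weights C s n (P :: (real ^ 'n) set) w \<longrightarrow>
    (\<integral>\<^sup>+\<xi>. ennreal (indicator {\<xi>. 2 ^ J \<le> norm \<xi>} \<xi> * norm \<xi> powr (- A) *
        (exp (- ((1 / 4) ^ n) * (norm \<xi>)\<^sup>2) * power_spectrum P w \<xi>)) \<partial>lborel) \<le> ennreal (K * \<theta> ^ J))"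
proof -
  define e where "e = real CARD('n) - s"
  have e: "0 \<le> e" "e < A" using s A by (auto simp: e_def)
  obtain K0 where K0: "K0 > 0" and energy: "\<And>n P w u. frostman_weights C s n (P :: (real ^ 'n) set) w \<Longrightarrow> 0 < u \<Longrightarrow>
      (1 / 4) ^ n \<le> u \<Longrightarrow>
      (\<integral>\<xi>. exp (- u * (norm \<xi>)\<^sup>2) * power_spectrum P w \<xi> \<partial>lborel) \<le> K0 * u powr (- e / 2)"
    using frostman_energy[OF s(1), of C] unfolding e_def by blast
  define \<theta> where "\<theta> = 2 powr (e - A)"
  have \<theta>: "0 < \<theta>" "\<theta> < 1" using e powr_less_mono[of "e - A" 0 2] by (auto simp: \<theta>_def)
  define K1 where "K1 = exp 1 * K0 * 2 powr e"
  have K1: "K1 > 0" using K0 by (simp add: K1_def)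
  have "(\<integral>\<^sup>+\<xi>. ennreal (indicator {\<xi>. 2 ^ J \<le> norm \<xi>} \<xi> * norm \<xi> powr (- A) *
        (exp (- ((1 / 4) ^ n) * (norm \<xi>)\<^sup>2) * power_spectrum P w \<xi>)) \<partial>lborel) \<le> ennreal (K1 / (1 - \<theta>) * \<theta> ^ J)"
    if F: "frostman_weights C s n P w" for n J w and P :: "(real ^ 'n) set"
  proof -
    define W where "W = (\<lambda>\<xi>. exp (- ((1 / 4) ^ n) * (norm \<xi>)\<^sup>2) * power_spectrum P w \<xi>)"
    have W0: "0 \<le> W \<xi>" for \<xi> by (simp add: W_def power_spectrum_nonneg)
    have [measurable]: "W \<in> borel_measurable borel" unfolding W_def by measurable
    define D where "D = (\<lambda>j. {\<xi>::real ^ 'n. 2 ^ j \<le> norm \<xi> \<and> norm \<xi> < 2 ^ Suc j})"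
    have [measurable]: "D j \<in> sets borel" for j unfolding D_def by measurable
    have shell: "(\<integral>\<^sup>+\<xi>. ennreal (indicator (D j) \<xi> * norm \<xi> powr (- A) * W \<xi>) \<partial>lborel) \<le> ennreal (K1 * \<theta> ^ j)" for j
    proof -
      \<comment> \<open>On the shell v |\<xi>|^2 \<le> 1, so inserting exp (-v |\<xi>|^2) costs at
        most the factor exp 1. Adding v to 4^-n instead of replacing it keeps u \<ge> 4^-n, where
        the energy bound holds, even for shells beyond frequency 2^n.\<close>
      define v where "v = (1 / 4 :: real) ^ Suc j"
      define u where "u = (1 / 4) ^ n + v"
      have v0: "0 < v" by (simp add: v_def)
      have v2: "v = (1 / 2 ^ Suc j)\<^sup>2"
        unfolding v_def by (rule quarter_power)
      have u: "0 < u" "(1 / 4) ^ n \<le> u" "v \<le> u" using v0 by (auto simp: u_def add_pos_pos)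
      have pw: "indicator (D j) \<xi> * norm \<xi> powr (- A) * W \<xi> \<le>
          exp 1 * 2 powr (- (A * real j)) * (exp (- u * (norm \<xi>)\<^sup>2) * power_spectrum P w \<xi>)" for \<xi>
      proof (cases "\<xi> \<in> D j")
        case True
        have "norm \<xi> powr (- A) \<le> (2 ^ j) powr (- A)"
          using True e by (intro powr_mono2') (auto simp: D_def)
        also have "\<dots> = 2 powr (- (A * real j))" by (simp add: powr_realpow[symmetric] powr_powr mult.commute)
        finally have 1: "norm \<xi> powr (- A) \<le> 2 powr (- (A * real j))" .
        have "v * (norm \<xi>)\<^sup>2 \<le> v * (2 ^ Suc j)\<^sup>2"
          using True v0 by (intro mult_left_mono power_mono) (auto simp: D_def)
        also have "\<dots> = 1" unfolding v2 power_mult_distrib[symmetric] by simp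
        finally have "W \<xi> \<le> exp 1 * (exp (- u * (norm \<xi>)\<^sup>2) * power_spectrum P w \<xi>)"
          unfolding W_def u_def mult.assoc[symmetric] exp_add[symmetric]
          by (intro mult_right_mono power_spectrum_nonneg) (simp add: algebra_simps)
        then have "norm \<xi> powr (- A) * W \<xi> \<le>
            2 powr (- (A * real j)) * (exp 1 * (exp (- u * (norm \<xi>)\<^sup>2) * power_spectrum P w \<xi>))"
          using 1 W0 by (intro mult_mono) auto
        then show ?thesis using True by (simp add: mult_ac)
      qed (simp add: power_spectrum_nonneg)
      have "(\<integral>\<^sup>+\<xi>. ennreal (indicator (D j) \<xi> * norm \<xi> powr (- A) * W \<xi>) \<partial>lborel) \<le>
          (\<integral>\<^sup>+\<xi>. ennreal (exp 1 * 2 powr (- (A * real j)) * (exp (- u * (norm \<xi>)\<^sup>2) * power_spectrum P w \<xi>)) \<partial>lborel)"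
        using pw by (intro nn_integral_mono ennreal_leI)
      also have "\<dots> = ennreal (\<integral>\<xi>. exp 1 * 2 powr (- (A * real j)) * (exp (- u * (norm \<xi>)\<^sup>2) * power_spectrum P w \<xi>) \<partial>lborel)"
        by (intro nn_integral_eq_integral integrable_mult_right integrable_power_spectrum u)
           (simp add: power_spectrum_nonneg)
      also have "\<dots> = ennreal (exp 1 * 2 powr (- (A * real j)) * (\<integral>\<xi>. exp (- u * (norm \<xi>)\<^sup>2) * power_spectrum P w \<xi> \<partial>lborel))"
        by (simp only: integral_mult_right_zero)
      also have "\<dots> \<le> ennreal (exp 1 * 2 powr (- (A * real j)) * (K0 * v powr (- e / 2)))"
      proof (intro ennreal_leI mult_left_mono)
        \<comment> \<open>The exponent is nonpositive and v \<le> u, which removes the dependence on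
          n.\<close>
        have "u powr (- e / 2) \<le> v powr (- e / 2)" using u v0 e by (intro powr_mono2') auto
        then show "(\<integral>\<xi>. exp (- u * (norm \<xi>)\<^sup>2) * power_spectrum P w \<xi> \<partial>lborel) \<le> K0 * v powr (- e / 2)"
          using energy[OF F u(1,2)] K0 by (meson mult_left_mono less_imp_le order.trans)
      qed auto
      also have "exp 1 * 2 powr (- (A * real j)) * (K0 * v powr (- e / 2)) = K1 * \<theta> ^ j"
      proof -
        have "v powr (- e / 2) = (1 / 2 ^ Suc j) powr (- e)"
          unfolding v2 by (subst powr_numeral[symmetric], simp, subst powr_powr) simp
        also have "\<dots> = 2 powr (real (Suc j) * e)" unfolding dyadic_powr by simp
        also have "\<dots> = 2 powr (e * real j) * 2 powr e" by (simp add: powr_add[symmetric] algebra_simps)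
        finally have "v powr (- e / 2) = 2 powr (e * real j) * 2 powr e" .
        moreover have "\<theta> ^ j = 2 powr (- (A * real j)) * 2 powr (e * real j)"
          by (simp add: \<theta>_def powr_realpow[symmetric] powr_powr powr_add[symmetric] algebra_simps)
        ultimately show ?thesis by (simp add: K1_def mult_ac)
      qed
      finally show ?thesis .
    qed
    have "(\<integral>\<^sup>+\<xi>. ennreal (indicator {\<xi>. 2 ^ J \<le> norm \<xi>} \<xi> * norm \<xi> powr (- A) * W \<xi>) \<partial>lborel) \<le>
        (\<integral>\<^sup>+\<xi>. (\<Sum>i. ennreal (indicator (D (J + i)) \<xi> * norm \<xi> powr (- A) * W \<xi>)) \<partial>lborel)"
    proof (intro nn_integral_mono)
      fix \<xi> :: "real ^ 'n"
      show "ennreal (indicator {\<xi>. 2 ^ J \<le> norm \<xi>} \<xi> * norm \<xi> powr (- A) * W \<xi>) \<le>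
          (\<Sum>i. ennreal (indicator (D (J + i)) \<xi> * norm \<xi> powr (- A) * W \<xi>))"
      proof (cases "2 ^ J \<le> norm \<xi>")
        case True
        obtain N where N: "norm \<xi> < 2 ^ N" using real_arch_pow[of 2 "norm \<xi>"] by auto
        \<comment> \<open>Minimality of m places \<xi> in the dyadic shell with index m - 1, and m -
          1 is at least J.\<close>
        define m where "m = (LEAST m. norm \<xi> < 2 ^ m)"
        have m: "norm \<xi> < 2 ^ m" unfolding m_def by (rule LeastI[of _ N]) (rule N)
        have "J < m"
        proof (rule ccontr)
          assume "\<not> J < m"
          then have "(2::real) ^ m \<le> 2 ^ J" by (intro power_increasing) auto
          then show False using m True by linarith
        qed
        then obtain i where i: "m = Suc (J + i)" using less_iff_Suc_add by blast
        have "\<not> norm \<xi> < 2 ^ (J + i)"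
          using not_less_Least[of "J + i" "\<lambda>m. norm \<xi> < 2 ^ m"] i by (simp add: m_def)
        then have "\<xi> \<in> D (J + i)" using m i by (simp add: D_def)
        then have "ennreal (indicator {\<xi>. 2 ^ J \<le> norm \<xi>} \<xi> * norm \<xi> powr (- A) * W \<xi>) =
            ennreal (indicator (D (J + i)) \<xi> * norm \<xi> powr (- A) * W \<xi>)" using True by simp
        also have "\<dots> \<le> (\<Sum>i. ennreal (indicator (D (J + i)) \<xi> * norm \<xi> powr (- A) * W \<xi>))"
          using sum_le_suminf[of "\<lambda>i. ennreal (indicator (D (J + i)) \<xi> * norm \<xi> powr (- A) * W \<xi>)" "{i}"] by simp
        finally show ?thesis .
      qed simp
    qed
    also have "\<dots> = (\<Sum>i. \<integral>\<^sup>+\<xi>. ennreal (indicator (D (J + i)) \<xi> * norm \<xi> powr (- A) * W \<xi>) \<partial>lborel)"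
      by (intro nn_integral_suminf) measurable
    also have "\<dots> \<le> (\<Sum>i. ennreal (K1 * \<theta> ^ (J + i)))"
      by (intro suminf_le shell) auto
    also have "\<dots> = ennreal (\<Sum>i. K1 * \<theta> ^ (J + i))"
    proof (rule suminf_ennreal2)
      show "summable (\<lambda>i. K1 * \<theta> ^ (J + i))"
        using \<theta> by (simp add: power_add mult.assoc[symmetric] summable_mult summable_geometric)
    qed (use K1 \<theta> in auto)
    also have "(\<Sum>i. K1 * \<theta> ^ (J + i)) = K1 / (1 - \<theta>) * \<theta> ^ J"
    proof -
      have "(\<Sum>i. K1 * \<theta> ^ (J + i)) = (\<Sum>i. K1 * \<theta> ^ J * \<theta> ^ i)" by (simp add: power_add mult.assoc)
      also have "\<dots> = K1 * \<theta> ^ J * (\<Sum>i. \<theta> ^ i)" using \<theta> by (intro suminf_mult summable_geometric) auto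
      also have "(\<Sum>i. \<theta> ^ i) = 1 / (1 - \<theta>)" using \<theta> by (intro suminf_geometric) auto
      finally show ?thesis by simp
    qed
    finally show ?thesis by (simp add: W_def)
  qed
  then show ?thesis using K1 \<theta> by (intro exI[of _ "K1 / (1 - \<theta>)"]) (auto intro!: exI[of _ \<theta>])
qed

text \<open>Split the Fourier integral at |\<xi>| = 2^J. Beyond it, decay and spectral tail give a
  bound that is small uniformly in n; below it, the integrand is Lipschitz in t with a constant
  independent of n, since the spectrum is at most 1.\<close>

lemma distance_density_equicontinuous:
  fixes b :: "'n::finite \<Rightarrow> 'k::finite"
  assumes card: "\<And>j. 2 \<le> card {i. b i = j}" and A: "0 \<le> A" "\<And>j. A \<le> (real (card {i. b i = j}) - 1) / 2"
    and s: "0 \<le> s" "s \<le> real CARD('n)" "real CARD('n) - s < A" and a: "0 < a" and \<eta>: "0 < \<eta>"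
  shows "\<exists>\<delta>>0. \<forall>n P w t t'. frostman_weights C s n P w \<longrightarrow> (\<forall>j. a \<le> t $ j) \<longrightarrow> (\<forall>j. a \<le> t' $ j) \<longrightarrow>
    norm (t - t') \<le> \<delta> \<longrightarrow> \<bar>distance_density b ((1 / 4) ^ n) P w t - distance_density b ((1 / 4) ^ n) P w t'\<bar> \<le> \<eta>"
proof -
  define m where "m = measure (sphere_measure b) (annuli b)"
  have m0: "0 \<le> m" by (simp add: m_def)
  obtain D where D: "D > 0" "\<And>t \<xi>. (\<And>j. a \<le> t $ j) \<Longrightarrow> 1 \<le> norm \<xi> \<Longrightarrow> \<bar>sphere_fourier b t \<xi>\<bar> \<le> D * norm \<xi> powr (- A)"
    using sphere_fourier_decay[OF card A a] by blast
  obtain K \<theta> where K: "K > 0" and \<theta>: "0 < \<theta>" "\<theta> < 1"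
    and tail: "\<And>n P w J. frostman_weights C s n (P :: (real ^ 'n) set) w \<Longrightarrow>
    (\<integral>\<^sup>+\<xi>. ennreal (indicator {\<xi>. 2 ^ J \<le> norm \<xi>} \<xi> * norm \<xi> powr (- A) *
        (exp (- ((1 / 4) ^ n) * (norm \<xi>)\<^sup>2) * power_spectrum P w \<xi>)) \<partial>lborel) \<le> ennreal (K * \<theta> ^ J)"
    using frostman_spectral_tail[OF s, of C] by blast
  have "(\<lambda>J. 2 * D * K * \<theta> ^ J) \<longlonglongrightarrow> 2 * D * K * 0"
    using \<theta> by (intro tendsto_mult_left LIMSEQ_power_zero) auto
  then have "eventually (\<lambda>J. 2 * D * K * \<theta> ^ J < \<eta> / 2) sequentially"
    by (rule order_tendstoD) (use \<eta> in simp)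
  then obtain J where J: "2 * D * K * \<theta> ^ J < \<eta> / 2" by (auto simp: eventually_sequentially)
  define vol where "vol = measure lborel (cball (0::real ^ 'n) (2 ^ J))"
  \<comment> \<open>Half of \<eta> is reserved for the tail; the summand 1 keeps the denominator
    positive.\<close>
  define \<delta> where "\<delta> = \<eta> / (2 * (m * 2 ^ J * vol + 1))"
  have den: "0 < m * 2 ^ J * vol + 1" using m0 by (simp add: vol_def add_nonneg_pos)
  then have \<delta>: "\<delta> > 0" using \<eta> by (simp add: \<delta>_def)
  have "m * 2 ^ J * vol * \<delta> \<le> (m * 2 ^ J * vol + 1) * \<delta>" using \<delta> by (intro mult_right_mono) auto
  also have "\<dots> = \<eta> / 2" using den by (simp add: \<delta>_def field_simps)
  finally have \<delta>': "m * 2 ^ J * vol * \<delta> \<le> \<eta> / 2" .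
  show ?thesis
  proof (intro exI[of _ \<delta>] conjI allI impI)
    show "\<delta> > 0" by fact
    fix n w and P :: "(real ^ 'n) set" and t t' :: "real ^ 'k"
    assume F: "frostman_weights C s n P w" and t: "\<forall>j. a \<le> t $ j" "\<forall>j. a \<le> t' $ j" and tt': "norm (t - t') \<le> \<delta>"
    have P: "finite P" "\<And>x. 0 \<le> w x" "sum w P = 1" using F by (auto simp: frostman_weights_def)
    define W where "W = (\<lambda>\<xi>. exp (- ((1 / 4) ^ n) * (norm \<xi>)\<^sup>2) * power_spectrum P w \<xi>)"
    have W0: "0 \<le> W \<xi>" for \<xi> by (simp add: W_def power_spectrum_nonneg)
    have W1: "W \<xi> \<le> 1" for \<xi>
    proof -
      have "W \<xi> \<le> 1 * 1" unfolding W_def using P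
        by (intro mult_mono power_spectrum_le_1 power_spectrum_nonneg) auto
      then show ?thesis by simp
    qed
    have [measurable]: "W \<in> borel_measurable borel" unfolding W_def by measurable
    have W_int: "integrable lborel W" unfolding W_def by (rule integrable_power_spectrum) simp
    have [measurable]: "sphere_fourier b t \<in> borel_measurable borel" for t
    proof -
      interpret S: finite_measure "sphere_measure b" by (rule finite_sphere_measure)
      show ?thesis unfolding sphere_fourier_def by measurable
    qed
    have W_sf: "integrable lborel (\<lambda>\<xi>. W \<xi> * sphere_fourier b t \<xi>)" for t
    proof (rule Bochner_Integration.integrable_bound[of _ "\<lambda>\<xi>. m * W \<xi>"])
      show "AE \<xi> in lborel. norm (W \<xi> * sphere_fourier b t \<xi>) \<le> norm (m * W \<xi>)"
        using sphere_fourier_bound[of b t] W0 m0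
        by (intro AE_I2) (simp add: abs_mult m_def mult.commute mult_left_mono)
    qed (use W_int in auto)
    have density_eq: "distance_density b ((1 / 4) ^ n) P w \<tau> = (\<integral>\<xi>. W \<xi> * sphere_fourier b \<tau> \<xi> \<partial>lborel)" for \<tau>
      unfolding W_def by (rule distance_density_fourier) simp
    have "ennreal \<bar>distance_density b ((1 / 4) ^ n) P w t - distance_density b ((1 / 4) ^ n) P w t'\<bar> =
        ennreal \<bar>\<integral>\<xi>. W \<xi> * sphere_fourier b t \<xi> - W \<xi> * sphere_fourier b t' \<xi> \<partial>lborel\<bar>"
      using W_sf by (simp add: density_eq)
    also have "\<dots> \<le> (\<integral>\<^sup>+\<xi>. ennreal (norm (W \<xi> * sphere_fourier b t \<xi> - W \<xi> * sphere_fourier b t' \<xi>)) \<partial>lborel)"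
      using integral_norm_bound_ennreal[of lborel "\<lambda>\<xi>. W \<xi> * sphere_fourier b t \<xi> - W \<xi> * sphere_fourier b t' \<xi>"] W_sf
      by simp
    also have "\<dots> \<le> (\<integral>\<^sup>+\<xi>. ennreal (m * 2 ^ J * \<delta>) * indicator (cball 0 (2 ^ J)) \<xi> +
        ennreal (2 * D) * ennreal (indicator {\<xi>. 2 ^ J \<le> norm \<xi>} \<xi> * norm \<xi> powr (- A) * W \<xi>) \<partial>lborel)"
    proof (intro nn_integral_mono)
      fix \<xi> :: "real ^ 'n"
      have d: "norm (W \<xi> * sphere_fourier b t \<xi> - W \<xi> * sphere_fourier b t' \<xi>) =
          W \<xi> * \<bar>sphere_fourier b t \<xi> - sphere_fourier b t' \<xi>\<bar>"
        using W0[of \<xi>] by (simp add: right_diff_distrib[symmetric] abs_mult)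
      show "ennreal (norm (W \<xi> * sphere_fourier b t \<xi> - W \<xi> * sphere_fourier b t' \<xi>)) \<le>
        ennreal (m * 2 ^ J * \<delta>) * indicator (cball 0 (2 ^ J)) \<xi> +
        ennreal (2 * D) * ennreal (indicator {\<xi>. 2 ^ J \<le> norm \<xi>} \<xi> * norm \<xi> powr (- A) * W \<xi>)"
      proof (cases "norm \<xi> \<le> 2 ^ J")
        case True
        have "W \<xi> * \<bar>sphere_fourier b t \<xi> - sphere_fourier b t' \<xi>\<bar> \<le> 1 * (m * (norm \<xi> * norm (t - t')))"
          unfolding m_def by (intro mult_mono W1 sphere_fourier_lipschitz) auto
        also have "\<dots> \<le> m * (2 ^ J * \<delta>)"
          using True tt' m0 \<delta> by (simp add: mult_left_mono mult_mono)
        finally have "ennreal (norm (W \<xi> * sphere_fourier b t \<xi> - W \<xi> * sphere_fourier b t' \<xi>)) \<le>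
          ennreal (m * 2 ^ J * \<delta>) * indicator (cball 0 (2 ^ J)) \<xi>"
          unfolding d using True by (simp add: ennreal_leI mult.assoc)
        then show ?thesis by (rule order.trans) simp
      next
        case False
        have "1 \<le> (2::real) ^ J" by simp
        then have n1: "1 \<le> norm \<xi>" using False by linarith
        have "\<bar>sphere_fourier b t \<xi>\<bar> \<le> D * norm \<xi> powr (- A)" "\<bar>sphere_fourier b t' \<xi>\<bar> \<le> D * norm \<xi> powr (- A)"
          using t by (intro D(2) n1; blast)+
        then have "\<bar>sphere_fourier b t \<xi> - sphere_fourier b t' \<xi>\<bar> \<le> 2 * D * norm \<xi> powr (- A)"
          by linarith
        then have "W \<xi> * \<bar>sphere_fourier b t \<xi> - sphere_fourier b t' \<xi>\<bar> \<le> W \<xi> * (2 * D * norm \<xi> powr (- A))"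
          by (rule mult_left_mono) (rule W0)
        also have "\<dots> = 2 * D * (norm \<xi> powr (- A) * W \<xi>)" by (simp only: mult_ac)
        finally have "W \<xi> * \<bar>sphere_fourier b t \<xi> - sphere_fourier b t' \<xi>\<bar> \<le> 2 * D * (norm \<xi> powr (- A) * W \<xi>)" .
        then have "ennreal (norm (W \<xi> * sphere_fourier b t \<xi> - W \<xi> * sphere_fourier b t' \<xi>)) \<le>
          ennreal (2 * D) * ennreal (indicator {\<xi>. 2 ^ J \<le> norm \<xi>} \<xi> * norm \<xi> powr (- A) * W \<xi>)"
          unfolding d using False D(1) W0[of \<xi>] by (subst ennreal_mult[symmetric]) (auto intro!: ennreal_leI)
        then show ?thesis by (rule order.trans) simp
      qed
    qed
    also have "\<dots> = ennreal (m * 2 ^ J * \<delta>) * emeasure lborel (cball (0::real ^ 'n) (2 ^ J)) +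
        ennreal (2 * D) * (\<integral>\<^sup>+\<xi>. ennreal (indicator {\<xi>. 2 ^ J \<le> norm \<xi>} \<xi> * norm \<xi> powr (- A) * W \<xi>) \<partial>lborel)"
    proof -
      have [measurable]: "cball (0 :: real ^ 'n) (2 ^ J) \<in> sets borel" by simp
      show ?thesis by (subst nn_integral_add) (simp_all add: nn_integral_cmult)
    qed
    also have "\<dots> \<le> ennreal (m * 2 ^ J * \<delta>) * ennreal vol + ennreal (2 * D) * ennreal (K * \<theta> ^ J)"
    proof (intro add_mono mult_left_mono)
      show "emeasure lborel (cball (0::real ^ 'n) (2 ^ J)) \<le> ennreal vol"
        unfolding vol_def using emeasure_lborel_cball_finite[of "0 :: real ^ 'n" "2 ^ J"]
        by (subst emeasure_eq_ennreal_measure) auto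
      show "(\<integral>\<^sup>+\<xi>. ennreal (indicator {\<xi>. 2 ^ J \<le> norm \<xi>} \<xi> * norm \<xi> powr (- A) * W \<xi>) \<partial>lborel) \<le> ennreal (K * \<theta> ^ J)"
        unfolding W_def by (rule tail[OF F])
    qed auto
    also have "\<dots> = ennreal (m * 2 ^ J * vol * \<delta> + 2 * D * K * \<theta> ^ J)"
      using m0 \<delta> D(1) K \<theta> by (simp add: ennreal_mult[symmetric] ennreal_plus[symmetric] vol_def mult_ac del: ennreal_plus)
    also have "\<dots> \<le> ennreal \<eta>" using J \<delta>' by (intro ennreal_leI) linarith
    finally show "\<bar>distance_density b ((1 / 4) ^ n) P w t - distance_density b ((1 / 4) ^ n) P w t'\<bar> \<le> \<eta>"
      using \<eta> by (simp add: ennreal_le_iff)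
  qed
qed

section \<open>Mass and localization of the distance density\<close>

lemma borel_measurable_sphere_point_pair [measurable (raw)]:
  assumes [measurable]: "f \<in> borel_measurable M" "g \<in> borel_measurable M"
  shows "(\<lambda>x. sphere_point b (f x) (g x)) \<in> borel_measurable M"
  unfolding sphere_point_def by (intro borel_measurable_vec_lambda) measurable

text \<open>Since r \<le> a / 4 \<le> |z^j| / 8, the product s_j |v^j| lies between 7/8 and 9/8 of
  |z^j|. Dividing by s_j, which is between 4/7 and 4/5 of |z^j|, puts |v^j| between 35/32 and 63/32,
  inside the annulus.\<close>

lemma stretched_point_in_annuli:
  assumes z: "\<And>j. 2 * a \<le> block_norm b j z" "0 < a" and r: "r \<le> a / 4"
    and s: "\<And>j. 4 / 7 * block_norm b j z \<le> s $ j \<and> s $ j \<le> 4 / 5 * block_norm b j z"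
    and y: "(\<chi> i. s $ b i * v $ i) \<in> cball z r"
  shows "v \<in> annuli b" and "\<And>j. a \<le> s $ j * block_norm b j v \<and> s $ j * block_norm b j v \<le> 2 * block_norm b j z"
proof -
  have zp: "0 < block_norm b j z" for j using z(1)[of j] z(2) by linarith
  have sp: "0 < s $ j" for j using s[of j] zp[of j] by simp
  have norm_y: "block_norm b j (\<chi> i. s $ b i * v $ i) = s $ j * block_norm b j v" for j
  proof -
    have "(block_norm b j (\<chi> i. s $ b i * v $ i))\<^sup>2 = (s $ j * block_norm b j v)\<^sup>2"
      unfolding power_mult_distrib block_norm_sq sum_distrib_left
      by (intro sum.cong) (auto simp: power_mult_distrib)
    then show ?thesis using sp[of j] by (simp add: less_imp_le)
  qed
  have close: "\<bar>s $ j * block_norm b j v - block_norm b j z\<bar> \<le> block_norm b j z / 8" for j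
  proof -
    have "\<bar>s $ j * block_norm b j v - block_norm b j z\<bar> \<le> r"
      unfolding norm_y[symmetric] using block_norm_diff[of b j "\<chi> i. s $ b i * v $ i" z] y
      by (simp add: dist_norm norm_minus_commute)
    then show ?thesis using r z(1)[of j] by simp
  qed
  have ann: "1 \<le> block_norm b j v \<and> block_norm b j v \<le> 2" for j
  proof -
    have "s $ j * 1 \<le> s $ j * block_norm b j v" "s $ j * block_norm b j v \<le> s $ j * 2"
      using close[of j] s[of j] zp[of j] by linarith+
    then show ?thesis using sp[of j] by (simp add: mult_le_cancel_left_pos)
  qed
  then show "v \<in> annuli b" by (simp add: annuli_def)
  show "a \<le> s $ j * block_norm b j v \<and> s $ j * block_norm b j v \<le> 2 * block_norm b j z" for j
    using close[of j] z(1)[of j] z(2) by linarith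
qed

text \<open>
  Polar coordinates in every block: substituting \<open>t $ j = s $ j * |v\<^sup>j|\<close> and then \<open>y = s v\<close> turns
  the integral over the radii \<open>t\<close> and the directions of \<open>v\<close> into one over a neighbourhood of \<open>z\<close>.
\<close>

lemma sphere_average_mass:
  fixes b :: "'n::finite \<Rightarrow> 'k::finite"
  assumes a: "0 < a" and B: "0 < B"
  shows "\<exists>c>0. \<forall>u z. 0 < u \<longrightarrow> sqrt u \<le> a / 4 \<longrightarrow> (\<forall>j. 2 * a \<le> block_norm b j z \<and> block_norm b j z \<le> B) \<longrightarrow>
    ennreal (c * sqrt u ^ CARD('n)) \<le> (\<integral>\<^sup>+t. indicator {t. \<forall>j. a \<le> t $ j \<and> t $ j \<le> 2 * B} t *
      (\<integral>\<^sup>+v. ennreal (exp (- (norm (z - sphere_point b t v))\<^sup>2 / (4 * u))) \<partial>sphere_measure b) \<partial>lborel)"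
proof -
  define \<omega> where "\<omega> = measure lborel (cball (0 :: real ^ 'n) 1)"
  have \<omega>: "\<omega> > 0" unfolding \<omega>_def by simp
  define e where "e = exp (- 1 / 4 :: real)"
  define c where "c = (16 / 35 * a) ^ CARD('k) * (e * \<omega> / B ^ CARD('n))"
  have "ennreal (c * sqrt u ^ CARD('n)) \<le> (\<integral>\<^sup>+t. indicator {t. \<forall>j. a \<le> t $ j \<and> t $ j \<le> 2 * B} t *
      (\<integral>\<^sup>+v. ennreal (exp (- (norm (z - sphere_point b t v))\<^sup>2 / (4 * u))) \<partial>sphere_measure b) \<partial>lborel)"
    if u: "0 < u" "sqrt u \<le> a / 4" and z: "\<And>j. 2 * a \<le> block_norm b j z" "\<And>j. block_norm b j z \<le> B" for u z
  proof -
    have zp: "0 < block_norm b j z" for j using z(1)[of j] a by linarith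
    define T where "T = {t :: real ^ 'k. \<forall>j. a \<le> t $ j \<and> t $ j \<le> 2 * B}"
    define S where "S = cbox (\<chi> j. 4 / 7 * block_norm b j z) (\<chi> j. 4 / 5 * block_norm b j z)"
    define Y where "Y = cball z (sqrt u)"
    define f where "f = (\<lambda>t v. indicator T t * (indicator (annuli b) v *
      ennreal (exp (- (norm (z - sphere_point b t v))\<^sup>2 / (4 * u)))))"
    \<comment> \<open>The minorant of f in the variables (s, v): it equals e where s v lies within
      sqrt u of z, for there the exponent of the Gaussian is at least -1/4.\<close>
    define h where "h = (\<lambda>s v. indicator S s * (indicator Y (\<chi> i. s $ b i * v $ i) * ennreal e))"
    have [measurable]: "T \<in> sets borel" "S \<in> sets borel" "Y \<in> sets borel"
      unfolding T_def S_def Y_def by measurable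
    have [measurable]: "(\<lambda>x. \<chi> i. (fst x :: real ^ 'k) $ b i * (snd x :: real ^ 'n) $ i) \<in> borel_measurable (borel \<Otimes>\<^sub>M borel)"
      by (intro borel_measurable_vec_lambda) measurable
    have [measurable]: "(\<lambda>v::real ^ 'n. \<chi> i. (s :: real ^ 'k) $ b i * v $ i) \<in> borel_measurable borel" for s
      by (intro borel_measurable_vec_lambda) measurable
    have [measurable]: "(\<lambda>s::real ^ 'k. \<chi> i. s $ b i * (v :: real ^ 'n) $ i) \<in> borel_measurable borel" for v
      by (intro borel_measurable_vec_lambda) measurable
    have S_mem: "s \<in> S \<longleftrightarrow> (\<forall>j. 4 / 7 * block_norm b j z \<le> s $ j \<and> s $ j \<le> 4 / 5 * block_norm b j z)" for s
      by (simp add: S_def mem_box_cart)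
    have radial: "(\<integral>\<^sup>+s. h s v \<partial>lborel) \<le> (\<integral>\<^sup>+t. f t v \<partial>lborel)" for v
    proof (cases "v \<in> annuli b")
      case False
      then have "h s v = 0" for s
        using stretched_point_in_annuli(1)[OF z(1) a u(2), of s v]
        by (auto simp: h_def S_mem Y_def indicator_def)
      then show ?thesis by simp
    next
      case True
      then have v: "1 \<le> block_norm b j v" for j by (simp add: annuli_def)
      have [measurable]: "(\<lambda>t. f t v) \<in> borel_measurable borel" unfolding f_def by measurable
      have "h s v \<le> f (\<chi> j. block_norm b j v * s $ j) v" for s
      proof (cases "s \<in> S \<and> (\<chi> i. s $ b i * v $ i) \<in> Y")
        case sS: True
        have eq: "sphere_point b (\<chi> j. block_norm b j v * s $ j) v = (\<chi> i. s $ b i * v $ i)"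
          using v by (simp add: sphere_point_def vec_eq_iff) (metis not_one_le_zero)
        have "(\<chi> j. block_norm b j v * s $ j) \<in> T"
        proof -
          have st: "a \<le> s $ j * block_norm b j v \<and> s $ j * block_norm b j v \<le> 2 * block_norm b j z" for j
            by (rule stretched_point_in_annuli(2)[OF z(1) a u(2)]) (use sS in \<open>auto simp: S_mem Y_def\<close>)
          have "a \<le> block_norm b j v * s $ j \<and> block_norm b j v * s $ j \<le> 2 * B" for j
            using st[of j] z(2)[of j] by (simp add: mult.commute)
          then show ?thesis by (simp add: T_def)
        qed
        moreover have "e \<le> exp (- (norm (z - (\<chi> i. s $ b i * v $ i)))\<^sup>2 / (4 * u))"
        proof -
          have "(norm (z - (\<chi> i. s $ b i * v $ i)))\<^sup>2 \<le> (sqrt u)\<^sup>2"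
            using sS by (intro power_mono) (auto simp: Y_def dist_norm)
          then show ?thesis using u by (simp add: e_def field_simps)
        qed
        ultimately show ?thesis using sS True unfolding f_def h_def eq by (simp add: ennreal_leI)
      qed (auto simp: h_def indicator_def)
      then have "(\<integral>\<^sup>+s. h s v \<partial>lborel) \<le> (\<integral>\<^sup>+s. f (\<chi> j. block_norm b j v * s $ j) v \<partial>lborel)"
        by (intro nn_integral_mono)
      \<comment> \<open>The Jacobian of t_j = s_j |v^j| is at least 1 on the annuli.\<close>
      also have "\<dots> \<le> ennreal (\<Prod>j\<in>UNIV. block_norm b j v) * (\<integral>\<^sup>+s. f (\<chi> j. block_norm b j v * s $ j) v \<partial>lborel)"
      proof -
        have "1 \<le> ennreal (\<Prod>j\<in>UNIV. block_norm b j v)" using v by (simp add: prod_ge_1)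
        from mult_right_mono[OF this] show ?thesis by simp
      qed
      also have "\<dots> = (\<integral>\<^sup>+t. f t v \<partial>lborel)"
        by (rule nn_integral_stretch[symmetric]) (use v in \<open>auto intro: less_le_trans[OF zero_less_one]\<close>)
      finally show ?thesis .
    qed
    \<comment> \<open>For fixed s the variable is y = s v: the ball Y has volume \<omega> (sqrt
      u)^d, and the Jacobian is at most B^d because s_j \<le> B.\<close>
    have dil: "ennreal (e * (\<omega> * sqrt u ^ CARD('n)) / B ^ CARD('n)) * indicator S s \<le> (\<integral>\<^sup>+v. h s v \<partial>lborel)" for s
    proof (cases "s \<in> S")
      case True
      have s: "0 < s $ j" "s $ j \<le> B" for j
      proof -
        have "4 / 7 * block_norm b j z \<le> s $ j" "s $ j \<le> 4 / 5 * block_norm b j z" using True by (auto simp: S_mem)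
        then show "0 < s $ j" "s $ j \<le> B" using zp[of j] z(2)[of j] by linarith+
      qed
      define X where "X = (\<integral>\<^sup>+v. indicator Y (\<chi> i. s $ b i * v $ i) \<partial>(lborel :: (real ^ 'n) measure))"
      have "ennreal (\<omega> * sqrt u ^ CARD('n)) = emeasure lborel Y"
      proof -
        have "emeasure lborel Y = ennreal (measure lborel Y)"
          unfolding Y_def by (intro emeasure_eq_ennreal_measure)
            (use emeasure_lborel_cball_finite[of z "sqrt u"] in auto)
        also have "measure lborel Y = sqrt u ^ CARD('n) * \<omega>"
          unfolding Y_def \<omega>_def using u content_ball_conv_unit_ball[of "sqrt u" z]
            by (simp add: content_cball_conv_ball)
        finally show ?thesis by (simp add: mult.commute)
      qed
      also have "\<dots> = (\<integral>\<^sup>+y. indicator Y y \<partial>lborel)" by simp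
      also have "\<dots> = ennreal (\<Prod>i\<in>UNIV. s $ b i) * X"
        unfolding X_def by (rule nn_integral_stretch) (use s in auto)
      also have "\<dots> \<le> ennreal (B ^ CARD('n)) * X"
      proof (intro mult_right_mono ennreal_leI)
        have "(\<Prod>i\<in>UNIV. s $ b i) \<le> (\<Prod>i\<in>(UNIV::'n set). B)"
          using s by (intro prod_mono) (auto intro: less_imp_le)
        then show "(\<Prod>i\<in>UNIV. s $ b i) \<le> B ^ CARD('n)" by simp
      qed simp
      finally have "ennreal (1 / B ^ CARD('n)) * ennreal (\<omega> * sqrt u ^ CARD('n)) \<le>
          ennreal (1 / B ^ CARD('n)) * (ennreal (B ^ CARD('n)) * X)"
        by (rule mult_left_mono) simp
      also have "\<dots> = X"
        using B by (simp add: mult.assoc[symmetric] ennreal_mult[symmetric])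
      finally have "ennreal (\<omega> * sqrt u ^ CARD('n) / B ^ CARD('n)) \<le> X"
        using B \<omega> u by (simp add: ennreal_mult[symmetric])
      then have "ennreal e * ennreal (\<omega> * sqrt u ^ CARD('n) / B ^ CARD('n)) \<le> ennreal e * X"
        by (rule mult_left_mono) simp
      moreover have "(\<integral>\<^sup>+v. h s v \<partial>lborel) = ennreal e * X"
      proof -
        have "(\<integral>\<^sup>+v. indicator Y (\<chi> i. s $ b i * v $ i) * ennreal e \<partial>(lborel :: (real ^ 'n) measure)) = X * ennreal e"
          unfolding X_def by (rule nn_integral_multc) measurable
        then show ?thesis unfolding h_def using True by (simp add: mult.commute[of X])
      qed
      ultimately show ?thesis
        using True B \<omega> u by (simp add: ennreal_mult[symmetric] e_def)
    qed simp
    \<comment> \<open>Each side of the box has length (4/5 - 4/7) |z^j|, at least (8/35) 2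
      a.\<close>
    have vol_S: "ennreal ((16 / 35 * a) ^ CARD('k)) \<le> emeasure lborel S"
    proof -
      have "emeasure lborel S = ennreal (measure lborel S)"
        unfolding S_def by (intro emeasure_eq_ennreal_measure) (simp add: emeasure_lborel_cbox_eq)
      moreover have "(16 / 35 * a) ^ CARD('k) \<le> measure lborel S"
      proof -
        have "(\<Prod>j\<in>(UNIV::'k set). 16 / 35 * a) \<le> (\<Prod>j\<in>UNIV. 4 / 5 * block_norm b j z - 4 / 7 * block_norm b j z)"
          using z(1) a by (intro prod_mono) auto
        then show ?thesis
          unfolding S_def by (subst content_cbox_cart) (auto simp: interval_eq_empty_cart not_less)
      qed
      ultimately show ?thesis by (simp add: ennreal_leI)
    qed
    have "ennreal (c * sqrt u ^ CARD('n)) =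
        ennreal (e * (\<omega> * sqrt u ^ CARD('n)) / B ^ CARD('n)) * ennreal ((16 / 35 * a) ^ CARD('k))"
      using a B \<omega> u by (simp add: c_def e_def ennreal_mult[symmetric] field_simps)
    also have "\<dots> \<le> ennreal (e * (\<omega> * sqrt u ^ CARD('n)) / B ^ CARD('n)) * emeasure lborel S"
      using vol_S by (rule mult_left_mono) simp
    also have "\<dots> = (\<integral>\<^sup>+s. ennreal (e * (\<omega> * sqrt u ^ CARD('n)) / B ^ CARD('n)) * indicator S s \<partial>lborel)"
      by (simp add: nn_integral_cmult)
    also have "\<dots> \<le> (\<integral>\<^sup>+s. \<integral>\<^sup>+v. h s v \<partial>lborel \<partial>lborel)"
      by (intro nn_integral_mono dil)
    \<comment> \<open>The order is exchanged because \<open>dil\<close> integrates over v for fixed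
      s, whereas \<open>radial\<close> compares the radial integrals for fixed v.\<close>
    also have "\<dots> = (\<integral>\<^sup>+v. \<integral>\<^sup>+s. h s v \<partial>lborel \<partial>lborel)"
    proof (rule lborel_pair.Fubini'[of "\<lambda>v s. h s v"])
      have "(\<lambda>x. h (snd x) (fst x)) \<in> borel_measurable (borel \<Otimes>\<^sub>M borel)"
      proof -
        have [measurable]: "(\<lambda>x. \<chi> i. (snd x :: real ^ 'k) $ b i * (fst x :: real ^ 'n) $ i) \<in> borel_measurable (borel \<Otimes>\<^sub>M borel)"
          by (intro borel_measurable_vec_lambda) measurable
        show ?thesis unfolding h_def by measurable
      qed
      then show "case_prod (\<lambda>v s. h s v) \<in> borel_measurable (lborel \<Otimes>\<^sub>M lborel)"
        by (simp add: case_prod_unfold cong: measurable_cong_sets)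
    qed
    also have "\<dots> \<le> (\<integral>\<^sup>+v. \<integral>\<^sup>+t. f t v \<partial>lborel \<partial>lborel)"
      by (intro nn_integral_mono radial)
    also have "\<dots> = (\<integral>\<^sup>+t. \<integral>\<^sup>+v. f t v \<partial>lborel \<partial>lborel)"
    proof (rule lborel_pair.Fubini'[symmetric, of "\<lambda>v t. f t v"])
      have "(\<lambda>x. f (snd x) (fst x)) \<in> borel_measurable (borel \<Otimes>\<^sub>M borel)"
        unfolding f_def by measurable
      then show "case_prod (\<lambda>v t. f t v) \<in> borel_measurable (lborel \<Otimes>\<^sub>M lborel)"
        by (simp add: case_prod_unfold cong: measurable_cong_sets)
    qed
    also have "\<dots> = (\<integral>\<^sup>+t. indicator T t *
      (\<integral>\<^sup>+v. ennreal (exp (- (norm (z - sphere_point b t v))\<^sup>2 / (4 * u))) \<partial>sphere_measure b) \<partial>lborel)"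
      unfolding f_def sphere_measure_def
      by (intro nn_integral_cong) (simp add: nn_integral_restrict_space nn_integral_cmult mult.commute)
    finally show ?thesis by (simp add: T_def)
  qed
  moreover have "c > 0" using a B \<omega> by (simp add: c_def e_def)
  ultimately show ?thesis by blast
qed

text \<open>If t differs by at least \<eta> from the block distance of x and y in some block, then
  every point of the product of spheres is at distance at least \<eta> from x - y, as block norms
  are 1-Lipschitz. If this happened for all pairs, each Gaussian would be at most its value at
  \<eta>, contrary to \<open>large\<close>.\<close>

lemma distance_density_near:
  fixes b :: "'n::finite \<Rightarrow> 'k::finite"
  assumes P: "finite P" "\<And>x. 0 \<le> w x" "sum w P = 1" and u: "0 < u" and \<eta>: "0 \<le> \<eta>" and t: "\<And>j. 0 \<le> t $ j"
    and large: "sqrt (pi / u) ^ CARD('n) * (measure (sphere_measure b) (annuli b) * exp (- \<eta>\<^sup>2 / (4 * u))) <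
      distance_density b u P w t"
  shows "\<exists>x\<in>P. \<exists>y\<in>P. \<forall>j. \<bar>t $ j - block_dist b j x y\<bar> < \<eta>"
proof (rule ccontr)
  interpret finite_measure "sphere_measure b" by (rule finite_sphere_measure)
  assume far: "\<not> (\<exists>x\<in>P. \<exists>y\<in>P. \<forall>j. \<bar>t $ j - block_dist b j x y\<bar> < \<eta>)"
  have "(\<integral>v. exp (- (norm (x - y - sphere_point b t v))\<^sup>2 / (4 * u)) \<partial>sphere_measure b) \<le>
      measure (sphere_measure b) (annuli b) * exp (- \<eta>\<^sup>2 / (4 * u))" if xy: "x \<in> P" "y \<in> P" for x y
  proof -
    obtain j where j: "\<eta> \<le> \<bar>t $ j - block_norm b j (x - y)\<bar>" using far xy unfolding block_dist_eq by (meson not_less)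
    have le: "exp (- (norm (x - y - sphere_point b t v))\<^sup>2 / (4 * u)) \<le> exp (- \<eta>\<^sup>2 / (4 * u))" if v: "v \<in> annuli b" for v
    proof -
      have "\<eta> \<le> norm (x - y - sphere_point b t v)"
        using j block_norm_diff[of b j "x - y" "sphere_point b t v"] t[of j]
        by (simp add: block_norm_sphere_point[OF v])
      then have "\<eta>\<^sup>2 \<le> (norm (x - y - sphere_point b t v))\<^sup>2" using \<eta> by (intro power_mono)
      then show ?thesis using u by (simp add: divide_right_mono)
    qed
    have "(\<integral>v. exp (- (norm (x - y - sphere_point b t v))\<^sup>2 / (4 * u)) \<partial>sphere_measure b) \<le>
        (\<integral>v. exp (- \<eta>\<^sup>2 / (4 * u)) \<partial>sphere_measure b)"
    proof (rule integral_mono)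
      show "integrable (sphere_measure b) (\<lambda>v. exp (- (norm (x - y - sphere_point b t v))\<^sup>2 / (4 * u)))"
        by (rule integrable_const_bound[of _ 1]) (use u in auto)
    qed (use le in auto)
    then show ?thesis by simp
  qed
  then have "distance_density b u P w t \<le> sqrt (pi / u) ^ CARD('n) *
      (\<Sum>x\<in>P. \<Sum>y\<in>P. w x * w y * (measure (sphere_measure b) (annuli b) * exp (- \<eta>\<^sup>2 / (4 * u))))"
    unfolding distance_density_def using P u by (intro mult_left_mono sum_mono) auto
  also have "\<dots> = sqrt (pi / u) ^ CARD('n) * (measure (sphere_measure b) (annuli b) * exp (- \<eta>\<^sup>2 / (4 * u)))"
    unfolding sum_distrib_right[symmetric] sum_distrib_left[symmetric] using P(3) by simp
  finally show False using large by simp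
qed

text \<open>A pair that is close in block j puts y into a slab around x, of mass at most C (2 a)^(s
  - (d - d_j)). These exponents are positive, so the sum over all blocks is at most 1/2 once a is
  small.\<close>

lemma frostman_close_pairs:
  fixes b :: "'n::finite \<Rightarrow> 'k::finite"
  assumes C: "0 < C" and s: "\<And>j. 0 < s - real (card (- {i. b i = j}))"
  shows "\<exists>a>0. 2 * a \<le> 1 \<and> (\<forall>n P w. frostman_weights C s n P w \<longrightarrow> 1 / 2 ^ n \<le> 2 * a \<longrightarrow>
    1 / 2 \<le> (\<Sum>x\<in>P. \<Sum>y\<in>P. if \<forall>j. 2 * a \<le> block_norm b j (x - y) then w x * w y else 0))"
proof -
  define p where "p = (\<lambda>j. s - real (card (- {i. b i = j})))"
  have "((\<lambda>r. \<Sum>j\<in>UNIV. C * r powr p j) \<longlongrightarrow> (\<Sum>j\<in>(UNIV::'k set). C * 0)) (at_right 0)"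
  proof (intro tendsto_sum tendsto_mult tendsto_const)
    fix j
    have "eventually (\<lambda>r. 0 \<le> r) (at_right (0::real))"
      by (rule eventually_mono[OF eventually_at_right_less]) simp
    then show "((\<lambda>r. r powr p j) \<longlongrightarrow> 0) (at_right 0)"
      using s[of j] by (intro tendsto_zero_powrI[where b="p j"]) (auto simp: p_def)
  qed
  then have "eventually (\<lambda>r. (\<Sum>j\<in>UNIV. C * r powr p j) < 1 / 2) (at_right 0)"
    by (intro order_tendstoD(2)) auto
  then obtain r1 where r1: "0 < r1" "\<And>r. 0 < r \<Longrightarrow> r < r1 \<Longrightarrow> (\<Sum>j\<in>UNIV. C * r powr p j) < 1 / 2"
    by (auto simp: eventually_at_right_field)
  define a where "a = min r1 1 / 4"
  have a: "0 < a" "2 * a \<le> 1" "2 * a < r1" using r1(1) by (auto simp: a_def)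
  have "1 / 2 \<le> (\<Sum>x\<in>P. \<Sum>y\<in>P. if \<forall>j. 2 * a \<le> block_norm b j (x - y) then w x * w y else 0)"
    if F: "frostman_weights C s n P w" and n: "1 / 2 ^ n \<le> 2 * a" for n P w
  proof -
    have P: "finite P" "\<And>x. 0 \<le> w x" "sum w P = 1" using F by (auto simp: frostman_weights_def)
    have slab: "sum w {y\<in>P. \<forall>i\<in>J. \<bar>x $ i - y $ i\<bar> \<le> r} \<le> C * r powr (s - real (card (- J)))"
      if "1 / 2 ^ n \<le> r" "r \<le> 1" for J r x
      using F that unfolding frostman_weights_def by blast
    have near: "sum w {y\<in>P. \<exists>j. block_norm b j (x - y) < 2 * a} \<le> 1 / 2" for x
    proof -
      have "sum w {y\<in>P. \<exists>j. block_norm b j (x - y) < 2 * a} \<le>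
          sum w (\<Union>j. {y\<in>P. \<forall>i\<in>{i. b i = j}. \<bar>x $ i - y $ i\<bar> \<le> 2 * a})"
      proof (intro sum_mono2)
        have comp: "\<bar>x $ i - y $ i\<bar> \<le> block_norm b (b i) (x - y)" for i y
        proof -
          have "((x - y) $ i)\<^sup>2 \<le> (block_norm b (b i) (x - y))\<^sup>2"
            unfolding block_norm_sq by (intro member_le_sum) auto
          then show ?thesis by (simp add: abs_le_square_iff[symmetric])
        qed
        show "{y\<in>P. \<exists>j. block_norm b j (x - y) < 2 * a} \<subseteq>
            (\<Union>j. {y\<in>P. \<forall>i\<in>{i. b i = j}. \<bar>x $ i - y $ i\<bar> \<le> 2 * a})"
        proof
          fix y assume "y \<in> {y\<in>P. \<exists>j. block_norm b j (x - y) < 2 * a}"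
          then obtain j where j: "y \<in> P" "block_norm b j (x - y) < 2 * a" by auto
          have "\<bar>x $ i - y $ i\<bar> \<le> 2 * a" if "b i = j" for i
            using comp[of i y] j(2) that by simp
          then show "y \<in> (\<Union>j. {y\<in>P. \<forall>i\<in>{i. b i = j}. \<bar>x $ i - y $ i\<bar> \<le> 2 * a})"
            using j(1) by auto
        qed
      qed (use P in auto)
      also have "\<dots> \<le> (\<Sum>j\<in>UNIV. sum w {y\<in>P. \<forall>i\<in>{i. b i = j}. \<bar>x $ i - y $ i\<bar> \<le> 2 * a})"
      proof -
        \<comment> \<open>The slabs may overlap, so the union bound passes through their disjoint
          sum.\<close>
        have "sum w (\<Union>j. A j) \<le> (\<Sum>j\<in>UNIV. sum w (A j))" if A: "\<And>j. A j \<subseteq> P" for A :: "'k \<Rightarrow> (real ^ 'n) set"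
        proof -
          have fin: "finite (A j)" for j using A P(1) by (rule finite_subset)
          have "sum w (\<Union>j. A j) \<le> sum w (snd ` (SIGMA j:UNIV. A j))"
            using fin P(2) by (intro sum_mono2) (auto simp: image_iff)
          also have "\<dots> \<le> (\<Sum>p\<in>(SIGMA j:UNIV. A j). w (snd p))"
            using fin P(2) sum_image_le[of "SIGMA j:UNIV. A j" w snd] by (simp add: o_def)
          also have "\<dots> = (\<Sum>j\<in>UNIV. sum w (A j))"
            using fin by (simp add: sum.Sigma split_beta)
          finally show ?thesis .
        qed
        then show ?thesis by auto
      qed
      also have "\<dots> \<le> (\<Sum>j\<in>UNIV. C * (2 * a) powr p j)"
        unfolding p_def by (intro sum_mono slab n a(2))
      also have "\<dots> \<le> 1 / 2" using r1(2)[of "2 * a"] a by simp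
      finally show ?thesis .
    qed
    have "1 / 2 = (\<Sum>x\<in>P. w x * (1 - 1 / 2))" using P(3) by (simp add: sum_distrib_right[symmetric] sum_divide_distrib[symmetric])
    also have "\<dots> \<le> (\<Sum>x\<in>P. w x * (sum w P - sum w {y\<in>P. \<exists>j. block_norm b j (x - y) < 2 * a}))"
      using near P by (intro sum_mono mult_left_mono) auto
    also have "\<dots> = (\<Sum>x\<in>P. w x * sum w {y\<in>P. \<forall>j. 2 * a \<le> block_norm b j (x - y)})"
    proof (intro sum.cong refl arg_cong2[where f="(*)"])
      fix x
      have "sum w P - sum w {y\<in>P. \<exists>j. block_norm b j (x - y) < 2 * a} =
          sum w (P - {y\<in>P. \<exists>j. block_norm b j (x - y) < 2 * a})"
        using P(1) by (intro sum_diff[symmetric]) auto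
      also have "P - {y\<in>P. \<exists>j. block_norm b j (x - y) < 2 * a} = {y\<in>P. \<forall>j. 2 * a \<le> block_norm b j (x - y)}"
        by (auto simp flip: not_less)
      finally show "sum w P - sum w {y\<in>P. \<exists>j. block_norm b j (x - y) < 2 * a} =
          sum w {y\<in>P. \<forall>j. 2 * a \<le> block_norm b j (x - y)}" .
    qed
    also have "\<dots> = (\<Sum>x\<in>P. \<Sum>y\<in>P. if \<forall>j. 2 * a \<le> block_norm b j (x - y) then w x * w y else 0)"
      using P(1) by (intro sum.cong refl) (auto simp: sum.inter_filter sum_distrib_left intro!: sum.cong)
    finally show ?thesis .
  qed
  then show ?thesis using a by blast
qed

text \<open>Averaging over the box T: by \<open>sphere_average_mass\<close> every pair separated in
  all blocks contributes a definite amount to the integral of the density, and such pairs have total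
  weight at least 1/2. The factor (\<pi> / u)^(d/2) cancels the power of sqrt u, so the bound does
  not depend on u.\<close>

lemma distance_density_large:
  fixes b :: "'n::finite \<Rightarrow> 'k::finite"
  assumes a: "0 < a" and B: "0 < B"
  shows "\<exists>c>0. \<forall>u P w. 0 < u \<longrightarrow> sqrt u \<le> a / 4 \<longrightarrow> finite P \<longrightarrow> (\<forall>x. 0 \<le> w x) \<longrightarrow>
    (\<forall>x\<in>P. \<forall>y\<in>P. norm (x - y) \<le> B) \<longrightarrow>
    1 / 2 \<le> (\<Sum>x\<in>P. \<Sum>y\<in>P. if \<forall>j. 2 * a \<le> block_norm b j (x - y) then w x * w y else 0) \<longrightarrow>
    (\<exists>t. (\<forall>j. a \<le> t $ j \<and> t $ j \<le> 2 * B) \<and> c \<le> distance_density b u P w t)"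
proof -
  define T where "T = {t :: real ^ 'k. \<forall>j. a \<le> t $ j \<and> t $ j \<le> 2 * B}"
  have T_cbox: "T = cbox (\<chi> j. a) (\<chi> j. 2 * B)" by (auto simp: T_def mem_box_cart)
  have [measurable]: "T \<in> sets borel" unfolding T_cbox by simp
  obtain c where c: "c > 0" "\<And>u z. 0 < u \<Longrightarrow> sqrt u \<le> a / 4 \<Longrightarrow> (\<And>j. 2 * a \<le> block_norm b j z) \<Longrightarrow>
      (\<And>j. block_norm b j z \<le> B) \<Longrightarrow> ennreal (c * sqrt u ^ CARD('n)) \<le> (\<integral>\<^sup>+t. indicator T t *
      (\<integral>\<^sup>+v. ennreal (exp (- (norm (z - sphere_point b t v))\<^sup>2 / (4 * u))) \<partial>sphere_measure b) \<partial>lborel)"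
    using sphere_average_mass[OF a B, of b] unfolding T_def by blast
  define V where "V = measure lborel T"
  have V: "0 \<le> V" "emeasure lborel T = ennreal V"
    unfolding V_def T_cbox
    by (simp, intro emeasure_eq_ennreal_measure) (simp add: emeasure_lborel_cbox_eq)
  \<comment> \<open>Half of the lower bound \<open>sqrt pi ^ CARD('n) * c / 2\<close> for the mass,
    spread over the volume of T; V + 1 keeps the denominator positive.\<close>
  define c' where "c' = sqrt pi ^ CARD('n) * c / 4 / (V + 1)"
  have c': "c' > 0" using c V by (simp add: c'_def add_nonneg_pos)
  have main: "\<exists>t. (\<forall>j. a \<le> t $ j \<and> t $ j \<le> 2 * B) \<and> c' \<le> distance_density b u P w t"
    if u: "0 < u" "sqrt u \<le> a / 4" and P: "finite P" "\<And>x. 0 \<le> w x"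
      and diam: "\<And>x y. x \<in> P \<Longrightarrow> y \<in> P \<Longrightarrow> norm (x - y) \<le> B"
      and far: "1 / 2 \<le> (\<Sum>x\<in>P. \<Sum>y\<in>P. if \<forall>j. 2 * a \<le> block_norm b j (x - y) then w x * w y else 0)" for u P w
  proof (rule ccontr)
    interpret S: finite_measure "sphere_measure b" by (rule finite_sphere_measure)
    assume none: "\<not> (\<exists>t. (\<forall>j. a \<le> t $ j \<and> t $ j \<le> 2 * B) \<and> c' \<le> distance_density b u P w t)"
    then have small: "distance_density b u P w t \<le> c'" if "t \<in> T" for t
    proof -
      have "\<not> c' \<le> distance_density b u P w t"
        using none that unfolding T_def mem_Collect_eq by blast
      then show ?thesis by simp
    qed
    define I where "I = (\<lambda>z t. \<integral>\<^sup>+v. ennreal (exp (- (norm (z - sphere_point b t v))\<^sup>2 / (4 * u))) \<partial>sphere_measure b)"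
    have [measurable]: "I z \<in> borel_measurable borel" for z
    proof -
      have "I z = (\<lambda>t. \<integral>\<^sup>+v. ennreal (exp (- (norm (z - sphere_point b t v))\<^sup>2 / (4 * u))) * indicator (annuli b) v \<partial>lborel)"
        by (simp add: I_def sphere_measure_def nn_integral_restrict_space)
      then show ?thesis by simp
    qed
    define q where "q = sqrt (pi / u) ^ CARD('n)"
    have q: "0 \<le> q" using u by (simp add: q_def)
    have I_eq: "ennreal (\<integral>v. exp (- (norm (z - sphere_point b t v))\<^sup>2 / (4 * u)) \<partial>sphere_measure b) = I z t" for z t
      unfolding I_def
      by (intro nn_integral_eq_integral[symmetric] S.integrable_const_bound[of _ 1]) (use u in auto)
    have dens: "ennreal (distance_density b u P w t) = ennreal q * (\<Sum>x\<in>P. \<Sum>y\<in>P. ennreal (w x * w y) * I (x - y) t)" for t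
      unfolding distance_density_def I_eq[symmetric] q_def[symmetric] using P q
      by (simp add: ennreal_mult[symmetric] sum_ennreal sum_nonneg)
    have "ennreal (q * (c * sqrt u ^ CARD('n)) * (1 / 2)) \<le>
        ennreal q * (\<Sum>x\<in>P. \<Sum>y\<in>P. ennreal (w x * w y) * (\<integral>\<^sup>+t. indicator T t * I (x - y) t \<partial>lborel))"
    proof -
      have "ennreal ((c * sqrt u ^ CARD('n)) * (1 / 2)) \<le>
          ennreal (\<Sum>x\<in>P. \<Sum>y\<in>P. (if \<forall>j. 2 * a \<le> block_norm b j (x - y) then w x * w y else 0) * (c * sqrt u ^ CARD('n)))"
        unfolding sum_distrib_right[symmetric] using far c u
        by (intro ennreal_leI) (simp add: mult.commute mult_left_mono)
      also have "\<dots> = (\<Sum>x\<in>P. \<Sum>y\<in>P. ennreal ((if \<forall>j. 2 * a \<le> block_norm b j (x - y) then w x * w y else 0) * (c * sqrt u ^ CARD('n))))"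
        using P c u by (simp add: sum_ennreal sum_nonneg)
      also have "\<dots> \<le> (\<Sum>x\<in>P. \<Sum>y\<in>P. ennreal (w x * w y) * (\<integral>\<^sup>+t. indicator T t * I (x - y) t \<partial>lborel))"
      proof (intro sum_mono)
        fix x y assume xy: "x \<in> P" "y \<in> P"
        show "ennreal ((if \<forall>j. 2 * a \<le> block_norm b j (x - y) then w x * w y else 0) * (c * sqrt u ^ CARD('n))) \<le>
            ennreal (w x * w y) * (\<integral>\<^sup>+t. indicator T t * I (x - y) t \<partial>lborel)"
        proof (cases "\<forall>j. 2 * a \<le> block_norm b j (x - y)")
          case True
          have "ennreal (c * sqrt u ^ CARD('n)) \<le> (\<integral>\<^sup>+t. indicator T t * I (x - y) t \<partial>lborel)"
            unfolding I_def using True diam[OF xy] u by (intro c(2)) (auto intro: order.trans[OF block_norm_le_norm])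
          then show ?thesis using True P c u by (simp add: ennreal_mult mult_left_mono)
        qed auto
      qed
      finally have "ennreal q * ennreal ((c * sqrt u ^ CARD('n)) * (1 / 2)) \<le>
          ennreal q * (\<Sum>x\<in>P. \<Sum>y\<in>P. ennreal (w x * w y) * (\<integral>\<^sup>+t. indicator T t * I (x - y) t \<partial>lborel))"
        by (rule mult_left_mono) simp
      then show ?thesis using q c u by (simp add: ennreal_mult[symmetric] mult.assoc)
    qed
    also have "\<dots> = (\<integral>\<^sup>+t. indicator T t * ennreal (distance_density b u P w t) \<partial>lborel)"
    proof -
      have "indicator T t * ennreal (distance_density b u P w t) =
          ennreal q * (\<Sum>x\<in>P. \<Sum>y\<in>P. ennreal (w x * w y) * (indicator T t * I (x - y) t))" for t
        unfolding dens sum_distrib_left by (intro sum.cong refl) (simp only: mult_ac)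
      then show ?thesis by (simp add: nn_integral_sum nn_integral_cmult)
    qed
    also have "\<dots> \<le> (\<integral>\<^sup>+t. ennreal c' * indicator T t \<partial>lborel)"
      using small by (intro nn_integral_mono) (auto simp: indicator_def intro: ennreal_leI)
    also have "\<dots> = ennreal (c' * V)" using V c' by (simp add: nn_integral_cmult ennreal_mult)
    finally have "q * (c * sqrt u ^ CARD('n)) * (1 / 2) \<le> c' * V" using c' V by (simp add: ennreal_le_iff)
    moreover have "q * sqrt u ^ CARD('n) = sqrt pi ^ CARD('n)"
      using u by (simp add: q_def power_mult_distrib[symmetric] real_sqrt_mult[symmetric])
    ultimately have "sqrt pi ^ CARD('n) * c / 2 \<le> c' * V" by (simp add: mult_ac)
    also have "\<dots> \<le> c' * (V + 1)" using c' by simp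
    also have "\<dots> = sqrt pi ^ CARD('n) * c / 4"
    proof -
      have "x / (V + 1) * (V + 1) = x" for x using V(1) by simp
      then show ?thesis unfolding c'_def .
    qed
    finally show False using c(1) by simp
  qed
  show ?thesis by (intro exI[of _ c'] conjI[OF c'] allI impI, rule main) auto
qed

section \<open>Passage to the limit\<close>

lemma hausdorff_measure_nonzero_below_dim:
  assumes "ereal s < hausdorff_dim E" "0 \<le> s"
  shows "hausdorff_measure s E \<noteq> 0"
proof
  assume "hausdorff_measure s E = 0"
  then have "hausdorff_dim E \<le> ereal s"
    unfolding hausdorff_dim_def using assms(2) by (intro INF_lower) auto
  then show False using assms(1) by simp
qed

lemma compact_block_distance_set:
  fixes b :: "'n::finite \<Rightarrow> 'k::finite"
  assumes "compact E"
  shows "compact (block_distance_set b E)"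
proof -
  have "block_distance_set b E = (\<lambda>p. \<chi> j. block_norm b j (fst p - snd p)) ` (E \<times> E)"
    unfolding block_distance_set_def block_dist_eq by force
  moreover have "continuous_on (E \<times> E) (\<lambda>p. \<chi> j. block_norm b j (fst p - snd p))"
    by (intro continuous_on_vec_lambda continuous_on_compose2[OF continuous_on_block_norm[of UNIV]] continuous_intros) auto
  ultimately show ?thesis using assms by (simp add: compact_continuous_image compact_Times)
qed

text \<open>A subsequence of the centres converges to some l, and the ball of radius \<rho>/2 about
  l eventually lies in the balls of radius \<rho> along it. Points of that ball are approximated by
  D with errors tending to 0, and D is closed.\<close>

lemma interior_of_limit_balls:
  fixes D :: "(real ^ 'k) set"
  assumes D: "closed D" and K: "compact K" "\<And>n. N \<le> n \<Longrightarrow> t n \<in> K" and \<rho>: "0 < \<rho>" and \<eta>: "\<eta> \<longlonglongrightarrow> 0"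
    and near: "\<And>n \<tau>. N \<le> n \<Longrightarrow> norm (\<tau> - t n) \<le> \<rho> \<Longrightarrow> \<exists>p\<in>D. \<forall>j. \<bar>\<tau> $ j - p $ j\<bar> \<le> \<eta> n"
  shows "interior D \<noteq> {}"
proof -
  obtain l r where r: "l \<in> K" "strict_mono r" "((\<lambda>n. t (n + N)) \<circ> r) \<longlonglongrightarrow> l"
    by (rule seq_compactE[OF compact_imp_seq_compact[OF K(1)], of "\<lambda>n. t (n + N)"]) (use K(2) in auto)
  have "eventually (\<lambda>n. dist (t (r n + N)) l < \<rho> / 2) sequentially"
    using tendstoD[OF r(3), of "\<rho> / 2"] \<rho> by (simp add: o_def)
  then obtain M where M: "\<And>n. M \<le> n \<Longrightarrow> dist (t (r n + N)) l < \<rho> / 2" by (auto simp: eventually_sequentially)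
  have "ball l (\<rho> / 2) \<subseteq> D"
  proof
    fix \<tau> assume \<tau>: "\<tau> \<in> ball l (\<rho> / 2)"
    have "\<tau> \<in> closure D"
    proof (subst closure_approachable, intro allI impI)
      fix e :: real assume e: "0 < e"
      have "(\<lambda>n. real CARD('k) * \<eta> (r n + N)) \<longlonglongrightarrow> real CARD('k) * 0"
      proof (intro tendsto_mult_left)
        have "filterlim (\<lambda>n. r n + N) at_top sequentially"
          using r(2) by (intro filterlim_subseq) (simp add: strict_mono_def)
        then show "(\<lambda>n. \<eta> (r n + N)) \<longlonglongrightarrow> 0" by (rule filterlim_compose[OF \<eta>])
      qed
      then have "eventually (\<lambda>n. real CARD('k) * \<eta> (r n + N) < e) sequentially"
        using e by (intro order_tendstoD(2)) auto
      then obtain M' where M': "\<And>n. M' \<le> n \<Longrightarrow> real CARD('k) * \<eta> (r n + N) < e" by (auto simp: eventually_sequentially)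
      define n where "n = max M M'"
      have "norm (\<tau> - t (r n + N)) \<le> \<rho>"
      proof -
        have "dist \<tau> (t (r n + N)) \<le> dist l \<tau> + dist (t (r n + N)) l"
          using dist_triangle[of \<tau> "t (r n + N)" l] by (simp add: dist_commute)
        moreover have "dist l \<tau> < \<rho> / 2" "dist (t (r n + N)) l < \<rho> / 2" using \<tau> M[of n] by (auto simp: n_def)
        ultimately show ?thesis by (simp add: dist_norm)
      qed
      then obtain p where p: "p \<in> D" "\<And>j. \<bar>\<tau> $ j - p $ j\<bar> \<le> \<eta> (r n + N)"
        using near[of "r n + N" \<tau>] by (meson le_add2)
      have "norm (\<tau> - p) \<le> (\<Sum>j\<in>UNIV. \<bar>(\<tau> - p) $ j\<bar>)" by (rule norm_le_l1_cart)
      also have "\<dots> \<le> (\<Sum>j\<in>(UNIV::'k set). \<eta> (r n + N))" using p(2) by (intro sum_mono) simp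
      also have "\<dots> < e" using M'[of n] by (simp add: n_def)
      finally show "\<exists>y\<in>D. dist y \<tau> < e" using p(1) by (auto simp: dist_norm norm_minus_commute)
    qed
    then show "\<tau> \<in> D" using D by simp
  qed
  then have "l \<in> interior D" using \<rho> by (intro interiorI[of "ball l (\<rho> / 2)"]) auto
  then show ?thesis by auto
qed

theorem corollary1p4:
  fixes b :: "'n::finite \<Rightarrow> 'k::finite"
    and d :: "'k \<Rightarrow> nat"
    and E :: "(real ^ 'n) set"
  assumes "\<And>j. card {i. b i = j} = d j"
    and "\<And>j. d j > 1"
    and "compact E"
    and "hausdorff_dim E > ereal (real (\<Sum>j\<in>UNIV. d j) - 1 / 2 * (MIN j. real (d j) - 1))"
  shows "interior (block_distance_set b E) \<noteq> {}"
proof -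
  define A where "A = 1 / 2 * (MIN j. real (d j) - 1)"
  have card2: "2 \<le> card {i. b i = j}" for j using assms(1)[of j] assms(2)[of j] by simp
  have A_le: "A \<le> (real (card {i. b i = j}) - 1) / 2" for j
  proof -
    have "(MIN j. real (d j) - 1) \<le> real (d j) - 1" by (intro Min_le) auto
    then show ?thesis by (simp add: A_def assms(1))
  qed
  have A_pos: "0 < A"
  proof -
    have "1 \<le> (MIN j. real (d j) - 1)"
    proof (rule Min.boundedI)
      show "1 \<le> a" if "a \<in> range (\<lambda>j. real (d j) - 1)" for a
      proof -
        from that obtain j where "a = real (d j) - 1" by auto
        then show ?thesis using assms(2)[of j] by linarith
      qed
    qed auto
    then show ?thesis unfolding A_def by linarith
  qed
  have dim: "real (\<Sum>j\<in>UNIV. d j) = real CARD('n)"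
    using sum_over_blocks[where b=b and f="\<lambda>_. 1"] by (simp add: assms(1))
  \<comment> \<open>The minimum yields s \<le> d in addition to s < dim E, as
    \<open>frostman_spectral_tail\<close> demands; 0 < A leaves room for such an s.\<close>
  have "ereal (real CARD('n) - A) < min (hausdorff_dim E) (ereal (real CARD('n)))"
    using assms(4) A_pos unfolding dim A_def by simp
  then obtain s where s1: "ereal (real CARD('n) - A) < ereal s" "ereal s < min (hausdorff_dim E) (ereal (real CARD('n)))"
    using ereal_dense2 by blast
  then have s: "real CARD('n) - s < A" "s \<le> real CARD('n)" by auto
  have block_card: "real (card (- {i. b i = j})) = real CARD('n) - real (card {i. b i = j})" for j
    by (simp add: Compl_eq_Diff_UNIV card_Diff_subset of_nat_diff card_mono)
  \<comment> \<open>Since s > d - A and A \<le> (d_j - 1) / 2 < d_j, slabs that are thin in block j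
    have a positive exponent.\<close>
  have s_block: "0 < s - real (card (- {i. b i = j}))" for j
  proof -
    have "0 \<le> real (card {i. b i = j})" by simp
    then show ?thesis unfolding block_card using s(1) A_le[of j] by argo
  qed
  have s_pos: "0 < s"
  proof -
    have "0 \<le> real (card (- {i. b i = undefined}))" by simp
    then show ?thesis using s_block[of undefined] by argo
  qed
  have "hausdorff_measure s E \<noteq> 0"
    using s1(2) s_pos by (intro hausdorff_measure_nonzero_below_dim) auto
  then obtain C where C: "C > 0" "\<And>n. \<exists>P w. P \<subseteq> E \<and> frostman_weights C s n P w"
    using discrete_frostman[OF compact_imp_bounded[OF assms(3)] s_pos] by blast
  then obtain P w where P: "\<And>n. P n \<subseteq> E" and F: "\<And>n. frostman_weights C s n (P n) (w n)" by metis
  have P': "finite (P n)" "\<And>x. 0 \<le> w n x" "sum (w n) (P n) = 1" for n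
    using F[of n] by (auto simp: frostman_weights_def)
  obtain a where a: "0 < a" "2 * a \<le> 1" and pairs: "\<And>n P w. frostman_weights C s n P w \<Longrightarrow> 1 / 2 ^ n \<le> 2 * a \<Longrightarrow>
    1 / 2 \<le> (\<Sum>x\<in>P. \<Sum>y\<in>P. if \<forall>j. 2 * a \<le> block_norm b j (x - y) then w x * w y else 0)"
    using frostman_close_pairs[OF C(1) s_block] by auto
  obtain L where L: "\<And>x. x \<in> E \<Longrightarrow> norm x \<le> L" using compact_imp_bounded[OF assms(3)] by (auto simp: bounded_iff)
  define B where "B = 2 * \<bar>L\<bar> + 1"
  have B: "0 < B" by (simp add: B_def)
  have diam: "norm (x - y) \<le> B" if "x \<in> E" "y \<in> E" for x y
    using norm_triangle_ineq4[of x y] L[OF that(1)] L[OF that(2)] by (simp add: B_def)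
  obtain c where c: "0 < c" and large: "\<forall>u P w. 0 < u \<longrightarrow> sqrt u \<le> a / 4 \<longrightarrow> finite P \<longrightarrow> (\<forall>x. 0 \<le> w x) \<longrightarrow>
    (\<forall>x\<in>P. \<forall>y\<in>P. norm (x - y) \<le> B) \<longrightarrow>
    1 / 2 \<le> (\<Sum>x\<in>P. \<Sum>y\<in>P. if \<forall>j. 2 * a \<le> block_norm b j (x - y) then w x * w y else 0) \<longrightarrow>
    (\<exists>t. (\<forall>j. a \<le> t $ j \<and> t $ j \<le> 2 * B) \<and> c \<le> distance_density b u P w t)"
    using distance_density_large[OF a(1) B, of b] by (elim exE conjE) (rule that)
  obtain \<delta> where \<delta>: "0 < \<delta>" and equi: "\<And>n P w t t'. frostman_weights C s n P w \<Longrightarrow> (\<And>j. a / 2 \<le> t $ j) \<Longrightarrow>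
    (\<And>j. a / 2 \<le> t' $ j) \<Longrightarrow> norm (t - t') \<le> \<delta> \<Longrightarrow>
    \<bar>distance_density b ((1 / 4) ^ n) P w t - distance_density b ((1 / 4) ^ n) P w t'\<bar> \<le> c / 4"
    using distance_density_equicontinuous[OF card2 less_imp_le[OF A_pos] A_le less_imp_le[OF s_pos] s(2,1),
        of "a / 2" "c / 4" C] a(1) c by auto
  define \<rho> where "\<rho> = min \<delta> (a / 2)"
  \<comment> \<open>Much larger than the Gaussian width 2^-n, yet tending to 0. With u = 4^-n it
    gives \<eta>^2 / (4 u) = 2^n, so the tail exp (-2^n) beats the factor (2^n)^d of the
    normalization.\<close>
  define \<eta> where "\<eta> = (\<lambda>n::nat. 2 * sqrt (1 / 2 ^ n))"
  define m where "m = measure (sphere_measure b) (annuli b)"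
  have sqrt_u: "sqrt ((1 / 4) ^ n) = 1 / 2 ^ n" for n
    unfolding quarter_power by simp
  have "(\<lambda>n. (1 / 2 :: real) ^ n) \<longlonglongrightarrow> 0" by (intro LIMSEQ_power_zero) simp
  then have pow0: "(\<lambda>n. 1 / 2 ^ n :: real) \<longlonglongrightarrow> 0" by (simp add: power_one_over)
  have \<eta>0: "\<eta> \<longlonglongrightarrow> 0"
    unfolding \<eta>_def using tendsto_mult_left[OF tendsto_real_sqrt[OF pow0], of 2] by simp
  have "filterlim (\<lambda>n. 2 ^ n :: real) at_top sequentially"
    by real_asymp
  then have "(\<lambda>n. (2 ^ n) ^ CARD('n) / exp (2 ^ n :: real)) \<longlonglongrightarrow> 0"
    by (rule filterlim_compose[OF tendsto_power_div_exp_0])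
  then have "(\<lambda>n. sqrt pi ^ CARD('n) * m * ((2 ^ n) ^ CARD('n) / exp (2 ^ n :: real))) \<longlonglongrightarrow> sqrt pi ^ CARD('n) * m * 0"
    by (rule tendsto_mult_left)
  then have "eventually (\<lambda>n. sqrt pi ^ CARD('n) * m * ((2 ^ n) ^ CARD('n) / exp (2 ^ n :: real)) < c / 2) sequentially"
    using c by (intro order_tendstoD(2)) auto
  moreover have "eventually (\<lambda>n. 1 / 2 ^ n < a / 4) sequentially"
    using a(1) by (intro order_tendstoD(2)[OF pow0]) auto
  ultimately have "eventually (\<lambda>n. sqrt pi ^ CARD('n) * m * ((2 ^ n) ^ CARD('n) / exp (2 ^ n :: real)) < c / 2 \<and>
      1 / 2 ^ n < a / 4) sequentially" by (rule eventually_conj)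
  then obtain N where N: "\<And>n. N \<le> n \<Longrightarrow> sqrt pi ^ CARD('n) * m * ((2 ^ n) ^ CARD('n) / exp (2 ^ n :: real)) < c / 2"
      "\<And>n. N \<le> n \<Longrightarrow> 1 / 2 ^ n < a / 4"
    by (auto simp: eventually_sequentially)
  have "\<exists>t. (\<forall>j. a \<le> t $ j \<and> t $ j \<le> 2 * B) \<and> c \<le> distance_density b ((1 / 4) ^ n) (P n) (w n) t" if "N \<le> n" for n
  proof (rule large[rule_format])
    show "sqrt ((1 / 4) ^ n) \<le> a / 4" unfolding sqrt_u using N(2)[OF that] by simp
    show "1 / 2 \<le> (\<Sum>x\<in>P n. \<Sum>y\<in>P n. if \<forall>j. 2 * a \<le> block_norm b j (x - y) then w n x * w n y else 0)"
      using N(2)[OF that] a(1) by (intro pairs[OF F[of n]]) linarith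
  qed (use P' P diam in \<open>auto simp: subset_iff\<close>)
  then obtain t where t: "\<And>n j. N \<le> n \<Longrightarrow> a \<le> t n $ j \<and> t n $ j \<le> 2 * B"
      "\<And>n. N \<le> n \<Longrightarrow> c \<le> distance_density b ((1 / 4) ^ n) (P n) (w n) (t n)"
    by metis
  show ?thesis
  proof (rule interior_of_limit_balls[where K="cbox (\<chi> j. a) (\<chi> j. 2 * B)" and t=t and N=N and \<rho>=\<rho> and \<eta>=\<eta>])
    show "closed (block_distance_set b E)"
      using assms(3) by (intro compact_imp_closed compact_block_distance_set)
    show "0 < \<rho>" using \<delta> a by (simp add: \<rho>_def)
    show "t n \<in> cbox (\<chi> j. a) (\<chi> j. 2 * B)" if "N \<le> n" for n
      using t(1)[OF that] by (simp add: mem_box_cart)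
    fix n \<tau> assume n: "N \<le> n" and \<tau>: "norm (\<tau> - t n) \<le> \<rho>"
    let ?u = "(1 / 4 :: real) ^ n"
    have \<tau>_ge: "a / 2 \<le> \<tau> $ j" for j
    proof -
      have "\<bar>\<tau> $ j - t n $ j\<bar> \<le> norm (\<tau> - t n)" using component_le_norm_cart[of "\<tau> - t n" j] by simp
      moreover have "norm (\<tau> - t n) \<le> a / 2" using \<tau> by (simp add: \<rho>_def)
      moreover have "a \<le> t n $ j" using t(1)[OF n, of j] by simp
      ultimately show ?thesis by linarith
    qed
    have "\<bar>distance_density b ?u (P n) (w n) \<tau> - distance_density b ?u (P n) (w n) (t n)\<bar> \<le> c / 4"
    proof (rule equi[OF F])
      show "a / 2 \<le> t n $ j" for j using t(1)[OF n, of j] a by simp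
    qed (use \<tau>_ge \<tau> in \<open>auto simp: \<rho>_def\<close>)
    \<comment> \<open>At least c - c / 4 of the density survives at \<tau>. This exceeds c / 2, the
      level below which the Gaussian tails stay for n \<ge> N, so \<tau> must be close to a point of
      the distance set.\<close>
    then have "c / 2 < distance_density b ?u (P n) (w n) \<tau>" using t(2)[OF n] c by linarith
    moreover have "sqrt (pi / ?u) ^ CARD('n) * (m * exp (- (\<eta> n)\<^sup>2 / (4 * ?u))) < c / 2"
    proof -
      have "(\<eta> n)\<^sup>2 / (4 * ?u) = 2 ^ n"
        by (simp add: \<eta>_def quarter_power power_mult_distrib power2_eq_square[of "1 / 2 ^ n"])
      then have e: "exp (- (\<eta> n)\<^sup>2 / (4 * ?u)) = 1 / exp (2 ^ n)" by (simp add: exp_minus inverse_eq_divide)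
      have "sqrt (pi / ?u) = sqrt pi * 2 ^ n" unfolding real_sqrt_divide sqrt_u by simp
      then have "sqrt (pi / ?u) ^ CARD('n) * (m * exp (- (\<eta> n)\<^sup>2 / (4 * ?u))) =
          sqrt pi ^ CARD('n) * m * ((2 ^ n) ^ CARD('n) / exp (2 ^ n))"
        unfolding e by (simp add: power_mult_distrib)
      then show ?thesis using N(1)[OF n] by simp
    qed
    ultimately have "\<exists>x\<in>P n. \<exists>y\<in>P n. \<forall>j. \<bar>\<tau> $ j - block_dist b j x y\<bar> < \<eta> n"
      unfolding m_def using P' \<tau>_ge a
      by (intro distance_density_near[where u="?u" and w="w n"])
        (auto simp: \<eta>_def intro: order.trans[of 0 "a / 2"])
    then obtain x y where xy: "x \<in> P n" "y \<in> P n" "\<And>j. \<bar>\<tau> $ j - block_dist b j x y\<bar> < \<eta> n" by blast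
    show "\<exists>p\<in>block_distance_set b E. \<forall>j. \<bar>\<tau> $ j - p $ j\<bar> \<le> \<eta> n"
    proof (intro bexI[of _ "\<chi> j. block_dist b j x y"] allI)
      show "(\<chi> j. block_dist b j x y) \<in> block_distance_set b E"
        unfolding block_distance_set_def using xy(1,2) P[of n] by blast
    qed (use xy(3) in \<open>auto intro: less_imp_le\<close>)
  qed (use \<eta>0 in auto)
qed

end
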